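(* Let $V=\mathbb{C}^n$, let $G$ be a finite subgroup of $GL(V)$, and let $\alpha:G\times G\to\mathbb{C}^\times$ be a normalized two-cocycle. Let $d$ be the number of conjugacy classes of elements $g\in G$ such that $\operatorname{codim}V^g=2$ and $\det(h^{\perp})=\alpha(h,g)\alpha(g,h)^{-1}$ for all $h\in C(g)=\{h\in G\mid hg=gh\}$. Then the set of families $\{a_g\}_{g\in G}$ of skew-symmetric bilinear forms on $V$ for which the corresponding algebra $A$ is a twisted graded Hecke algebra (for $G$ and $\alpha$) forms a vector space over $\mathbb{C}$ of dimension $$d+\dim\left(\textstyle\bigwedge^2V\right)^G.$$
   Context: All algebras and vector spaces are over $\mathbb{C}$. A two-cocycle is a function $\alpha:G\times G\to\mathbb{C}^\times$ with $\alpha(g,h)\alpha(gh,k)=\alpha(h,k)\alpha(g,hk)$ for all $g,h,k\in G$; it is normalized if $\alpha(1,g)=\alpha(g,1)=1$ for all $g\in G$. If $S$ is an associative $\mathbb{C}$-algebra with an action of $G$ by algebra automorphisms, the crossed product algebra $S\#_{\alpha}G$ is the vector space $S\otimes\mathbb{C}G$ with multiplication $(r\otimes g)(s\otimes h)=\alpha(g,h)\,r(g\cdot s)\otimes gh$ for $r,s\in S$, $g,h\in G$; write $s\overline{g}$ for $s\otimes g$. The action of $G$ on $V$ induces actions on the tensor algebra $T(V)$ and the symmetric algebra $S(V)$. Let $t$ be an indeterminate and write $S\#_\alpha G[t]=\mathbb{C}[t]\otimes(S\#_\alpha G)$. Given skew-symmetric bilinear forms $a_g:V\times V\to\mathbb{C}$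 (one for each $g\in G$, possibly $0$), let $A$ be the quotient of $T(V)\#_\alpha G[t]$ by the two-sided ideal generated by all elements $$vw-wv-\sum_{g\in G}a_g(v,w)\,t\,\overline{g}\qquad (v,w\in V).$$ A choice of linear section $S(V)\hookrightarrow T(V)$ of the canonical projection $T(V)\to S(V)$ that preserves the grading (for example, writing monomials in the order $v_1^{i_1}\cdots v_n^{i_n}$ for a basis $v_1,\dots,v_n$ of $V$) induces a surjective $\mathbb{C}[t]$-linear map $S(V)\#_\alpha G[t]\to A$. One says $A$ is a twisted graded Hecke algebra (for $G$ and $\alpha$, defined by the forms $\{a_g\}_{g\in G}$) if this map is an isomorphism of $\mathbb{C}[t]$-modules. Equivalently, giving elements of $V$ degree 1 and elements of $G$ (and $t$) degree 0, $A$ is a filtered algebra over $\mathbb{C}[t]$, and it is a twisted graded Hecke algebra when the canonical surjection $S(V)\#_\alpha G[t]\to\operatorname{gr}A$ is an isomorphism. Families $\{a_g\}_{g\in G}$ are added and scaled componentwise. Fix a $G$-invariant nondegenerate Hermitian form on $V$; orthogonal complements are taken with respect to it. For $g\in G$, $V^g=\{v\in V\mid g\cdot v=v\}$. One has $(V^g)^\perp=\operatorname{im}(g-1)$ and $V=V^g\oplus (V^g)^\perp$. For $h\in G$ (with $g$ fixed), $h^{\perp}:(V^g)^{\perp}\to(V^g)^{\perp}$ is the composition of the restriction $h:(V^g)^\perp\to V$, the quotient map $V\to V/V^g$, and the natural isomorphism $V/V^g\cong(V^g)^\perp$ (i.e. $h$ restricted to $(V^g)^\perp$ followed by projection onto $(V^g)^\perp$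 along $V^g$). $(\bigwedge^2V)^G$ denotes the $G$-invariants of the exterior square of $V$. *)

theory Defs
  imports
    "HOL-Analysis.Analysis"
    "HOL-Library.Poly_Mapping"
    "HOL-Library.Function_Algebras"
    "HOL-Algebra.QuotRing"
    "HOL-Algebra.Module"
begin

definition GL :: "(complex^'n^'n) monoid" where
  "GL = \<lparr>carrier = {g. invertible g}, mult = (**), one = mat 1\<rparr>"

definition normalized_two_cocycle ::
  "(complex^'n^'n) set \<Rightarrow> (complex^'n^'n \<Rightarrow> complex^'n^'n \<Rightarrow> complex) \<Rightarrow> bool" where
  "normalized_two_cocycle G \<alpha> \<longleftrightarrow>
     (\<forall>g\<in>G. \<forall>h\<in>G. \<alpha> g h \<noteq> 0) \<and>
     (\<forall>g\<in>G. \<forall>h\<in>G. \<forall>k\<in>G. \<alpha> g h * \<alpha> (g ** h) k = \<alpha> h k * \<alpha> g (h ** k)) \<and>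
     (\<forall>g\<in>G. \<alpha> (mat 1) g = 1 \<and> \<alpha> g (mat 1) = 1)"

text \<open>
  The tensor algebra of \<open>V = complex^'n\<close> is the monoid algebra of the free monoid on \<open>'n\<close>
  (the word \<open>[i\<^sub>1, \<dots>, i\<^sub>k]\<close> stands for the tensor of the corresponding standard basis vectors),
  and the symmetric algebra is the monoid algebra of the free commutative monoid \<open>'n multiset\<close>.
  The product of a monoid algebra \<open>'m \<Rightarrow>\<^sub>0 'c\<close> is the library's convolution product, which
  needs the free monoid written additively.

  With coefficients in \<open>complex poly\<close>, the polynomial ring in \<open>t\<close>, these types are
  the tensor and symmetric algebras with \<open>t\<close> adjoined.
\<close>

instantiation list :: (type) monoid_add
begin

definition zero_list :: "'a list" where "zero_list = []"
definition plus_list :: "'a list \<Rightarrow> 'a list \<Rightarrow> 'a list" where "plus_list xs ys = xs @ ys"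

instance
  by standard (simp_all add: zero_list_def plus_list_def)

end

type_synonym ('n, 'c) tensor = "'n list \<Rightarrow>\<^sub>0 'c"
type_synonym ('n, 'c) symm = "'n multiset \<Rightarrow>\<^sub>0 'c"

abbreviation const :: "'c::zero \<Rightarrow> ('m::monoid_add \<Rightarrow>\<^sub>0 'c)" where
  "const c \<equiv> Poly_Mapping.single 0 c"

definition lin_ext :: "('m \<Rightarrow> ('k::monoid_add \<Rightarrow>\<^sub>0 'c::semiring_1)) \<Rightarrow> ('m \<Rightarrow>\<^sub>0 'c) \<Rightarrow> ('k \<Rightarrow>\<^sub>0 'c)" where
  "lin_ext \<phi> f = (\<Sum>m\<in>Poly_Mapping.keys f. const (Poly_Mapping.lookup f m) * \<phi> m)"

definition vec_tensor :: "complex^'n \<Rightarrow> ('n, complex poly) tensor" where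
  "vec_tensor v = (\<Sum>i\<in>UNIV. Poly_Mapping.single [i] [:v $ i:])"

definition vec_symm :: "complex^'n \<Rightarrow> ('n, complex poly) symm" where
  "vec_symm v = (\<Sum>i\<in>UNIV. Poly_Mapping.single {#i#} [:v $ i:])"

definition act_tensor ::
  "complex^'n^'n \<Rightarrow> ('n, complex poly) tensor \<Rightarrow> ('n, complex poly) tensor" where
  "act_tensor g = lin_ext (\<lambda>w. prod_list (map (\<lambda>j. vec_tensor (g *v axis j 1)) w))"

definition act_symm ::
  "complex^'n^'n \<Rightarrow> ('n, complex poly) symm \<Rightarrow> ('n, complex poly) symm" where
  "act_symm g = lin_ext (\<lambda>m. \<Prod>j\<in>#m. vec_symm (g *v axis j 1))"

definition symm_proj :: "('n, complex) tensor \<Rightarrow> ('n, complex) symm" where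
  "symm_proj f = (\<Sum>w\<in>Poly_Mapping.keys f. Poly_Mapping.single (mset w) (Poly_Mapping.lookup f w))"

text \<open>Multiplication by \<open>const c\<close> is scalar multiplication by \<open>c\<close>.\<close>

definition graded_section :: "(('n, complex) symm \<Rightarrow> ('n, complex) tensor) \<Rightarrow> bool" where
  "graded_section \<sigma> \<longleftrightarrow>
     (\<forall>f f'. \<sigma> (f + f') = \<sigma> f + \<sigma> f') \<and>
     (\<forall>c f. \<sigma> (const c * f) = const c * \<sigma> f) \<and>
     (\<forall>f. symm_proj (\<sigma> f) = f) \<and>
     (\<forall>d f. (\<forall>m\<in>Poly_Mapping.keys f. size m = d) \<longrightarrow> (\<forall>w\<in>Poly_Mapping.keys (\<sigma> f). length w = d))"

definition extend_section ::
  "(('n, complex) symm \<Rightarrow> ('n, complex) tensor) \<Rightarrow> ('n, complex poly) symm \<Rightarrow> ('n, complex poly) tensor" where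
  "extend_section \<sigma> = lin_ext (\<lambda>m. Poly_Mapping.map (\<lambda>c. [:c:]) (\<sigma> (Poly_Mapping.single m 1)))"

text \<open>
  For an algebra \<open>S\<close> with \<open>t\<close> adjoined to it (a monoid algebra over \<open>complex poly\<close>), the crossed
  product with \<open>t\<close> adjoined: the element \<open>\<Sum>\<^sub>g s\<^sub>g g\<close> is the function \<open>g \<mapsto> s\<^sub>g\<close>, extended by \<open>0\<close>
  outside \<open>G\<close>; a single term \<open>s g\<close> is \<open>cp_elem s g\<close> below. It is a module over the polynomial ring in \<open>t\<close>.
\<close>

definition crossed_product ::
  "(complex^'n^'n) set \<Rightarrow> (complex^'n^'n \<Rightarrow> complex^'n^'n \<Rightarrow> complex) \<Rightarrow>
   (complex^'n^'n \<Rightarrow> ('m::monoid_add \<Rightarrow>\<^sub>0 complex poly) \<Rightarrow> ('m \<Rightarrow>\<^sub>0 complex poly)) \<Rightarrow>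
   (complex poly, complex^'n^'n \<Rightarrow> ('m \<Rightarrow>\<^sub>0 complex poly)) module" where
  "crossed_product G \<alpha> act =
     \<lparr>carrier = {x. \<forall>g. g \<notin> G \<longrightarrow> x g = 0},
      mult = (\<lambda>x y k. \<Sum>(g, h) | g \<in> G \<and> h \<in> G \<and> g ** h = k. const [:\<alpha> g h:] * x g * act g (y h)),
      one = (\<lambda>g. if g = mat 1 then 1 else 0),
      zero = 0,
      add = (+),
      smult = (\<lambda>p x g. const p * x g)\<rparr>"

abbreviation tensor_cp ::
  "(complex^'n^'n) set \<Rightarrow> (complex^'n^'n \<Rightarrow> complex^'n^'n \<Rightarrow> complex) \<Rightarrow>
   (complex poly, complex^'n^'n \<Rightarrow> ('n, complex poly) tensor) module" where
  "tensor_cp G \<alpha> \<equiv> crossed_product G \<alpha> act_tensor"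

abbreviation symm_cp ::
  "(complex^'n^'n) set \<Rightarrow> (complex^'n^'n \<Rightarrow> complex^'n^'n \<Rightarrow> complex) \<Rightarrow>
   (complex poly, complex^'n^'n \<Rightarrow> ('n, complex poly) symm) module" where
  "symm_cp G \<alpha> \<equiv> crossed_product G \<alpha> act_symm"

definition cp_elem :: "'s::zero \<Rightarrow> complex^'n^'n \<Rightarrow> (complex^'n^'n \<Rightarrow> 's)" where
  "cp_elem s g = (\<lambda>h. if h = g then s else 0)"

type_synonym 'n form_family = "complex^'n^'n \<Rightarrow> complex^'n \<Rightarrow> complex^'n \<Rightarrow> complex"

definition skew_bilinear :: "(complex^'n \<Rightarrow> complex^'n \<Rightarrow> complex) \<Rightarrow> bool" where
  "skew_bilinear b \<longleftrightarrow>
     (\<forall>w. Vector_Spaces.linear (*s) (*) (\<lambda>v. b v w)) \<and>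
     (\<forall>v. Vector_Spaces.linear (*s) (*) (\<lambda>w. b v w)) \<and>
     (\<forall>v w. b v w = - b w v)"

text \<open>Here \<open>monom c 1\<close> is \<open>c * t\<close>.\<close>

definition hecke_relation ::
  "(complex^'n^'n) set \<Rightarrow> 'n form_family \<Rightarrow> complex^'n \<Rightarrow> complex^'n \<Rightarrow>
   (complex^'n^'n \<Rightarrow> ('n, complex poly) tensor)" where
  "hecke_relation G a v w =
     cp_elem (vec_tensor v * vec_tensor w - vec_tensor w * vec_tensor v) (mat 1)
     - (\<Sum>g\<in>G. cp_elem (const (monom (a g v w) 1)) g)"

definition hecke_ideal ::
  "(complex^'n^'n) set \<Rightarrow> (complex^'n^'n \<Rightarrow> complex^'n^'n \<Rightarrow> complex) \<Rightarrow> 'n form_family \<Rightarrow>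
   (complex^'n^'n \<Rightarrow> ('n, complex poly) tensor) set" where
  "hecke_ideal G \<alpha> a = genideal (tensor_cp G \<alpha>) {hecke_relation G a v w | v w. True}"

definition quotient_algebra :: "('p, 'a) module \<Rightarrow> 'a set \<Rightarrow> ('p, 'a set) module" where
  "quotient_algebra R I =
     ring.extend (R Quot I) \<lparr>smult = (\<lambda>p X. \<Union>x\<in>X. I +>\<^bsub>R\<^esub> (p \<odot>\<^bsub>R\<^esub> x))\<rparr>"

definition hecke_algebra ::
  "(complex^'n^'n) set \<Rightarrow> (complex^'n^'n \<Rightarrow> complex^'n^'n \<Rightarrow> complex) \<Rightarrow> 'n form_family \<Rightarrow>
   (complex poly, (complex^'n^'n \<Rightarrow> ('n, complex poly) tensor) set) module" where
  "hecke_algebra G \<alpha> a = quotient_algebra (tensor_cp G \<alpha>) (hecke_ideal G \<alpha> a)"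

definition hecke_map ::
  "(complex^'n^'n) set \<Rightarrow> (complex^'n^'n \<Rightarrow> complex^'n^'n \<Rightarrow> complex) \<Rightarrow>
   (('n, complex) symm \<Rightarrow> ('n, complex) tensor) \<Rightarrow> 'n form_family \<Rightarrow>
   (complex^'n^'n \<Rightarrow> ('n, complex poly) symm) \<Rightarrow> (complex^'n^'n \<Rightarrow> ('n, complex poly) tensor) set" where
  "hecke_map G \<alpha> \<sigma> a x = hecke_ideal G \<alpha> a +>\<^bsub>tensor_cp G \<alpha>\<^esub> (\<lambda>g. extend_section \<sigma> (x g))"

definition module_iso :: "('p, 'a) module \<Rightarrow> ('p, 'b) module \<Rightarrow> ('a \<Rightarrow> 'b) \<Rightarrow> bool" where
  "module_iso M N \<phi> \<longleftrightarrow>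
     bij_betw \<phi> (carrier M) (carrier N) \<and>
     (\<forall>x\<in>carrier M. \<forall>y\<in>carrier M. \<phi> (x \<oplus>\<^bsub>M\<^esub> y) = \<phi> x \<oplus>\<^bsub>N\<^esub> \<phi> y) \<and>
     (\<forall>p. \<forall>x\<in>carrier M. \<phi> (p \<odot>\<^bsub>M\<^esub> x) = p \<odot>\<^bsub>N\<^esub> \<phi> x)"

definition twisted_graded_hecke ::
  "(complex^'n^'n) set \<Rightarrow> (complex^'n^'n \<Rightarrow> complex^'n^'n \<Rightarrow> complex) \<Rightarrow>
   (('n, complex) symm \<Rightarrow> ('n, complex) tensor) \<Rightarrow> 'n form_family \<Rightarrow> bool" where
  "twisted_graded_hecke G \<alpha> \<sigma> a \<longleftrightarrow>
     module_iso (symm_cp G \<alpha>) (hecke_algebra G \<alpha> a) (hecke_map G \<alpha> \<sigma> a)"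

text \<open>Families indexed by \<open>G\<close> are extended by \<open>0\<close> outside \<open>G\<close>.\<close>

definition hecke_families ::
  "(complex^'n^'n) set \<Rightarrow> (complex^'n^'n \<Rightarrow> complex^'n^'n \<Rightarrow> complex) \<Rightarrow>
   (('n, complex) symm \<Rightarrow> ('n, complex) tensor) \<Rightarrow> 'n form_family set" where
  "hecke_families G \<alpha> \<sigma> =
     {a. (\<forall>g. g \<notin> G \<longrightarrow> a g = 0) \<and> (\<forall>g\<in>G. skew_bilinear (a g)) \<and> twisted_graded_hecke G \<alpha> \<sigma> a}"

interpretation fam: vector_space "\<lambda>(c::complex) (a :: 'n form_family) g v w. c * a g v w"
  by unfold_locales (simp_all add: fun_eq_iff algebra_simps)

definition invariant_hermitian_form ::
  "(complex^'n^'n) set \<Rightarrow> (complex^'n \<Rightarrow> complex^'n \<Rightarrow> complex) \<Rightarrow> bool" where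
  "invariant_hermitian_form G B \<longleftrightarrow>
     (\<forall>w. Vector_Spaces.linear (*s) (*) (\<lambda>v. B v w)) \<and>
     (\<forall>v w. B w v = cnj (B v w)) \<and>
     (\<forall>v. (\<forall>w. B v w = 0) \<longrightarrow> v = 0) \<and>
     (\<forall>g\<in>G. \<forall>v w. B (g *v v) (g *v w) = B v w)"

definition fixed_space :: "complex^'n^'n \<Rightarrow> (complex^'n) set" where
  "fixed_space g = {v. g *v v = v}"

definition fixed_perp ::
  "(complex^'n \<Rightarrow> complex^'n \<Rightarrow> complex) \<Rightarrow> complex^'n^'n \<Rightarrow> (complex^'n) set" where
  "fixed_perp B g = {v. \<forall>w\<in>fixed_space g. B v w = 0}"

text \<open>\<open>h\<close> on \<open>fixed_perp B g\<close> followed by the projection to \<open>fixed_perp B g\<close> along \<open>fixed_space g\<close>.\<close>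

definition h_perp ::
  "(complex^'n \<Rightarrow> complex^'n \<Rightarrow> complex) \<Rightarrow> complex^'n^'n \<Rightarrow> complex^'n^'n \<Rightarrow> complex^'n \<Rightarrow> complex^'n" where
  "h_perp B g h v = (THE w. w \<in> fixed_perp B g \<and> h *v v - w \<in> fixed_space g)"

text \<open>
  Determinant of a linear endomorphism \<open>f\<close> of a subspace \<open>W\<close>: Leibniz formula for its matrix in
  any basis of \<open>W\<close>, with rows and columns indexed by the basis vectors themselves.
\<close>

definition subspace_det :: "(complex^'n) set \<Rightarrow> (complex^'n \<Rightarrow> complex^'n) \<Rightarrow> complex" where
  "subspace_det W f =
     (let E = SOME E. vec.independent E \<and> vec.span E = W
      in \<Sum>p | p permutes E. of_int (sign p) * (\<Prod>b\<in>E. vec.representation E (f b) (p b)))"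

definition centralizer :: "(complex^'n^'n) set \<Rightarrow> complex^'n^'n \<Rightarrow> (complex^'n^'n) set" where
  "centralizer G g = {h\<in>G. h ** g = g ** h}"

definition conj_class :: "(complex^'n^'n) set \<Rightarrow> complex^'n^'n \<Rightarrow> (complex^'n^'n) set" where
  "conj_class G g = {h ** g ** matrix_inv h | h. h \<in> G}"

definition contributing_classes ::
  "(complex^'n^'n) set \<Rightarrow> (complex^'n^'n \<Rightarrow> complex^'n^'n \<Rightarrow> complex) \<Rightarrow>
   (complex^'n \<Rightarrow> complex^'n \<Rightarrow> complex) \<Rightarrow> (complex^'n^'n) set set" where
  "contributing_classes G \<alpha> B =
     {conj_class G g | g. g \<in> G \<and> CARD('n) - vec.dim (fixed_space g) = 2 \<and>
        (\<forall>h\<in>centralizer G g.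
           subspace_det (fixed_perp B g) (h_perp B g h) = \<alpha> h g * inverse (\<alpha> g h))}"

text \<open>
  The tensor square of \<open>complex^'n\<close> is \<open>complex^('n \<times> 'n)\<close>; the exterior square is the subspace
  spanned by the alternating tensors \<open>v \<otimes> w - w \<otimes> v\<close>.
\<close>

definition wedge :: "complex^'n \<Rightarrow> complex^'n \<Rightarrow> complex^('n \<times> 'n)" where
  "wedge v w = (\<chi> p. v $ fst p * w $ snd p - w $ fst p * v $ snd p)"

definition ext_square :: "(complex^('n::finite \<times> 'n)) set" where
  "ext_square = vec.span {wedge v w | v w. True}"

definition tensor_square_act :: "complex^'n^'n \<Rightarrow> complex^('n \<times> 'n) \<Rightarrow> complex^('n \<times> 'n)" where
  "tensor_square_act g x = (\<chi> p. \<Sum>q\<in>UNIV. g $ fst p $ fst q * g $ snd p $ snd q * x $ q)"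

definition ext_square_invariants :: "(complex^'n^'n) set \<Rightarrow> (complex^('n \<times> 'n)) set" where
  "ext_square_invariants G = {x\<in>ext_square. \<forall>g\<in>G. tensor_square_act g x = x}"

end

theory Submission
  imports Defs
begin

text \<open>
  Write \<open>r(v,w)\<close> for the defining relations. The algebra is a twisted graded Hecke algebra iff
  (1) \<open>a\<^bsub>hgh'\<^esub>(hv,hw) \<alpha>(hgh',h) = \<alpha>(h,g) a\<^sub>g(v,w)\<close> for \<open>h'\<close> the inverse of \<open>h\<close>, and
  (2) the cyclic sum of \<open>a\<^sub>g(v,w) (u - gu)\<close> vanishes for every \<open>g\<close>.
  These are necessary because the elements \<open>h r(v,w) - r(hv,hw) h\<close> and the cyclic sum of
  \<open>[u, r(v,w)]\<close> of the ideal have degree 0 and 1, where every graded section is the obvious one.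
  They suffice by a diamond argument: rewriting descents \<open>xy\<close> of a word to \<open>yx\<close> plus lower terms
  gives a normal form which does not depend on the order of the steps, hence vanishes on the
  ideal, and which is the projection to the symmetric algebra up to terms of lower degree.

  For \<open>g \<noteq> 1\<close>, averaging \<open>a\<^sub>g(u,_)\<close> over the powers of \<open>g\<close> and (2) show that \<open>V\<^sup>g\<close> lies in the kernel
  of \<open>a\<^sub>g\<close>, and then (2) says that \<open>a\<^sub>g = 0\<close> or \<open>codim V\<^sup>g = 2\<close>. So \<open>a\<^sub>g\<close> is a multiple of a volume form on
  \<open>V / V\<^sup>g\<close>, on which the centralizer acts by \<open>det h\<^sup>\<bottom>\<close>, and (1) leaves one free scalar for every
  contributing class. At \<open>g = 1\<close> the form is any invariant one; the Hermitian form turns these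
  conjugate-linearly into the invariants of the exterior square.
\<close>

section \<open>Monoid algebras and linear extension\<close>

text \<open>A group element \<open>g\<close> that moves right past a word turns its letters into
  linear combinations, so replacing a pair of letters leaves a tensor and not a word. The rewriting
  therefore recurses through linear extension, and independence of the order is known in shorter
  lengths for all vectors and homogeneous tensors before it is used for longer words. Every word
  ends in a group element \<open>k\<close>; the values of \<alpha> that arise when \<open>g\<close>
  meets \<open>k\<close> are the ones that (1) and the cocycle identity balance. The forms decide
  only injectivity: sorting words makes the map onto for every family. The Hermitian form may be
  indefinite, so a vector orthogonal to itself need not vanish. Averaging over the powers of a group
  element, together with nondegeneracy, takes the place of positivity in splitting the space. The
  passage from invariants of the exterior square to forms is only conjugate-linear. The dimension is
  therefore counted on an explicit basis, with conjugated coefficients, instead of through a linear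
  isomorphism.\<close>

lemma poly_mapping_sum_single:
  "f = (\<Sum>m\<in>Poly_Mapping.keys f. Poly_Mapping.single m (Poly_Mapping.lookup f m))"
  by (rule poly_mapping_eqI)
     (auto simp: lookup_sum lookup_single when_def in_keys_iff sum.delta)

lemma poly_mapping_keys_induct [consumes 1, case_names zero single add]:
  fixes f :: "'m \<Rightarrow>\<^sub>0 'c::comm_monoid_add"
  assumes "Poly_Mapping.keys f \<subseteq> K"
    and "P 0" "\<And>m c. m \<in> K \<Longrightarrow> P (Poly_Mapping.single m c)"
    and "\<And>f g. P f \<Longrightarrow> P g \<Longrightarrow> P (f + g)"
  shows "P f"
proof -
  have "P (\<Sum>m\<in>F. Poly_Mapping.single m (Poly_Mapping.lookup f m))"
    if "finite F" "F \<subseteq> K" for F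
    using that by (induction F rule: finite_induct) (auto intro: assms)
  from this[of "Poly_Mapping.keys f"] assms(1) show ?thesis
    by (simp flip: poly_mapping_sum_single)
qed

lemma const_mult_comm:
  fixes f :: "'m::monoid_add \<Rightarrow>\<^sub>0 'c::comm_semiring_1"
  shows "f * const c = const c * f"
proof -
  have "Poly_Mapping.keys f \<subseteq> UNIV" by simp
  then show ?thesis
    by (induction f rule: poly_mapping_keys_induct)
      (simp_all add: mult_single mult.commute distrib_right distrib_left)
qed

lemma lookup_const_mult:
  fixes f :: "'m::monoid_add \<Rightarrow>\<^sub>0 'c::semiring_1"
  shows "Poly_Mapping.lookup (const c * f) m = c * Poly_Mapping.lookup f m"
proof -
  have "Poly_Mapping.keys f \<subseteq> UNIV" by simp
  then show ?thesis
    by (induction f rule: poly_mapping_keys_induct)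
      (simp_all add: mult_single distrib_left lookup_add lookup_single when_def)
qed

text \<open>Cancellation makes the support of a sum unpredictable. Summing over a common finite
  superset of the supports is what gives additivity of \<open>lin_ext\<close>.\<close>

lemma lin_ext_superset:
  fixes \<phi> :: "'m \<Rightarrow> ('k::monoid_add \<Rightarrow>\<^sub>0 'c::semiring_1)"
  assumes "finite K" "Poly_Mapping.keys f \<subseteq> K"
  shows "lin_ext \<phi> f = (\<Sum>m\<in>K. const (Poly_Mapping.lookup f m) * \<phi> m)"
  unfolding lin_ext_def
  by (rule sum.mono_neutral_left) (use assms in \<open>auto simp: in_keys_iff\<close>)

text \<open>As a congruence rule it tells the function package that a recursive call under
  \<open>lin_ext\<close> happens only at words of the support, whose length is under control. The
  termination of \<open>normal_form\<close> depends on it.\<close>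

lemma lin_ext_cong [fundef_cong]:
  assumes "f = g" "\<And>m. m \<in> Poly_Mapping.keys g \<Longrightarrow> \<phi> m = \<psi> m"
  shows "lin_ext \<phi> f = lin_ext \<psi> g"
  using assms by (simp add: lin_ext_def)

lemma lin_ext_zero [simp]: "lin_ext \<phi> 0 = 0"
  by (simp add: lin_ext_def)

lemma lin_ext_single:
  fixes \<phi> :: "'m \<Rightarrow> ('k::monoid_add \<Rightarrow>\<^sub>0 'c::semiring_1)"
  shows "lin_ext \<phi> (Poly_Mapping.single m c) = const c * \<phi> m"
  by (subst lin_ext_superset[of "{m}"]) auto

lemma lin_ext_add:
  fixes \<phi> :: "'m \<Rightarrow> ('k::monoid_add \<Rightarrow>\<^sub>0 'c::semiring_1)"
  shows "lin_ext \<phi> (f + g) = lin_ext \<phi> f + lin_ext \<phi> g"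
proof -
  let ?K = "Poly_Mapping.keys f \<union> Poly_Mapping.keys g"
  have "lin_ext \<phi> (f + g) = (\<Sum>m\<in>?K. const (Poly_Mapping.lookup (f + g) m) * \<phi> m)"
    by (rule lin_ext_superset) (use Poly_Mapping.keys_add[of f g] in auto)
  also have "\<dots> = (\<Sum>m\<in>?K. const (Poly_Mapping.lookup f m) * \<phi> m) + (\<Sum>m\<in>?K. const (Poly_Mapping.lookup g m) * \<phi> m)"
    by (simp add: lookup_add single_add distrib_right sum.distrib)
  also have "\<dots> = lin_ext \<phi> f + lin_ext \<phi> g"
    by (subst (1 2) lin_ext_superset[of ?K]) auto
  finally show ?thesis .
qed

lemma lin_ext_sum:
  fixes \<phi> :: "'m \<Rightarrow> ('k::monoid_add \<Rightarrow>\<^sub>0 'c::semiring_1)"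
  shows "lin_ext \<phi> (sum F I) = (\<Sum>i\<in>I. lin_ext \<phi> (F i))"
  by (induction I rule: infinite_finite_induct) (auto simp: lin_ext_add)

lemma lin_ext_const_mult:
  fixes \<phi> :: "'m::monoid_add \<Rightarrow> ('k::monoid_add \<Rightarrow>\<^sub>0 'c::semiring_1)"
  shows "lin_ext \<phi> (const c * f) = const c * lin_ext \<phi> f"
proof -
  have "Poly_Mapping.keys f \<subseteq> UNIV" by simp
  then show ?thesis
    by (induction f rule: poly_mapping_keys_induct)
      (simp_all add: lin_ext_add lin_ext_single mult_single distrib_left flip: mult.assoc)
qed

lemma lin_ext_diff:
  fixes \<phi> :: "'m \<Rightarrow> ('k::monoid_add \<Rightarrow>\<^sub>0 'c::ring_1)"
  shows "lin_ext \<phi> (f - g) = lin_ext \<phi> f - lin_ext \<phi> g"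
  by (metis add_diff_cancel diff_add_cancel lin_ext_add)

lemma lin_ext_mult:
  fixes \<phi> :: "'m::monoid_add \<Rightarrow> ('k::monoid_add \<Rightarrow>\<^sub>0 'c::comm_semiring_1)"
  assumes "\<And>m m'. \<phi> (m + m') = \<phi> m * \<phi> m'"
  shows "lin_ext \<phi> (f * g) = lin_ext \<phi> f * lin_ext \<phi> g"
proof -
  have "Poly_Mapping.keys f \<subseteq> UNIV" by simp
  then show ?thesis
  proof (induction f rule: poly_mapping_keys_induct)
    case (single m c)
    have "Poly_Mapping.keys g \<subseteq> UNIV" by simp
    then show ?case
    proof (induction g rule: poly_mapping_keys_induct)
      case (single m' c')
      have "const c * \<phi> m * (const c' * \<phi> m') = const c * (\<phi> m * const c') * \<phi> m'"
        by (simp add: mult.assoc)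
      also have "\<dots> = const (c * c') * \<phi> (m + m')"
        by (simp add: const_mult_comm[of "\<phi> m"] assms mult_single flip: mult.assoc)
      finally show ?case by (simp add: lin_ext_single mult_single)
    qed (simp_all add: distrib_left lin_ext_add)
  qed (simp_all add: distrib_right lin_ext_add)
qed

section \<open>The group action on the tensor algebra\<close>

lemma list_plus_eq_append [simp]: "(xs :: 'a list) + ys = xs @ ys"
  by (simp add: plus_list_def)

lemma zero_list_append [simp]: "(0 :: 'a list) @ xs = xs" "xs @ (0 :: 'a list) = xs"
  by (simp_all add: zero_list_def)

lemma single_Nil [simp]: "Poly_Mapping.single [] c = const c"
  by (simp add: zero_list_def)

lemma length_zero_list [simp]: "length (0 :: 'a list) = 0"
  by (simp add: zero_list_def)

lemma vec_tensor_add: "vec_tensor (v + w) = vec_tensor v + vec_tensor w"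
  unfolding vec_tensor_def sum.distrib[symmetric] single_add[symmetric] by simp

lemma vec_tensor_scale: "vec_tensor (c *s v) = const [:c:] * vec_tensor v"
  by (simp add: vec_tensor_def sum_distrib_left mult_single mult.commute)

lemma vec_tensor_zero [simp]: "vec_tensor 0 = 0"
  by (simp add: vec_tensor_def)

lemma vec_tensor_diff: "vec_tensor (v - w) = vec_tensor v - vec_tensor w"
  by (metis add_diff_cancel diff_add_cancel vec_tensor_add)

lemma vec_tensor_sum: "vec_tensor (sum f I) = (\<Sum>i\<in>I. vec_tensor (f i))"
  by (induction I rule: infinite_finite_induct) (auto simp: vec_tensor_add)

lemma vec_tensor_axis: "vec_tensor (axis i 1) = Poly_Mapping.single [i] 1"
proof -
  have "vec_tensor (axis i (1::complex)) = (\<Sum>j\<in>UNIV. if j = i then Poly_Mapping.single [i] 1 else 0)"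
    unfolding vec_tensor_def by (rule sum.cong) (auto simp: axis_def one_pCons)
  then show ?thesis by simp
qed

lemma act_tensor_add: "act_tensor g (x + y) = act_tensor g x + act_tensor g y"
  by (simp add: act_tensor_def lin_ext_add)

lemma act_tensor_diff: "act_tensor g (x - y) = act_tensor g x - act_tensor g y"
  by (simp add: act_tensor_def lin_ext_diff)

lemma act_tensor_zero [simp]: "act_tensor g 0 = 0"
  by (simp add: act_tensor_def)

lemma act_tensor_const_mult: "act_tensor g (const c * x) = const c * act_tensor g x"
  unfolding act_tensor_def by (rule lin_ext_const_mult)

lemma act_tensor_mult: "act_tensor g (x * y) = act_tensor g x * act_tensor g y"
  unfolding act_tensor_def by (rule lin_ext_mult) simp

lemma act_tensor_const [simp]: "act_tensor g (const c) = const c"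
  by (simp add: act_tensor_def lin_ext_single zero_list_def del: single_Nil)

lemma act_tensor_one [simp]: "act_tensor g 1 = 1"
  using act_tensor_const[of g 1] by simp

lemma act_tensor_single:
  "act_tensor g (Poly_Mapping.single w c) = const c * prod_list (map (\<lambda>j. vec_tensor (g *v axis j 1)) w)"
  by (simp add: act_tensor_def lin_ext_single)

lemma vec_eq_sum_axis: "(v :: complex^'n) = (\<Sum>i\<in>UNIV. v $ i *s axis i 1)"
  by (simp add: vec_eq_iff axis_def if_distrib[of "(*) _"] cong: if_cong)

lemma act_tensor_vec: "act_tensor g (vec_tensor v) = vec_tensor (g *v v)"
proof -
  have "act_tensor g (vec_tensor v) = (\<Sum>i\<in>UNIV. const [:v $ i:] * vec_tensor (g *v axis i 1))"
    by (simp add: vec_tensor_def[of v] act_tensor_def lin_ext_sum lin_ext_single)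
  also have "\<dots> = vec_tensor (g *v (\<Sum>i\<in>UNIV. v $ i *s axis i 1))"
    by (simp add: vec.linear_sum[OF matrix_vector_mul_linear_gen] vector_scalar_commute vec_tensor_sum vec_tensor_scale)
  finally show ?thesis unfolding vec_eq_sum_axis[of v, symmetric] .
qed

lemma act_tensor_matrix_mult: "act_tensor (g ** h) x = act_tensor g (act_tensor h x)"
proof -
  have "Poly_Mapping.keys x \<subseteq> UNIV" by simp
  then show ?thesis
  proof (induction x rule: poly_mapping_keys_induct)
    case (single w c)
    have "prod_list (map (\<lambda>j. vec_tensor (g ** h *v axis j 1)) w) =
        act_tensor g (prod_list (map (\<lambda>j. vec_tensor (h *v axis j 1)) w))"
      by (induction w) (auto simp: act_tensor_mult act_tensor_vec matrix_vector_mul_assoc)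
    then show ?case by (simp add: act_tensor_single act_tensor_const_mult)
  qed (auto simp: act_tensor_add)
qed

lemma act_tensor_id [simp]: "act_tensor (mat 1) x = x"
proof -
  have "Poly_Mapping.keys x \<subseteq> UNIV" by simp
  then show ?thesis
  proof (induction x rule: poly_mapping_keys_induct)
    case (single w c)
    have "prod_list (map (\<lambda>j. vec_tensor (axis j 1)) w) = Poly_Mapping.single w (1 :: complex poly)"
      by (induction w) (auto simp: vec_tensor_axis mult_single)
    then show ?case by (simp add: act_tensor_single mult_single)
  qed (auto simp: act_tensor_add)
qed

text \<open>Degree in the vector space only: \<open>t\<close> sits in the coefficients and has
  degree 0. Neither scalars nor the group action changes this degree.\<close>

definition homog :: "nat \<Rightarrow> ('n, 'c::zero) tensor \<Rightarrow> bool" where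
  "homog d x \<longleftrightarrow> (\<forall>w\<in>Poly_Mapping.keys x. length w = d)"

lemma homog_single: "length w = d \<Longrightarrow> homog d (Poly_Mapping.single w c)"
  by (simp add: homog_def)

lemma homog_sum: "(\<And>i. i \<in> I \<Longrightarrow> homog d (f i)) \<Longrightarrow> homog d (sum f I)"
  unfolding homog_def using Poly_Mapping.keys_sum[of f I] by blast

lemma homog_mult: "homog d x \<Longrightarrow> homog e y \<Longrightarrow> homog (d + e) (x * y)"
  for x :: "('n, 'c::semiring_0) tensor"
  unfolding homog_def using Poly_Mapping.keys_mult[of x y] by fastforce

lemma homog_const_mult: "homog e y \<Longrightarrow> homog e (const c * y)"
  for y :: "('n, 'c::semiring_0) tensor"
  using homog_mult[of 0 "const c" e y] by (simp add: homog_single)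

lemma homog_vec_tensor: "homog 1 (vec_tensor v)"
  unfolding vec_tensor_def by (rule homog_sum) (simp add: homog_single)

lemma homog_act_tensor: "homog d x \<Longrightarrow> homog d (act_tensor g x)"
  unfolding act_tensor_def lin_ext_def
proof (rule homog_sum)
  fix w assume "homog d x" "w \<in> Poly_Mapping.keys x"
  then have "length w = d" by (simp add: homog_def)
  have "homog (length w) (prod_list (map (\<lambda>j. vec_tensor (g *v axis j 1)) w))" for w
  proof (induction w)
    case (Cons i w)
    then show ?case
      using homog_mult[OF homog_vec_tensor Cons.IH] by simp
  qed (simp add: homog_def)
  then show "homog d (const (Poly_Mapping.lookup x w) * prod_list (map (\<lambda>j. vec_tensor (g *v axis j 1)) w))"
    unfolding \<open>length w = d\<close>[symmetric] by (rule homog_const_mult)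
qed

section \<open>The twisted crossed product ring\<close>

lemma GL_simps [simp]:
  "carrier GL = {g. invertible g}" "mult GL = (**)" "one GL = mat 1"
  by (simp_all add: GL_def)

lemma cp_elem_zero [simp]: "cp_elem 0 g = 0"
  by (auto simp: cp_elem_def fun_eq_iff)

lemma cp_elem_same [simp]: "cp_elem s g g = s"
  by (simp add: cp_elem_def)

lemma cp_elem_add: "cp_elem (s + r) g = cp_elem s g + cp_elem (r :: 'a::monoid_add) g"
  by (auto simp: cp_elem_def fun_eq_iff)

lemma cp_elem_diff: "cp_elem (s - r) g = cp_elem s g - cp_elem (r :: 'a::group_add) g"
  by (auto simp: cp_elem_def fun_eq_iff)

lemma cp_elem_sum: "cp_elem (sum f I) g = (\<Sum>i\<in>I. cp_elem (f i :: 'a::comm_monoid_add) g)"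
  by (induction I rule: infinite_finite_induct) (auto simp: cp_elem_add)

locale twisted_group =
  fixes G :: "(complex^'n^'n) set" and \<alpha> :: "complex^'n^'n \<Rightarrow> complex^'n^'n \<Rightarrow> complex"
  assumes finite_G: "finite G" and subgroup_G: "subgroup G GL"
    and cocycle_\<alpha>: "normalized_two_cocycle G \<alpha>"
begin

lemma one_in_G [simp]: "mat 1 \<in> G"
  using subgroup.one_closed[OF subgroup_G] by simp

lemma mult_in_G [simp]: "g \<in> G \<Longrightarrow> h \<in> G \<Longrightarrow> g ** h \<in> G"
  using subgroup.m_closed[OF subgroup_G] by simp

lemma invertible_G: "g \<in> G \<Longrightarrow> invertible g"
  using subgroup.subset[OF subgroup_G] by auto

lemma right_inverse [simp]: "g \<in> G \<Longrightarrow> g ** matrix_inv g = mat 1"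
  and left_inverse [simp]: "g \<in> G \<Longrightarrow> matrix_inv g ** g = mat 1"
  using someI_ex[OF invertible_G[unfolded invertible_def]] by (simp_all add: matrix_inv_def)

lemma inv_in_G [simp]: "g \<in> G \<Longrightarrow> matrix_inv g \<in> G"
proof -
  assume g: "g \<in> G"
  have "inv\<^bsub>GL\<^esub> g = matrix_inv g"
    unfolding m_inv_def
  proof (rule the_equality)
    show "matrix_inv g \<in> carrier GL \<and> g \<otimes>\<^bsub>GL\<^esub> matrix_inv g = \<one>\<^bsub>GL\<^esub> \<and> matrix_inv g \<otimes>\<^bsub>GL\<^esub> g = \<one>\<^bsub>GL\<^esub>"
      using g by (auto simp: invertible_def intro!: exI[of _ g])
  next
    fix y assume "y \<in> carrier GL \<and> g \<otimes>\<^bsub>GL\<^esub> y = \<one>\<^bsub>GL\<^esub> \<and> y \<otimes>\<^bsub>GL\<^esub> g = \<one>\<^bsub>GL\<^esub>"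
    then have "y ** (g ** matrix_inv g) = matrix_inv g" by (simp add: matrix_mul_assoc)
    then show "y = matrix_inv g" using g by simp
  qed
  then show ?thesis using subgroup.m_inv_closed[OF subgroup_G g] by simp
qed

lemma left_inverse_assoc [simp]: "g \<in> G \<Longrightarrow> matrix_inv g ** (g ** h) = h"
  and right_inverse_assoc [simp]: "g \<in> G \<Longrightarrow> g ** (matrix_inv g ** h) = h"
  by (simp_all add: matrix_mul_assoc)

lemma left_inverse_vec [simp]: "g \<in> G \<Longrightarrow> matrix_inv g *v (g *v v) = v"
  and right_inverse_vec [simp]: "g \<in> G \<Longrightarrow> g *v (matrix_inv g *v v) = v"
  by (simp_all add: matrix_vector_mul_assoc)

lemma cancel_left: "g \<in> G \<Longrightarrow> g ** h = g ** k \<longleftrightarrow> h = k"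
  by (metis left_inverse_assoc)

lemma cancel_right: "g \<in> G \<Longrightarrow> h ** g = k ** g \<longleftrightarrow> h = k"
  by (metis right_inverse matrix_mul_assoc matrix_mul_rid)

lemma bij_betw_left_mult: "g \<in> G \<Longrightarrow> bij_betw (\<lambda>h. g ** h) G G"
  by (rule bij_betw_byWitness[where f' = "\<lambda>h. matrix_inv g ** h"]) auto

lemma bij_betw_conj: "g \<in> G \<Longrightarrow> bij_betw (\<lambda>h. g ** h ** matrix_inv g) G G"
  by (rule bij_betw_byWitness[where f' = "\<lambda>h. matrix_inv g ** h ** g"])
    (auto simp flip: matrix_mul_assoc)

lemma \<alpha>_nonzero [simp]: "g \<in> G \<Longrightarrow> h \<in> G \<Longrightarrow> \<alpha> g h \<noteq> 0"
  using cocycle_\<alpha> by (simp add: normalized_two_cocycle_def)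

lemma \<alpha>_one [simp]: "g \<in> G \<Longrightarrow> \<alpha> (mat 1) g = 1" "g \<in> G \<Longrightarrow> \<alpha> g (mat 1) = 1"
  using cocycle_\<alpha> by (simp_all add: normalized_two_cocycle_def)

lemma cocycle:
  "g \<in> G \<Longrightarrow> h \<in> G \<Longrightarrow> k \<in> G \<Longrightarrow> \<alpha> g h * \<alpha> (g ** h) k = \<alpha> h k * \<alpha> g (h ** k)"
  using cocycle_\<alpha> by (simp add: normalized_two_cocycle_def)

abbreviation "R \<equiv> tensor_cp G \<alpha>"

lemma cp_carrier: "x \<in> carrier R \<longleftrightarrow> (\<forall>g. g \<notin> G \<longrightarrow> x g = 0)"
  by (simp add: crossed_product_def)

lemma cp_add [simp]: "x \<oplus>\<^bsub>R\<^esub> y = x + y" and cp_zero [simp]: "\<zero>\<^bsub>R\<^esub> = 0"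
  by (simp_all add: crossed_product_def)

lemma cp_one: "\<one>\<^bsub>R\<^esub> = cp_elem 1 (mat 1)"
  by (auto simp: crossed_product_def cp_elem_def)

lemma cp_smult: "p \<odot>\<^bsub>R\<^esub> x = (\<lambda>g. const p * x g)"
  by (simp add: crossed_product_def)

lemma cp_mult: "x \<otimes>\<^bsub>R\<^esub> y = (\<lambda>k. \<Sum>(g, h) | g \<in> G \<and> h \<in> G \<and> g ** h = k. const [:\<alpha> g h:] * x g * act_tensor g (y h))"
  by (simp add: crossed_product_def)

lemma cp_elem_carrier [simp]: "g \<in> G \<Longrightarrow> cp_elem s g \<in> carrier R"
  by (auto simp: cp_carrier cp_elem_def)

lemma zero_carrier [simp]: "0 \<in> carrier R"
  and add_carrier [simp]: "x \<in> carrier R \<Longrightarrow> y \<in> carrier R \<Longrightarrow> x + y \<in> carrier R"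
  and diff_carrier [simp]: "x \<in> carrier R \<Longrightarrow> y \<in> carrier R \<Longrightarrow> x - y \<in> carrier R"
  and uminus_carrier [simp]: "x \<in> carrier R \<Longrightarrow> - x \<in> carrier R"
  by (simp_all add: cp_carrier)

lemma sum_carrier: "(\<And>i. i \<in> I \<Longrightarrow> f i \<in> carrier R) \<Longrightarrow> sum f I \<in> carrier R"
  by (induction I rule: infinite_finite_induct) auto

lemma finite_fibre: "finite {(g, h). g \<in> G \<and> h \<in> G \<and> g ** h = k}"
  by (rule finite_subset[of _ "G \<times> G"]) (auto simp: finite_G)

lemma mult_carrier [simp]: "x \<otimes>\<^bsub>R\<^esub> y \<in> carrier R"
proof -
  have "{(g, h). g \<in> G \<and> h \<in> G \<and> g ** h = k} = {}" if "k \<notin> G" for k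
    using that by auto
  then show ?thesis unfolding cp_carrier cp_mult by (metis (no_types, lifting) sum.empty)
qed

lemma cp_mult_add_left: "(x + x') \<otimes>\<^bsub>R\<^esub> y = x \<otimes>\<^bsub>R\<^esub> y + x' \<otimes>\<^bsub>R\<^esub> y"
  and cp_mult_add_right: "x \<otimes>\<^bsub>R\<^esub> (y + y') = x \<otimes>\<^bsub>R\<^esub> y + x \<otimes>\<^bsub>R\<^esub> y'"
  by (simp_all add: fun_eq_iff cp_mult act_tensor_add distrib_left distrib_right case_prod_unfold sum.distrib)

lemma cp_mult_zero [simp]: "0 \<otimes>\<^bsub>R\<^esub> y = 0" "x \<otimes>\<^bsub>R\<^esub> 0 = 0"
  by (simp_all add: fun_eq_iff cp_mult)

lemma cp_mult_diff_left: "(x - x') \<otimes>\<^bsub>R\<^esub> y = x \<otimes>\<^bsub>R\<^esub> y - x' \<otimes>\<^bsub>R\<^esub> y"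
  by (metis add_diff_cancel diff_add_cancel cp_mult_add_left)

lemma cp_mult_diff_right: "x \<otimes>\<^bsub>R\<^esub> (y - y') = x \<otimes>\<^bsub>R\<^esub> y - x \<otimes>\<^bsub>R\<^esub> y'"
  by (metis add_diff_cancel diff_add_cancel cp_mult_add_right)

lemma cp_mult_sum_left: "sum f I \<otimes>\<^bsub>R\<^esub> y = (\<Sum>i\<in>I. f i \<otimes>\<^bsub>R\<^esub> y)"
  by (rule sum_comp_morphism[of "\<lambda>x. x \<otimes>\<^bsub>R\<^esub> y" f I, unfolded o_def, symmetric])
    (rule cp_mult_zero cp_mult_add_left)+

lemma cp_mult_sum_right: "y \<otimes>\<^bsub>R\<^esub> sum f I = (\<Sum>i\<in>I. y \<otimes>\<^bsub>R\<^esub> f i)"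
  by (rule sum_comp_morphism[of "\<lambda>x. y \<otimes>\<^bsub>R\<^esub> x" f I, unfolded o_def, symmetric])
    (rule cp_mult_zero cp_mult_add_right)+

lemma cp_elem_mult:
  assumes "g \<in> G" "h \<in> G"
  shows "cp_elem s g \<otimes>\<^bsub>R\<^esub> cp_elem r h = cp_elem (const [:\<alpha> g h:] * s * act_tensor g r) (g ** h)"
proof
  fix k
  let ?A = "{(g, h). g \<in> G \<and> h \<in> G \<and> g ** h = k}"
  have "(cp_elem s g \<otimes>\<^bsub>R\<^esub> cp_elem r h) k =
      (\<Sum>p\<in>?A. if p = (g, h) then const [:\<alpha> g h:] * s * act_tensor g r else 0)"
    unfolding cp_mult
  proof (rule sum.cong)
    fix p assume "p \<in> ?A"
    show "(case p of (g', h') \<Rightarrow> const [:\<alpha> g' h':] * cp_elem s g g' * act_tensor g' (cp_elem r h h')) =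
        (if p = (g, h) then const [:\<alpha> g h:] * s * act_tensor g r else 0)"
      by (cases p) (simp add: cp_elem_def)
  qed simp
  also have "\<dots> = cp_elem (const [:\<alpha> g h:] * s * act_tensor g r) (g ** h) k"
    using assms finite_fibre[of k] by (auto simp: cp_elem_def sum.delta)
  finally show "(cp_elem s g \<otimes>\<^bsub>R\<^esub> cp_elem r h) k = \<dots>" .
qed

lemma sum_apply: "sum f I x = (\<Sum>i\<in>I. f i x :: 'b::comm_monoid_add)"
  by (induction I rule: infinite_finite_induct) auto

lemma cp_sum_cp_elem:
  assumes "x \<in> carrier R"
  shows "x = (\<Sum>g\<in>G. cp_elem (x g) g)"
proof
  fix h
  have "(\<Sum>g\<in>G. cp_elem (x g) g) h = (\<Sum>g\<in>G. if g = h then x h else 0)"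
    unfolding sum_apply by (rule sum.cong) (auto simp: cp_elem_def)
  also have "\<dots> = x h" using assms finite_G by (simp add: cp_carrier)
  finally show "x h = (\<Sum>g\<in>G. cp_elem (x g) g) h" by simp
qed

lemma cp_induct [consumes 1, case_names zero elem add]:
  assumes "x \<in> carrier R" "P 0" "\<And>s g. g \<in> G \<Longrightarrow> P (cp_elem s g)"
    "\<And>x y. P x \<Longrightarrow> P y \<Longrightarrow> P (x + y)"
  shows "P x"
proof -
  have "P (\<Sum>g\<in>F. cp_elem (x g) g)" if "finite F" "F \<subseteq> G" for F
    using that by (induction F rule: finite_induct) (auto intro: assms)
  from this[of G] finite_G show ?thesis using cp_sum_cp_elem[OF assms(1)] by simp
qed

text \<open>On monomials the tensor parts agree because the action is multiplicative and respects
  products of matrices. The scalars of the two bracketings are the two sides of the cocycle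
  identity.\<close>

lemma cp_mult_assoc:
  assumes "x \<in> carrier R" "y \<in> carrier R" "z \<in> carrier R"
  shows "x \<otimes>\<^bsub>R\<^esub> y \<otimes>\<^bsub>R\<^esub> z = x \<otimes>\<^bsub>R\<^esub> (y \<otimes>\<^bsub>R\<^esub> z)"
  using assms(1)
proof (induction x rule: cp_induct)
  case (elem s g)
  show ?case using assms(2)
  proof (induction y rule: cp_induct)
    case (elem r h)
    show ?case using assms(3)
    proof (induction z rule: cp_induct)
      case (elem q k)
      note G = \<open>g \<in> G\<close> \<open>h \<in> G\<close> \<open>k \<in> G\<close>
      let ?s = "s * act_tensor g r * act_tensor g (act_tensor h q)"
      have "cp_elem s g \<otimes>\<^bsub>R\<^esub> cp_elem r h \<otimes>\<^bsub>R\<^esub> cp_elem q k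
          = cp_elem (const [:\<alpha> g h * \<alpha> (g ** h) k:] * ?s) (g ** h ** k)"
        by (simp add: G cp_elem_mult act_tensor_matrix_mult mult_single mult.assoc mult.commute[of "\<alpha> g h"] flip: mult.assoc[of "const _" "const _"])
      also have "const [:\<alpha> g h * \<alpha> (g ** h) k:] * ?s = const [:\<alpha> g (h ** k):] * s * act_tensor g (const [:\<alpha> h k:] * r * act_tensor h q)"
      proof -
        have "const [:\<alpha> g (h ** k):] * s * act_tensor g (const [:\<alpha> h k:] * r * act_tensor h q)
          = const [:\<alpha> g (h ** k):] * (s * const [:\<alpha> h k:]) * act_tensor g r * act_tensor g (act_tensor h q)"
          by (simp add: act_tensor_mult act_tensor_const_mult mult.assoc)
        also have "\<dots> = const [:\<alpha> h k * \<alpha> g (h ** k):] * ?s"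
          unfolding const_mult_comm[of s]
          by (simp add: mult_single mult.assoc mult.commute flip: mult.assoc[of "const _" "const _"])
        finally show ?thesis by (simp add: G cocycle)
      qed
      finally show ?case by (simp add: G cp_elem_mult matrix_mul_assoc)
    qed (simp_all only: cp_mult_add_right cp_mult_zero)
  qed (simp_all only: cp_mult_add_right cp_mult_add_left cp_mult_zero)
qed (simp_all only: cp_mult_add_left cp_mult_zero)

text \<open>Since scalars act as multiplication by ring elements, every two-sided ideal is closed
  under them, and scalar multiplication descends to the quotient.\<close>

lemma cp_smult_eq_mult:
  assumes "x \<in> carrier R"
  shows "p \<odot>\<^bsub>R\<^esub> x = cp_elem (const p) (mat 1) \<otimes>\<^bsub>R\<^esub> x"
  using assms
proof (induction x rule: cp_induct)
  case zero
  show ?case by (simp only: cp_mult_zero) (simp add: cp_smult fun_eq_iff)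
next
  case (elem s g)
  show ?case using elem by (simp add: cp_elem_mult flip: one_pCons) (auto simp: cp_smult cp_elem_def fun_eq_iff)
next
  case (add x y)
  then show ?case unfolding cp_mult_add_right add[symmetric] by (simp add: cp_smult fun_eq_iff distrib_left)
qed

lemma ring_R: "ring R"
proof (rule ringI)
  show "abelian_group R"
    by (rule abelian_groupI) (auto simp: add.assoc add.commute intro: exI[of _ "- _"] bexI[of _ "- _"])
  have "\<one>\<^bsub>R\<^esub> \<otimes>\<^bsub>R\<^esub> x = x \<and> x \<otimes>\<^bsub>R\<^esub> \<one>\<^bsub>R\<^esub> = x" if "x \<in> carrier R" for x
    using that unfolding cp_one
  proof (induction x rule: cp_induct)
    case (elem s g)
    then show ?case by (simp add: cp_elem_mult flip: one_pCons)
  qed (simp_all only: cp_mult_add_left cp_mult_add_right cp_mult_zero simp_thms)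
  then show "monoid R"
    by unfold_locales (auto simp: cp_mult_assoc cp_one)
qed (auto simp: cp_mult_add_left cp_mult_add_right)

end

section \<open>Normal forms in the deformed algebra\<close>

lemma vec_axis_induct [case_names add scale axis]:
  fixes v :: "complex^'n"
  assumes "\<And>v w. P v \<Longrightarrow> P w \<Longrightarrow> P (v + w)" "\<And>c v. P v \<Longrightarrow> P (c *s v)"
    and "\<And>i. P (axis i 1)"
  shows "P v"
proof -
  have "P (\<Sum>i\<in>F. v $ i *s axis i 1)" if "finite F" for F :: "'n set"
    using that
  proof (induction F rule: finite_induct)
    case empty
    then show ?case using assms(2)[OF assms(3), of 0] by simp
  next
    case (insert i F)
    then show ?case by (simp add: assms)
  qed
  from this[of UNIV] show ?thesis unfolding vec_eq_sum_axis[of v, symmetric] by simp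
qed

text \<open>With \<open>K\<close> the words of a fixed length, homogeneity survives the induction.
  Splitting off the coefficient leaves only bare words, which suits statements linear over the
  coefficients.\<close>

lemma poly_mapping_keys_scale_induct [consumes 1, case_names zero add scale single]:
  fixes f :: "'m::monoid_add \<Rightarrow>\<^sub>0 'c::semiring_1"
  assumes "Poly_Mapping.keys f \<subseteq> K"
    and "P 0" "\<And>f g. P f \<Longrightarrow> P g \<Longrightarrow> P (f + g)" "\<And>c f. P f \<Longrightarrow> P (const c * f)"
    and "\<And>m. m \<in> K \<Longrightarrow> P (Poly_Mapping.single m 1)"
  shows "P f"
  using assms(1)
proof (induction f rule: poly_mapping_keys_induct)
  case (single m c)
  then show ?case using assms(4)[of "Poly_Mapping.single m 1" c] assms(5)[of m] by (simp add: mult_single)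
qed (simp_all add: assms)

text \<open>Each letter counts with its rank times the number of letters to its right. Swapping a
  descent moves the larger letter one place to the right, which lowers the total by the difference
  of the ranks.\<close>

fun word_weight :: "'n::countable list \<Rightarrow> nat" where
  "word_weight [] = 0"
| "word_weight (x # w) = length w * to_nat x + word_weight w"

lemma word_weight_swap:
  "to_nat y < to_nat x \<Longrightarrow> word_weight (u @ y # x # v) < word_weight (u @ x # y # v)"
  by (induction u) simp_all

lemma unsorted_descent:
  assumes "\<not> sorted (map to_nat w)"
  shows "\<exists>u x y v. w = u @ x # y # v \<and> to_nat y < to_nat x"
  using assms
proof (induction w)
  case (Cons x w)
  show ?case
  proof (cases "sorted (map to_nat w)")
    case True
    then obtain y v where w: "w = y # v" using Cons.prems by (cases w) auto
    have "to_nat y < to_nat x"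
    proof (rule ccontr)
      assume "\<not> to_nat y < to_nat x"
      then have "sorted (map to_nat (x # w))" using True w by auto
      then show False using Cons.prems by simp
    qed
    then show ?thesis using w by (intro exI[of _ "[]"] exI[of _ x] exI[of _ y] exI[of _ v]) simp
  next
    case False
    then obtain u x' y' v where "w = u @ x' # y' # v" "to_nat y' < to_nat x'" using Cons.IH by auto
    then show ?thesis by (intro exI[of _ "x # u"] exI[of _ x'] exI[of _ y'] exI[of _ v]) simp
  qed
qed simp

locale hecke_data = twisted_group G \<alpha> for G :: "(complex^'n^'n) set" and \<alpha> +
  fixes a :: "'n form_family"
  assumes skew_a: "g \<in> G \<Longrightarrow> skew_bilinear (a g)"
begin

lemma a_skew: "g \<in> G \<Longrightarrow> a g v w = - a g w v"
  using skew_a[of g] unfolding skew_bilinear_def by blast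

lemma a_linear_left: "g \<in> G \<Longrightarrow> Vector_Spaces.linear (*s) (*) (\<lambda>v. a g v w)"
  and a_linear_right: "g \<in> G \<Longrightarrow> Vector_Spaces.linear (*s) (*) (\<lambda>w. a g v w)"
  using skew_a[of g] unfolding skew_bilinear_def by blast+

lemma a_alternating [simp]: "g \<in> G \<Longrightarrow> a g v v = 0"
  using a_skew[of g v v] unfolding eq_neg_iff_add_eq_0 by simp

lemma a_add_left: "g \<in> G \<Longrightarrow> a g (v + v') w = a g v w + a g v' w"
  and a_scale_left: "g \<in> G \<Longrightarrow> a g (c *s v) w = c * a g v w"
  using a_linear_left[of g w] unfolding Vector_Spaces.linear_iff by blast+

lemma a_add_right: "g \<in> G \<Longrightarrow> a g v (w + w') = a g v w + a g v w'"
  and a_scale_right: "g \<in> G \<Longrightarrow> a g v (c *s w) = c * a g v w"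
  using a_linear_right[of g v] unfolding Vector_Spaces.linear_iff by blast+

text \<open>An arbitrary choice, of which only \<open>descentE\<close> is known. That the choice
  does not matter under the two conditions is the content of
  \<open>normal_form_descent\<close>.\<close>

definition descent :: "'n list \<Rightarrow> 'n list \<times> 'n \<times> 'n \<times> 'n list" where
  "descent w = (SOME (u, x, y, v). w = u @ x # y # v \<and> to_nat y < to_nat x)"

lemma descentE:
  assumes "\<not> sorted (map to_nat w)"
  obtains u x y v where "descent w = (u, x, y, v)" "w = u @ x # y # v" "to_nat y < to_nat x"
proof -
  have "\<exists>p. case p of (u, x, y, v) \<Rightarrow> w = u @ x # y # v \<and> to_nat y < to_nat x"
    using unsorted_descent[OF assms] by auto
  from someI_ex[OF this] show thesis
    unfolding descent_def[symmetric] by (cases "descent w") (auto intro: that)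
qed

text \<open>What replaces the word \<open>u @ x # y # v\<close> after a contraction is two letters
  shorter. Termination of the rewriting and all comparisons of leading terms rest on this.\<close>

lemma homog_contraction:
  "homog (length u + length v) (Poly_Mapping.single u c * act_tensor g (Poly_Mapping.single v c'))"
  by (intro homog_mult homog_act_tensor homog_single) auto

text \<open>\<open>normal_form w k k'\<close> is the component at \<open>k'\<close> of the normal form of the word \<open>w\<close> times \<open>k\<close>.\<close>

function normal_form :: "'n list \<Rightarrow> complex^'n^'n \<Rightarrow> complex^'n^'n \<Rightarrow> ('n, complex poly) symm" where
  "normal_form w k k' =
     (if sorted (map to_nat w) then if k' = k then Poly_Mapping.single (mset w) 1 else 0
      else case descent w of (u, x, y, v) \<Rightarrow>
        normal_form (u @ y # x # v) k k' +
        (\<Sum>g\<in>G. const (monom (a g (axis x 1) (axis y 1) * \<alpha> g k) 1) *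
           lin_ext (\<lambda>w'. normal_form w' (g ** k) k')
             (Poly_Mapping.single u 1 * act_tensor g (Poly_Mapping.single v 1))))"
  by pat_completeness auto
termination
proof (relation "measures [\<lambda>(w, k, k'). length w, \<lambda>(w, k, k'). word_weight w]", goal_cases)
  \<comment> \<open>The swap keeps the length and lowers the weight. The contraction below lowers
    the length, which comes first in the measure, so its effect on the weight is irrelevant.\<close>
  case prems: 2
  from prems(1) show ?case
    by (rule descentE) (use prems(2-) in \<open>auto simp: word_weight_swap\<close>)
next
  case prems: 3
  from prems(1) show ?case
    by (rule descentE) (use prems(2-) homog_contraction in \<open>fastforce simp: homog_def\<close>)
qed simp

declare normal_form.simps [simp del]

definition nf :: "('n, complex poly) tensor \<Rightarrow> complex^'n^'n \<Rightarrow> complex^'n^'n \<Rightarrow> ('n, complex poly) symm" where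
  "nf p k k' = lin_ext (\<lambda>w. normal_form w k k') p"

text \<open>The lower term of \<open>p * commutator x y * q\<close> followed by \<open>k\<close>:
  the commutator becomes a sum of multiples of \<open>g\<close>, moving \<open>g\<close> past
  \<open>q\<close> makes it act on \<open>q\<close>, and merging it with \<open>k\<close> costs the
  factor \<open>\<alpha> g k\<close>.\<close>

definition contraction :: "('n, complex poly) tensor \<Rightarrow> complex^'n \<Rightarrow> complex^'n \<Rightarrow> ('n, complex poly) tensor \<Rightarrow>
    complex^'n^'n \<Rightarrow> complex^'n^'n \<Rightarrow> ('n, complex poly) symm" where
  "contraction p x y q k k' =
     (\<Sum>g\<in>G. const (monom (a g x y * \<alpha> g k) 1) * nf (p * act_tensor g q) (g ** k) k')"

lemma nf_add: "nf (p + q) k k' = nf p k k' + nf q k k'"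
  and nf_diff: "nf (p - q) k k' = nf p k k' - nf q k k'"
  and nf_const_mult: "nf (const c * p) k k' = const c * nf p k k'"
  and nf_zero [simp]: "nf 0 k k' = 0"
  and nf_sum: "nf (sum f I) k k' = (\<Sum>i\<in>I. nf (f i) k k')"
  and nf_single: "nf (Poly_Mapping.single w c) k k' = const c * normal_form w k k'"
  by (simp_all add: nf_def lin_ext_add lin_ext_diff lin_ext_const_mult lin_ext_sum lin_ext_single)

lemma contraction_add:
  "contraction (p + p') x y q k k' = contraction p x y q k k' + contraction p' x y q k k'"
  "contraction p x y (q + q') k k' = contraction p x y q k k' + contraction p x y q' k k'"
  by (simp_all add: contraction_def nf_add act_tensor_add distrib_left distrib_right sum.distrib)

lemma contraction_diff:
  "contraction (p - p') x y q k k' = contraction p x y q k k' - contraction p' x y q k k'"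
  "contraction p x y (q - q') k k' = contraction p x y q k k' - contraction p x y q' k k'"
  by (metis add_diff_cancel diff_add_cancel contraction_add(1))
    (metis add_diff_cancel diff_add_cancel contraction_add(2))

lemma contraction_add_vec:
  "contraction p (x + x') y q k k' = contraction p x y q k k' + contraction p x' y q k k'"
  "contraction p x (y + y') q k k' = contraction p x y q k k' + contraction p x y' q k k'"
  unfolding contraction_def sum.distrib[symmetric]
  by (auto intro!: sum.cong simp: a_add_left a_add_right distrib_left distrib_right single_add simp flip: add_monom)

lemma contraction_skew: "contraction p x y q k k' = - contraction p y x q k k'"
  unfolding contraction_def sum_negf[symmetric]
proof (rule sum.cong)
  fix g assume "g \<in> G"
  then show "const (monom (a g x y * \<alpha> g k) 1) * nf (p * act_tensor g q) (g ** k) k' =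
      - (const (monom (a g y x * \<alpha> g k) 1) * nf (p * act_tensor g q) (g ** k) k')"
    unfolding a_skew[OF \<open>g \<in> G\<close>, of x y] by (simp add: single_uminus flip: minus_monom)
qed simp

lemma const_mult_left_commute:
  fixes x y :: "'m::monoid_add \<Rightarrow>\<^sub>0 'c::comm_semiring_1"
  shows "x * (const c * y) = const c * (x * y)"
  by (simp add: const_mult_comm[of x c] flip: mult.assoc)

lemma const_mult_const_mult:
  fixes x :: "'m::monoid_add \<Rightarrow>\<^sub>0 'c::semiring_1"
  shows "const c * (const c' * x) = const (c * c') * x"
  by (simp add: mult_single flip: mult.assoc)

lemma contraction_const_mult:
  "contraction (const c * p) x y q k k' = const c * contraction p x y q k k'"
  "contraction p x y (const c * q) k k' = const c * contraction p x y q k k'"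
  unfolding contraction_def sum_distrib_left act_tensor_const_mult const_mult_left_commute[of p] mult.assoc nf_const_mult
  by (rule sum.cong[OF refl], rule mult.left_commute)+

lemma contraction_scale:
  "contraction p (c *s x) y q k k' = const [:c:] * contraction p x y q k k'"
  "contraction p x (c *s y) q k k' = const [:c:] * contraction p x y q k k'"
  unfolding contraction_def sum_distrib_left const_mult_const_mult
  by (rule sum.cong; simp add: a_scale_left a_scale_right smult_monom mult.assoc)+

abbreviation commutator :: "complex^'n \<Rightarrow> complex^'n \<Rightarrow> ('n, complex poly) tensor" where
  "commutator x y \<equiv> vec_tensor x * vec_tensor y - vec_tensor y * vec_tensor x"

lemma commutator_add:
  "commutator (x + x') y = commutator x y + commutator x' y"
  "commutator x (y + y') = commutator x y + commutator x y'"
  by (simp_all add: vec_tensor_add distrib_left distrib_right)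

lemma commutator_scale:
  "commutator (c *s x) y = const [:c:] * commutator x y"
  "commutator x (c *s y) = const [:c:] * commutator x y"
  unfolding vec_tensor_scale right_diff_distrib const_mult_left_commute mult.assoc by (rule refl)+

text \<open>Independence of the order of the steps in length \<open>d\<close>: the rewriting rule
  may be applied at every adjacent pair, ascents included, and not just at the descent chosen by
  \<open>descent\<close>.\<close>

definition reduces :: "nat \<Rightarrow> bool" where
  "reduces d \<longleftrightarrow> (\<forall>u x y v k k'. length u + length v + 2 = d \<longrightarrow> k \<in> G \<longrightarrow>
     normal_form (u @ x # y # v) k k' = normal_form (u @ y # x # v) k k' +
       contraction (Poly_Mapping.single u 1) (axis x 1) (axis y 1) (Poly_Mapping.single v 1) k k')"

text \<open>Both sides are linear in each argument, so letters and words suffice. The version for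
  vectors is needed because the group action mixes letters; homogeneity confines it to one length,
  which makes it usable inside an induction over lengths.\<close>

lemma nf_commutator:
  assumes "reduces (d + e + 2)" "homog d p" "homog e q" "k \<in> G"
  shows "nf (p * commutator x y * q) k k' = contraction p x y q k k'"
proof -
  have "Poly_Mapping.keys p \<subseteq> {w. length w = d}" using assms(2) by (auto simp: homog_def)
  then show ?thesis
  proof (induction p rule: poly_mapping_keys_scale_induct)
    case (single u)
    have "Poly_Mapping.keys q \<subseteq> {w. length w = e}" using assms(3) by (auto simp: homog_def)
    then show ?case
    proof (induction q rule: poly_mapping_keys_scale_induct)
      case (single v)
      show ?case
      proof (induction x rule: vec_axis_induct)
        case (axis i)
        show ?case
        proof (induction y rule: vec_axis_induct)
          case (axis j)
          have "normal_form (u @ i # j # v) k k' = normal_form (u @ j # i # v) k k' +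
            contraction (Poly_Mapping.single u 1) (axis i 1) (axis j 1) (Poly_Mapping.single v 1) k k'"
            by (rule assms(1)[unfolded reduces_def, rule_format]) (use assms(4) \<open>u \<in> _\<close> \<open>v \<in> _\<close> in auto)
          then show ?case
            by (simp add: vec_tensor_axis left_diff_distrib right_diff_distrib mult_single nf_diff nf_single)
        next
          case (add y y')
          then show ?case
            unfolding commutator_add distrib_left distrib_right nf_add contraction_add_vec by simp
        next
          case (scale c y)
          then show ?case
            unfolding commutator_scale const_mult_left_commute mult.assoc nf_const_mult contraction_scale by simp
        qed
      next
        case (add x x')
        then show ?case
          unfolding commutator_add distrib_left distrib_right nf_add contraction_add_vec by simp
      next
        case (scale c x)
        then show ?case
          unfolding commutator_scale const_mult_left_commute mult.assoc nf_const_mult contraction_scale by simp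
      qed
    next
      case zero
      show ?case by (simp add: contraction_def)
    next
      case (add q q')
      then show ?case unfolding distrib_left nf_add contraction_add by simp
    next
      case (scale c q)
      then show ?case unfolding const_mult_left_commute nf_const_mult contraction_const_mult mult.assoc by simp
    qed
  next
    case zero
    show ?case by (simp add: contraction_def)
  next
    case (add p p')
    then show ?case unfolding distrib_right nf_add contraction_add by simp
  next
    case (scale c p)
    then show ?case unfolding mult.assoc nf_const_mult contraction_const_mult mult.assoc by simp
  qed
qed

end

section \<open>Confluence of the rewriting under equivariance and the Jacobi identity\<close>

locale pbw_conditions = hecke_data G \<alpha> a for G :: "(complex^'n^'n) set" and \<alpha> and a +
  assumes equivariant: "g \<in> G \<Longrightarrow> h \<in> G \<Longrightarrow>
      a (h ** g ** matrix_inv h) (h *v v) (h *v w) * \<alpha> (h ** g ** matrix_inv h) h = \<alpha> h g * a g v w"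
    and jacobi: "g \<in> G \<Longrightarrow>
      a g v w *s (u - g *v u) + a g w u *s (v - g *v v) + a g u v *s (w - g *v w) = 0"
begin

text \<open>The form of equivariance for words that already end in \<open>k\<close>. The conjugate
  of \<open>g\<close> times \<open>h\<close> equals \<open>h ** g\<close>, so the cocycle identity
  for the conjugate, \<open>h\<close> and \<open>k\<close> brings in the factor which
  \<open>equivariant\<close> controls.\<close>

lemma equivariant_cocycle:
  assumes "g \<in> G" "h \<in> G" "k \<in> G"
  shows "\<alpha> h k * (a (h ** g ** matrix_inv h) (h *v v) (h *v w) * \<alpha> (h ** g ** matrix_inv h) (h ** k)) =
    a g v w * \<alpha> h g * \<alpha> (h ** g) k"
proof -
  let ?g = "h ** g ** matrix_inv h"
  have g: "?g \<in> G" "?g ** h = h ** g" using assms by (simp_all flip: matrix_mul_assoc)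
  have "\<alpha> h k * (a ?g (h *v v) (h *v w) * \<alpha> ?g (h ** k)) = a ?g (h *v v) (h *v w) * (\<alpha> ?g h * \<alpha> (?g ** h) k)"
    using cocycle[OF g(1) assms(2,3)] by simp
  also have "\<dots> = (a ?g (h *v v) (h *v w) * \<alpha> ?g h) * \<alpha> (h ** g) k"
    by (simp only: g(2) mult.assoc)
  also have "\<dots> = a g v w * \<alpha> h g * \<alpha> (h ** g) k"
    using equivariant[OF assms(1,2), of v w] by simp
  finally show ?thesis .
qed

lemma act_tensor_commutator: "act_tensor g (commutator x y) = commutator (g *v x) (g *v y)"
  by (simp add: act_tensor_diff act_tensor_mult act_tensor_vec)

text \<open>Two contractions at disjoint pairs commute. If the left pair goes first, its
  \<open>g\<close> acts on the right pair; equivariance transports the form there back to the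
  original vectors, at the price of conjugating the index. The rule is used only two letters below
  the words in question.\<close>

lemma contraction_far:
  assumes "reduces d" "homog i p" "homog j q" "homog l r" "i + j + l + 2 = d" "k \<in> G"
  shows "contraction p x y (q * commutator z t * r) k k' = contraction (p * commutator x y * q) z t r k k'"
proof -
  \<comment> \<open>The tensor and group part common to both orders, with \<open>g\<close> from the
    left pair. In the first order the right pair produces \<open>g ** h ** matrix_inv g\<close>,
    which is why that sum is reindexed by conjugation.\<close>
  let ?P = "\<lambda>g h. nf (p * act_tensor g q * act_tensor (g ** h) r) (g ** h ** k) k'"
  have "contraction p x y (q * commutator z t * r) k k' =
      (\<Sum>g\<in>G. \<Sum>h\<in>G. const (monom (a g x y * \<alpha> g k * (a (g ** h ** matrix_inv g) (g *v z) (g *v t) * \<alpha> (g ** h ** matrix_inv g) (g ** k))) 2) * ?P g h)"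
    unfolding contraction_def[of p]
  proof (rule sum.cong[OF refl])
    fix g assume g: "g \<in> G"
    have "nf (p * act_tensor g (q * commutator z t * r)) (g ** k) k' =
        nf (p * act_tensor g q * commutator (g *v z) (g *v t) * act_tensor g r) (g ** k) k'"
      unfolding act_tensor_mult act_tensor_commutator mult.assoc ..
    also have "\<dots> = contraction (p * act_tensor g q) (g *v z) (g *v t) (act_tensor g r) (g ** k) k'"
      by (rule nf_commutator[of "i + j" l]) (use assms g in \<open>auto intro: homog_mult homog_act_tensor\<close>)
    also have "\<dots> = (\<Sum>h\<in>G. const (monom (a h (g *v z) (g *v t) * \<alpha> h (g ** k)) 1) *
        nf (p * act_tensor g q * act_tensor (h ** g) r) (h ** g ** k) k')"
      unfolding contraction_def by (simp add: act_tensor_matrix_mult matrix_mul_assoc)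
    also have "\<dots> = (\<Sum>h\<in>G. const (monom (a (g ** h ** matrix_inv g) (g *v z) (g *v t) * \<alpha> (g ** h ** matrix_inv g) (g ** k)) 1) * ?P g h)"
      by (subst sum.reindex_bij_betw[OF bij_betw_conj[OF g], symmetric])
        (rule sum.cong, simp_all add: g flip: matrix_mul_assoc)
    finally show "const (monom (a g x y * \<alpha> g k) 1) * nf (p * act_tensor g (q * commutator z t * r)) (g ** k) k' =
      (\<Sum>h\<in>G. const (monom (a g x y * \<alpha> g k * (a (g ** h ** matrix_inv g) (g *v z) (g *v t) * \<alpha> (g ** h ** matrix_inv g) (g ** k))) 2) * ?P g h)"
      by (simp only: sum_distrib_left const_mult_const_mult mult_monom one_add_one)
  qed
  also have "\<dots> = (\<Sum>g\<in>G. \<Sum>h\<in>G. const (monom (a h z t * \<alpha> h k * (a g x y * \<alpha> g (h ** k))) 2) * ?P g h)"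
  proof (intro sum.cong refl)
    fix g h assume G: "g \<in> G" "h \<in> G"
    have "a g x y * \<alpha> g k * (a (g ** h ** matrix_inv g) (g *v z) (g *v t) * \<alpha> (g ** h ** matrix_inv g) (g ** k)) =
        a g x y * (a h z t * \<alpha> g h * \<alpha> (g ** h) k)"
      using equivariant_cocycle[OF G(2,1) assms(6), of z t] by (simp only: mult.assoc)
    also have "\<dots> = a g x y * a h z t * (\<alpha> h k * \<alpha> g (h ** k))"
      unfolding cocycle[OF G assms(6), symmetric] by simp
    finally show "const (monom (a g x y * \<alpha> g k * (a (g ** h ** matrix_inv g) (g *v z) (g *v t) * \<alpha> (g ** h ** matrix_inv g) (g ** k))) 2) * ?P g h =
      const (monom (a h z t * \<alpha> h k * (a g x y * \<alpha> g (h ** k))) 2) * ?P g h"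
      by (simp only: mult_ac)
  qed
  also have "\<dots> = (\<Sum>h\<in>G. \<Sum>g\<in>G. const (monom (a h z t * \<alpha> h k * (a g x y * \<alpha> g (h ** k))) 2) * ?P g h)"
    by (rule sum.swap)
  also have "\<dots> = contraction (p * commutator x y * q) z t r k k'"
    unfolding contraction_def[of "p * commutator x y * q"]
  proof (rule sum.cong[OF refl])
    fix h assume h: "h \<in> G"
    have "nf (p * commutator x y * q * act_tensor h r) (h ** k) k' =
        nf (p * commutator x y * (q * act_tensor h r)) (h ** k) k'"
      by (simp only: mult.assoc)
    also have "\<dots> = contraction p x y (q * act_tensor h r) (h ** k) k'"
      by (rule nf_commutator[of i "j + l"]) (use assms h in \<open>auto intro: homog_mult homog_act_tensor simp: add.assoc\<close>)
    also have "\<dots> = (\<Sum>g\<in>G. const (monom (a g x y * \<alpha> g (h ** k)) 1) * ?P g h)"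
      unfolding contraction_def act_tensor_mult act_tensor_matrix_mult[symmetric] by (simp only: mult.assoc matrix_mul_assoc)
    finally show "(\<Sum>g\<in>G. const (monom (a h z t * \<alpha> h k * (a g x y * \<alpha> g (h ** k))) 2) * ?P g h) =
      const (monom (a h z t * \<alpha> h k) 1) * nf (p * commutator x y * q * act_tensor h r) (h ** k) k'"
      by (simp only: sum_distrib_left const_mult_const_mult mult_monom one_add_one)
  qed
  finally show ?thesis .
qed

text \<open>Standing to the right of the contracted pair, \<open>z\<close> is hit by
  \<open>g\<close>; standing to the left, it is not. Each difference thus contributes
  \<open>a g x y *s (g *v z - z)\<close> in the place of \<open>z\<close>, and the cyclic sum is
  minus the Jacobi expression for every single \<open>g\<close>.\<close>

lemma contraction_braid:
  "contraction p x y (vec_tensor z * q) k k' - contraction (p * vec_tensor z) x y q k k'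
   + (contraction p y z (vec_tensor x * q) k k' - contraction (p * vec_tensor x) y z q k k')
   + (contraction p z x (vec_tensor y * q) k k' - contraction (p * vec_tensor y) z x q k k') = 0"
proof -
  define l where "l g v = nf (p * vec_tensor v * act_tensor g q) (g ** k) k'" for g v
  have l_add: "l g (v + w) = l g v + l g w" for g v w
    by (simp add: l_def vec_tensor_add distrib_left distrib_right nf_add)
  have l_scale: "l g (c *s v) = const [:c:] * l g v" for g c v
    unfolding l_def vec_tensor_scale const_mult_left_commute mult.assoc nf_const_mult ..
  have l_zero: "l g 0 = 0" for g by (simp add: l_def)
  have l_diff: "l g (v - w) = l g v - l g w" for g v w
    by (metis l_add add_diff_cancel diff_add_cancel)
  have c: "contraction p x y (vec_tensor z * q) k k' - contraction (p * vec_tensor z) x y q k k'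
      = (\<Sum>g\<in>G. const (monom (\<alpha> g k) 1) * l g (a g x y *s (g *v z - z)))" for x y z
    unfolding contraction_def sum_subtractf[symmetric]
  proof (rule sum.cong[OF refl])
    fix g
    have "const (monom (\<alpha> g k) 1) * l g (a g x y *s (g *v z - z)) = const (monom (a g x y * \<alpha> g k) 1) * (l g (g *v z) - l g z)"
      unfolding l_scale l_diff const_mult_const_mult by (simp add: smult_monom mult.commute[of "\<alpha> g k"])
    then show "const (monom (a g x y * \<alpha> g k) 1) * nf (p * act_tensor g (vec_tensor z * q)) (g ** k) k' -
          const (monom (a g x y * \<alpha> g k) 1) * nf (p * vec_tensor z * act_tensor g q) (g ** k) k' =
          const (monom (\<alpha> g k) 1) * l g (a g x y *s (g *v z - z))"
      by (simp add: l_def act_tensor_mult act_tensor_vec right_diff_distrib mult.assoc)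
  qed
  have z: "a g x y *s (g *v z - z) + a g y z *s (g *v x - x) + a g z x *s (g *v y - y) = 0" if "g \<in> G" for g
  proof -
    have "a g x y *s (g *v z - z) + a g y z *s (g *v x - x) + a g z x *s (g *v y - y) =
        - (a g x y *s (z - g *v z) + a g y z *s (x - g *v x) + a g z x *s (y - g *v y))"
      by (simp add: vec_eq_iff algebra_simps)
    also have "\<dots> = 0" using jacobi[OF that] by simp
    finally show ?thesis .
  qed
  show ?thesis
    unfolding c sum.distrib[symmetric] distrib_left[symmetric] l_add[symmetric]
    by (intro sum.neutral ballI) (simp only: z l_zero mult_zero_right)
qed

text \<open>The outcome of rewriting the displayed pair first, whether or not \<open>descent\<close>
  would choose it.\<close>

definition resolve :: "'n list \<Rightarrow> 'n \<Rightarrow> 'n \<Rightarrow> 'n list \<Rightarrow> complex^'n^'n \<Rightarrow> complex^'n^'n \<Rightarrow> ('n, complex poly) symm" where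
  "resolve u x y v k k' = normal_form (u @ y # x # v) k k' +
     contraction (Poly_Mapping.single u 1) (axis x 1) (axis y 1) (Poly_Mapping.single v 1) k k'"

text \<open>Both orders end in the same doubly swapped word. The contractions collected on the way
  differ by the two sides of \<open>contraction_far\<close>, expanded into words. The hypothesis
  \<open>IH\<close> applies to the once swapped words because their weight is smaller.\<close>

lemma resolve_far:
  assumes "reduces (length u + length m + length v + 2)" "k \<in> G"
    and IH: "\<And>u' x' y' v'. length (u' @ x' # y' # v') = length (u @ x # y # m @ z # t # v) \<Longrightarrow>
      word_weight (u' @ x' # y' # v') < word_weight (u @ x # y # m @ z # t # v) \<Longrightarrow> to_nat y' < to_nat x' \<Longrightarrow>
      normal_form (u' @ x' # y' # v') k k' = resolve u' x' y' v' k k'"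
    and "to_nat y < to_nat x" "to_nat t < to_nat z"
  shows "resolve u x y (m @ z # t # v) k k' = resolve (u @ x # y # m) z t v k k'"
proof -
  let ?s = "\<lambda>w. Poly_Mapping.single w (1 :: complex poly)"
  let ?e = "\<lambda>i. axis i (1 :: complex)"
  have 1: "normal_form (u @ y # x # m @ z # t # v) k k' = resolve (u @ y # x # m) z t v k k'"
    using IH[of "u @ y # x # m" z t v] assms(4,5) word_weight_swap[of y x u "m @ z # t # v"] by simp
  have 2: "normal_form (u @ x # y # m @ t # z # v) k k' = resolve u x y (m @ t # z # v) k k'"
    using IH[of u x y "m @ t # z # v"] assms(4,5) word_weight_swap[of t z "u @ x # y # m" v] by simp
  have "contraction (?s u) (?e x) (?e y) (?s m * commutator (?e z) (?e t) * ?s v) k k' =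
      contraction (?s u * commutator (?e x) (?e y) * ?s m) (?e z) (?e t) (?s v) k k'"
    by (rule contraction_far[OF assms(1), of "length u" _ "length m" _ "length v"])
      (simp_all add: homog_single assms)
  then have "contraction (?s u) (?e x) (?e y) (?s (m @ z # t # v)) k k' - contraction (?s u) (?e x) (?e y) (?s (m @ t # z # v)) k k' =
      contraction (?s (u @ x # y # m)) (?e z) (?e t) (?s v) k k' - contraction (?s (u @ y # x # m)) (?e z) (?e t) (?s v) k k'"
    by (simp add: vec_tensor_axis left_diff_distrib right_diff_distrib mult_single contraction_diff)
  then show ?thesis
    unfolding resolve_def using 1 2 by (simp add: resolve_def algebra_simps)
qed

text \<open>The two ways from \<open>x # y # z\<close> to \<open>z # y # x\<close> form a hexagon of
  three swaps each. All intermediate words have smaller weight, and the six contractions along the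
  sides are those of \<open>contraction_braid\<close>.\<close>

lemma resolve_braid:
  assumes IH: "\<And>u' x' y' v'. length (u' @ x' # y' # v') = length (u @ x # y # z # v) \<Longrightarrow>
      word_weight (u' @ x' # y' # v') < word_weight (u @ x # y # z # v) \<Longrightarrow> to_nat y' < to_nat x' \<Longrightarrow>
      normal_form (u' @ x' # y' # v') k k' = resolve u' x' y' v' k k'"
    and "to_nat y < to_nat x" "to_nat z < to_nat y"
  shows "resolve u x y (z # v) k k' = resolve (u @ [x]) y z v k k'"
proof -
  let ?s = "\<lambda>w. Poly_Mapping.single w (1 :: complex poly)"
  let ?e = "\<lambda>i. axis i (1 :: complex)"
  let ?c = "\<lambda>u x y v. contraction (?s u) (?e x) (?e y) (?s v) k k'"
  have w: "word_weight (u @ y # x # z # v) < word_weight (u @ x # y # z # v)"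
      "word_weight (u @ y # z # x # v) < word_weight (u @ y # x # z # v)"
      "word_weight (u @ x # z # y # v) < word_weight (u @ x # y # z # v)"
      "word_weight (u @ z # x # y # v) < word_weight (u @ x # z # y # v)"
    using word_weight_swap[of y x u "z # v"] word_weight_swap[of z x "u @ [y]" v]
      word_weight_swap[of z y "u @ [x]" v] word_weight_swap[of z x u "y # v"] assms by auto
  have 1: "normal_form (u @ y # x # z # v) k k' = normal_form (u @ y # z # x # v) k k' + ?c (u @ [y]) x z v"
    using IH[of "u @ [y]" x z v] w assms by (simp add: resolve_def)
  have 2: "normal_form (u @ y # z # x # v) k k' = normal_form (u @ z # y # x # v) k k' + ?c u y z (x # v)"
    using IH[of u y z "x # v"] w assms by (simp add: resolve_def)
  have 3: "normal_form (u @ x # z # y # v) k k' = normal_form (u @ z # x # y # v) k k' + ?c u x z (y # v)"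
    using IH[of u x z "y # v"] w assms by (simp add: resolve_def)
  have 4: "normal_form (u @ z # x # y # v) k k' = normal_form (u @ z # y # x # v) k k' + ?c (u @ [z]) x y v"
    using IH[of "u @ [z]" x y v] w assms by (simp add: resolve_def)
  have "?c u x y (z # v) - ?c (u @ [z]) x y v + (?c u y z (x # v) - ?c (u @ [x]) y z v)
      + (?c u z x (y # v) - ?c (u @ [y]) z x v) = 0"
    using contraction_braid[of "?s u" "?e x" "?e y" "?e z" "?s v" k k'] by (simp add: vec_tensor_axis mult_single)
  \<comment> \<open>Sorting moves \<open>x\<close> past \<open>z\<close>, whereas the cyclic
    identity contracts \<open>z\<close> with \<open>x\<close>; skewness turns one into the
    other.\<close>
  then have 5: "?c u x y (z # v) - ?c (u @ [z]) x y v + (?c u y z (x # v) - ?c (u @ [x]) y z v)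
      - (?c u x z (y # v) - ?c (u @ [y]) x z v) = 0"
    unfolding contraction_skew[of _ "?e z" "?e x"] by (simp add: algebra_simps)
  have "resolve u x y (z # v) k k' - resolve (u @ [x]) y z v k k' = 0"
    unfolding 5[symmetric] by (simp add: resolve_def 1 2 3 4)
  then show ?thesis by simp
qed

text \<open>As in Jacobson's proof of the Poincare-Birkhoff-Witt theorem, two descents of a word can be
  resolved in either order: distant ones by equivariance, overlapping ones by the Jacobi identity.\<close>

lemma normal_form_descent:
  fixes w u v :: "'n list" and x y :: 'n
  assumes "\<And>d'. d' < length w \<Longrightarrow> reduces d'" "k \<in> G"
    and "w = u @ x # y # v" "to_nat y < to_nat x"
  shows "normal_form w k k' = resolve u x y v k k'"
  using assms(1,3,4)
proof (induction "word_weight w" arbitrary: w u x y v rule: less_induct)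
  case less
  have IH: "normal_form (u' @ x' # y' # v') k k' = resolve u' x' y' v' k k'"
    if "length (u' @ x' # y' # v') = length w" "word_weight (u' @ x' # y' # v') < word_weight w" "to_nat y' < to_nat x'"
    for u' v' :: "'n list" and x' y' :: 'n
    by (rule less.hyps[OF that(2) _ refl that(3)]) (use less.prems(1) that in auto)
  have ordered: "resolve u x y v k k' = resolve u' x' y' v' k k'"
    if w: "w = u @ x # y # v" "w = u' @ x' # y' # v'" and "length u < length u'"
      and desc: "to_nat y < to_nat x" "to_nat y' < to_nat x'"
    for u v u' v' :: "'n list" and x y x' y' :: 'n
  proof -
    from w have "u @ x # y # v = u' @ x' # y' # v'" by simp
    then obtain r where r: "u' = u @ r" "x # y # v = r @ x' # y' # v'"
      using \<open>length u < length u'\<close> by (auto simp: append_eq_append_conv2)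
    then obtain r' where r': "r = x # r'" "y # v = r' @ x' # y' # v'"
      using \<open>length u < length u'\<close> by (cases r) auto
    show ?thesis
    proof (cases r')
      \<comment> \<open>An empty \<open>r'\<close> means that the descents overlap in
        \<open>y\<close>, which is then the letter \<open>x'\<close>. Otherwise they are disjoint
        and \<open>m\<close> lies between them.\<close>
      case Nil
      then have "resolve u x y (y' # v') k k' = resolve (u @ [x]) y y' v' k k'"
        by (intro resolve_braid) (use IH w r r' desc in auto)
      then show ?thesis using Nil r r' by simp
    next
      case (Cons b m)
      then have "resolve u x y (m @ x' # y' # v') k k' = resolve (u @ x # y # m) x' y' v' k k'"
        by (intro resolve_far less.prems(1)) (use IH w r r' desc assms(2) in auto)
      then show ?thesis using Cons r r' by simp
    qed
  qed
  have "\<not> sorted (map to_nat w)" using less.prems by (auto simp: sorted_append)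
  then obtain u' x' y' v' where d: "descent w = (u', x', y', v')" and
    w': "w = u' @ x' # y' # v'" "to_nat y' < to_nat x'" by (rule descentE)
  have "normal_form w k k' = resolve u' x' y' v' k k'"
    using \<open>\<not> sorted (map to_nat w)\<close> d
    by (subst normal_form.simps) (simp add: resolve_def contraction_def nf_def)
  also have "\<dots> = resolve u x y v k k'"
  proof (cases "length u" "length u'" rule: linorder_cases)
    case less
    then show ?thesis using ordered[OF less.prems(2) w'(1)] w' less.prems by simp
  next
    case equal
    then show ?thesis using w' less.prems by simp
  next
    case greater
    then show ?thesis using ordered[OF w'(1) less.prems(2)] w' less.prems by simp
  qed
  finally show ?case .
qed

text \<open>Shorter lengths are supplied by the induction. An ascent is the swapped descent read
  backwards, with the sign absorbed by skewness, and for equal letters the contraction vanishes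
  because the forms are alternating.\<close>

lemma reduces: "reduces d"
proof (induction d rule: less_induct)
  case (less d)
  show ?case
    unfolding reduces_def
  proof (intro allI impI)
    fix u v :: "'n list" and x y :: 'n and k k' assume *: "length u + length v + 2 = d" "k \<in> G"
    have desc: "normal_form (u @ x # y # v) k k' = resolve u x y v k k'" if "to_nat y < to_nat x" for x y
      by (rule normal_form_descent[OF _ *(2) refl that]) (use less.IH * in auto)
    have "normal_form (u @ x # y # v) k k' = resolve u x y v k k'"
    proof (cases "to_nat x" "to_nat y" rule: linorder_cases)
      case less
      then show ?thesis
        using desc[OF less] contraction_skew[of _ "axis x 1" "axis y 1"] by (simp add: resolve_def)
    next
      case equal
      then have "x = y" by simp
      moreover have "contraction p z z q k k' = 0" for p z q
        by (simp add: contraction_def sum.neutral)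
      ultimately show ?thesis by (simp add: resolve_def)
    qed (rule desc)
    then show "normal_form (u @ x # y # v) k k' = normal_form (u @ y # x # v) k k' +
        contraction (Poly_Mapping.single u 1) (axis x 1) (axis y 1) (Poly_Mapping.single v 1) k k'"
      by (simp add: resolve_def)
  qed
qed

lemma nf_commutator_eq_contraction:
  assumes "k \<in> G"
  shows "nf (p * commutator x y * q) k k' = contraction p x y q k k'"
proof -
  have "Poly_Mapping.keys p \<subseteq> UNIV" by simp
  then show ?thesis
  proof (induction p rule: poly_mapping_keys_induct)
    case (single u c)
    have "Poly_Mapping.keys q \<subseteq> UNIV" by simp
    then show ?case
    proof (induction q rule: poly_mapping_keys_induct)
      case (single v c')
      show ?case
        by (rule nf_commutator[OF reduces homog_single[OF refl] homog_single[OF refl] assms])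
    next
      case zero
      show ?case by (simp add: contraction_def)
    next
      case (add q q')
      then show ?case unfolding distrib_left nf_add contraction_add by simp
    qed
  next
    case zero
    show ?case by (simp add: contraction_def)
  next
    case (add p p')
    then show ?case unfolding distrib_right nf_add contraction_add by simp
  qed
qed

end

section \<open>The ideal of the relations and normal forms of its elements\<close>

context hecke_data begin

sublocale cp: ring R
  by (rule ring_R)

abbreviation "I \<equiv> hecke_ideal G \<alpha> a"

lemma hecke_relation_carrier [simp]: "hecke_relation G a v w \<in> carrier R"
  unfolding hecke_relation_def by (intro diff_carrier sum_carrier cp_elem_carrier) auto

lemma ideal_I: "ideal I R"
  unfolding hecke_ideal_def by (rule cp.genideal_ideal) auto

lemma I_carrier: "x \<in> I \<Longrightarrow> x \<in> carrier R"
  using ideal.Icarr[OF ideal_I] .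

lemma hecke_relation_in_I: "hecke_relation G a v w \<in> I"
proof -
  have "{hecke_relation G a v w | v w. True} \<subseteq> carrier R" by auto
  from cp.genideal_self[OF this] show ?thesis unfolding hecke_ideal_def by blast
qed

lemma I_mult_left: "x \<in> I \<Longrightarrow> y \<in> carrier R \<Longrightarrow> y \<otimes>\<^bsub>R\<^esub> x \<in> I"
  and I_mult_right: "x \<in> I \<Longrightarrow> y \<in> carrier R \<Longrightarrow> x \<otimes>\<^bsub>R\<^esub> y \<in> I"
  using ideal.I_l_closed[OF ideal_I] ideal.I_r_closed[OF ideal_I] by auto

lemma I_add: "x \<in> I \<Longrightarrow> y \<in> I \<Longrightarrow> x + y \<in> I"
  using additive_subgroup.a_closed[OF ideal.axioms(1)[OF ideal_I], of x y] by simp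

lemma I_zero: "0 \<in> I"
  using additive_subgroup.zero_closed[OF ideal.axioms(1)[OF ideal_I]] by simp

lemma cp_uminus: "x \<in> carrier R \<Longrightarrow> \<ominus>\<^bsub>R\<^esub> x = - x"
  using cp.minus_equality[of "- x" x] by simp

lemma cp_minus: "x \<in> carrier R \<Longrightarrow> y \<in> carrier R \<Longrightarrow> x \<ominus>\<^bsub>R\<^esub> y = x - y"
  by (simp add: a_minus_def cp_uminus)

lemma I_uminus: "x \<in> I \<Longrightarrow> - x \<in> I"
  using additive_subgroup.a_inv_closed[OF ideal.axioms(1)[OF ideal_I], of x]
  by (simp add: cp_uminus I_carrier)

lemma I_diff: "x \<in> I \<Longrightarrow> y \<in> I \<Longrightarrow> x - y \<in> I"
  using I_add[OF _ I_uminus, of x y] by simp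

lemma I_smult: "x \<in> I \<Longrightarrow> p \<odot>\<^bsub>R\<^esub> x \<in> I"
  by (simp add: cp_smult_eq_mult I_carrier I_mult_left)

lemma cp_elem_mult_relation:
  assumes "h \<in> G"
  shows "cp_elem p h \<otimes>\<^bsub>R\<^esub> hecke_relation G a v w =
    cp_elem (p * commutator (h *v v) (h *v w)) h - (\<Sum>g\<in>G. cp_elem (const (monom (a g v w * \<alpha> h g) 1) * p) (h ** g))"
proof -
  have 1: "cp_elem p h \<otimes>\<^bsub>R\<^esub> cp_elem (commutator v w) (mat 1) = cp_elem (p * commutator (h *v v) (h *v w)) h"
    unfolding cp_elem_mult[OF assms one_in_G]
    using assms by (simp add: act_tensor_diff act_tensor_mult act_tensor_vec flip: one_pCons)
  have 2: "cp_elem p h \<otimes>\<^bsub>R\<^esub> cp_elem (const (monom (a g v w) 1)) g = cp_elem (const (monom (a g v w * \<alpha> h g) 1) * p) (h ** g)"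
    if "g \<in> G" for g
  proof -
    have "const [:\<alpha> h g:] * p * act_tensor h (const (monom (a g v w) 1)) = const (monom (a g v w * \<alpha> h g) 1) * p"
      unfolding act_tensor_const const_mult_comm[of "_ * p"] const_mult_const_mult
      by (simp add: smult_monom mult.commute)
    then show ?thesis using assms that by (simp only: cp_elem_mult)
  qed
  show ?thesis
    unfolding hecke_relation_def cp_mult_diff_right cp_mult_sum_right 1 using 2 by simp
qed

text \<open>The ideal is additively generated by such products with monomials on both sides, so a
  linear map need only be tested on this expression.\<close>

lemma relation_mult_cp_elem:
  assumes "h \<in> G" "k \<in> G"
  shows "cp_elem p h \<otimes>\<^bsub>R\<^esub> hecke_relation G a v w \<otimes>\<^bsub>R\<^esub> cp_elem q k =
    cp_elem (const [:\<alpha> h k:] * (p * commutator (h *v v) (h *v w) * act_tensor h q)) (h ** k)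
    - (\<Sum>g\<in>G. cp_elem (const (monom (a g v w * \<alpha> h g * \<alpha> (h ** g) k) 1) * (p * act_tensor (h ** g) q)) (h ** g ** k))"
proof -
  have "cp_elem (const (monom (a g v w * \<alpha> h g) 1) * p) (h ** g) \<otimes>\<^bsub>R\<^esub> cp_elem q k =
      cp_elem (const (monom (a g v w * \<alpha> h g * \<alpha> (h ** g) k) 1) * (p * act_tensor (h ** g) q)) (h ** g ** k)" if "g \<in> G" for g
  proof -
    have "const [:\<alpha> (h ** g) k:] * (const (monom (a g v w * \<alpha> h g) 1) * p) * act_tensor (h ** g) q =
        const (monom (a g v w * \<alpha> h g * \<alpha> (h ** g) k) 1) * (p * act_tensor (h ** g) q)"
      unfolding const_mult_const_mult by (simp add: smult_monom mult.assoc mult.commute[of "\<alpha> (h ** g) k"])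
    then show ?thesis using assms that by (simp only: cp_elem_mult mult_in_G)
  qed
  then show ?thesis
    unfolding cp_elem_mult_relation[OF assms(1)] cp_mult_diff_left cp_mult_sum_left
    using assms by (simp add: cp_elem_mult mult.assoc)
qed

text \<open>Two group elements occur: \<open>k\<close> ends the words of the input, and
  \<open>k'\<close> is the component of the result that is read off. They differ because
  contractions multiply \<open>k\<close> from the left.\<close>

definition total_nf :: "(complex^'n^'n \<Rightarrow> ('n, complex poly) tensor) \<Rightarrow> complex^'n^'n \<Rightarrow> ('n, complex poly) symm" where
  "total_nf x k' = (\<Sum>k\<in>G. nf (x k) k k')"

lemma total_nf_add: "total_nf (x + y) k' = total_nf x k' + total_nf y k'"
  and total_nf_diff: "total_nf (x - y) k' = total_nf x k' - total_nf y k'"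
  and total_nf_zero: "total_nf 0 k' = 0"
  by (simp_all add: total_nf_def nf_add nf_diff sum.distrib sum_subtractf)

lemma total_nf_sum: "total_nf (sum f J) k' = (\<Sum>i\<in>J. total_nf (f i) k')"
  by (induction J rule: infinite_finite_induct) (simp_all only: sum.infinite sum.empty sum.insert total_nf_add total_nf_zero not_False_eq_True)

lemma total_nf_cp_elem:
  assumes "g \<in> G"
  shows "total_nf (cp_elem s g) k' = nf s g k'"
proof -
  have "total_nf (cp_elem s g) k' = (\<Sum>k\<in>G. if k = g then nf s g k' else 0)"
    unfolding total_nf_def by (rule sum.cong) (auto simp: cp_elem_def)
  then show ?thesis using assms finite_G by simp
qed

text \<open>Swaps keep the multiset of letters and contractions lose two of them. So at monomials at
  least as long as the word, the normal form is just the image in the symmetric algebra.\<close>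

lemma lookup_normal_form:
  "length w \<le> size m \<Longrightarrow> Poly_Mapping.lookup (normal_form w k k') m = (if k' = k \<and> m = mset w then 1 else 0)"
proof (induction w k k' rule: normal_form.induct)
  case (1 w k k')
  show ?case
  proof (cases "sorted (map to_nat w)")
    case True
    then show ?thesis by (subst normal_form.simps) (auto simp: lookup_single when_def)
  next
    case False
    then obtain u x y v where d: "descent w = (u, x, y, v)" and w: "w = u @ x # y # v"
      by (rule descentE)
    note IH = "1.IH"[OF False d[symmetric] refl refl]
    have "Poly_Mapping.lookup (const c * lin_ext (\<lambda>w'. normal_form w' (g ** k) k')
             (Poly_Mapping.single u 1 * act_tensor g (Poly_Mapping.single v 1))) m = 0" if "g \<in> G" for g c
    proof -
      let ?f = "Poly_Mapping.single u 1 * act_tensor g (Poly_Mapping.single v (1 :: complex poly))"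
      have "Poly_Mapping.lookup (normal_form w' (g ** k) k') m = 0" if "w' \<in> Poly_Mapping.keys ?f" for w'
      proof -
        have "length w' = length u + length v" using that homog_contraction[of u v 1 g 1] by (simp add: homog_def)
        then have "length w' < size m" using "1.prems" w by simp
        then have "m \<noteq> mset w'" by auto
        then show ?thesis
          using IH(2)[OF \<open>g \<in> G\<close> that] \<open>length w' < size m\<close> by auto
      qed
      then show ?thesis by (simp add: lookup_const_mult lin_ext_def lookup_sum)
    qed
    moreover have "Poly_Mapping.lookup (normal_form (u @ y # x # v) k k') m = (if k' = k \<and> m = mset w then 1 else 0)"
      using IH(1) "1.prems" w by (simp add: add_mset_commute)
    ultimately show ?thesis
      using False d by (subst normal_form.simps) (simp add: lookup_add lookup_sum)
  qed
qed

end

context pbw_conditions begin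

text \<open>For monomials, the commutator part has as normal form a contraction of
  \<open>h *v v\<close> with \<open>h *v w\<close>, whereas the other part still involves
  \<open>a g v w\<close>. Conjugating the index by \<open>h\<close> matches the two sums, and
  \<open>equivariant_cocycle\<close> matches their coefficients.\<close>

lemma total_nf_relation:
  assumes "y \<in> carrier R" "z \<in> carrier R"
  shows "total_nf (y \<otimes>\<^bsub>R\<^esub> hecke_relation G a v w \<otimes>\<^bsub>R\<^esub> z) k' = 0"
  using assms(1)
proof (induction y rule: cp_induct)
  case (elem p h)
  show ?case using assms(2)
  proof (induction z rule: cp_induct)
    case (elem q k)
    note G = \<open>h \<in> G\<close> \<open>k \<in> G\<close>
    let ?t = "\<lambda>g. const (monom (a g v w * \<alpha> h g * \<alpha> (h ** g) k) 1) * nf (p * act_tensor (h ** g) q) (h ** g ** k) k'"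
    have "const [:\<alpha> h k:] * contraction p (h *v v) (h *v w) (act_tensor h q) (h ** k) k' = (\<Sum>g\<in>G. ?t g)"
      unfolding contraction_def sum_distrib_left const_mult_const_mult
    proof (subst sum.reindex_bij_betw[OF bij_betw_conj[OF G(1)], symmetric], rule sum.cong[OF refl])
      fix g assume g: "g \<in> G"
      let ?g = "h ** g ** matrix_inv h"
      have "?g ** h = h ** g" using G by (simp flip: matrix_mul_assoc)
      then have "act_tensor ?g (act_tensor h q) = act_tensor (h ** g) q" "?g ** (h ** k) = h ** g ** k"
        by (simp_all add: matrix_mul_assoc flip: act_tensor_matrix_mult)
      then show "const ([:\<alpha> h k:] * monom (a ?g (h *v v) (h *v w) * \<alpha> ?g (h ** k)) 1) *
            nf (p * act_tensor ?g (act_tensor h q)) (?g ** (h ** k)) k' = ?t g"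
        using equivariant_cocycle[OF g G, of v w] by (simp add: smult_monom)
    qed
    then have "const [:\<alpha> h k:] * nf (p * commutator (h *v v) (h *v w) * act_tensor h q) (h ** k) k' = (\<Sum>g\<in>G. ?t g)"
      using G by (simp only: nf_commutator_eq_contraction mult_in_G)
    then show ?case
      unfolding relation_mult_cp_elem[OF G] total_nf_diff total_nf_sum
      using G by (simp add: total_nf_cp_elem nf_const_mult)
  qed (simp_all only: cp_mult_add_right cp_mult_zero total_nf_add total_nf_zero add_0)
qed (simp_all only: cp_mult_add_left cp_mult_zero total_nf_add total_nf_zero add_0)

text \<open>The kernel of \<open>total_nf\<close> is not visibly an ideal; the proof uses the largest ideal inside it.\<close>

lemma total_nf_ideal:
  assumes "x \<in> I"
  shows "total_nf x k' = 0"
proof -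
  let ?J = "{x \<in> carrier R. \<forall>y\<in>carrier R. \<forall>z\<in>carrier R. total_nf (y \<otimes>\<^bsub>R\<^esub> x \<otimes>\<^bsub>R\<^esub> z) k' = 0}"
  have neg: "y \<otimes>\<^bsub>R\<^esub> (- x) \<otimes>\<^bsub>R\<^esub> z = - (y \<otimes>\<^bsub>R\<^esub> x \<otimes>\<^bsub>R\<^esub> z)" for x y z
    using cp_mult_diff_right[of y 0 x] cp_mult_diff_left[of 0 "y \<otimes>\<^bsub>R\<^esub> x" z] by (simp only: cp_mult_zero diff_0)
  have tneg: "total_nf (- x) k' = - total_nf x k'" for x
    using total_nf_diff[of 0 x k'] by (simp only: diff_0 total_nf_zero)
  have "ideal ?J R"
  proof (rule idealI)
    show "subgroup ?J (add_monoid R)"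
    proof
      fix x assume x: "x \<in> ?J"
      then have "inv\<^bsub>add_monoid R\<^esub> x = - x" unfolding a_inv_def[symmetric] by (simp add: cp_uminus)
      then show "inv\<^bsub>add_monoid R\<^esub> x \<in> ?J"
        using x by (simp only: mem_Collect_eq neg tneg uminus_carrier) simp
    qed (auto simp: cp_mult_add_left cp_mult_add_right total_nf_add total_nf_zero)
  next
    fix x y assume *: "x \<in> ?J" "y \<in> carrier R"
    have "u \<otimes>\<^bsub>R\<^esub> (y \<otimes>\<^bsub>R\<^esub> x) \<otimes>\<^bsub>R\<^esub> z = (u \<otimes>\<^bsub>R\<^esub> y) \<otimes>\<^bsub>R\<^esub> x \<otimes>\<^bsub>R\<^esub> z"
        "u \<otimes>\<^bsub>R\<^esub> (x \<otimes>\<^bsub>R\<^esub> y) \<otimes>\<^bsub>R\<^esub> z = u \<otimes>\<^bsub>R\<^esub> x \<otimes>\<^bsub>R\<^esub> (y \<otimes>\<^bsub>R\<^esub> z)"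
      if "u \<in> carrier R" "z \<in> carrier R" for u z
      using * that by (simp_all add: cp_mult_assoc)
    then show "y \<otimes>\<^bsub>R\<^esub> x \<in> ?J" "x \<otimes>\<^bsub>R\<^esub> y \<in> ?J" using * by simp_all
  qed (rule ring_R)
  then have "I \<subseteq> ?J"
    unfolding hecke_ideal_def by (rule cp.genideal_minimal) (auto simp: total_nf_relation)
  then have "total_nf (\<one>\<^bsub>R\<^esub> \<otimes>\<^bsub>R\<^esub> x \<otimes>\<^bsub>R\<^esub> \<one>\<^bsub>R\<^esub>) k' = 0"
    using assms by blast
  then show ?thesis using I_carrier[OF assms] by simp
qed

end

section \<open>Graded sections\<close>

abbreviation poly_embed :: "('m \<Rightarrow>\<^sub>0 complex) \<Rightarrow> ('m \<Rightarrow>\<^sub>0 complex poly)" where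
  "poly_embed \<equiv> Poly_Mapping.map (\<lambda>c. [:c:])"

lemma lookup_poly_embed: "Poly_Mapping.lookup (poly_embed f) m = [:Poly_Mapping.lookup f m:]"
  by (simp add: Poly_Mapping.map.rep_eq when_def)

lemma poly_embed_add: "poly_embed (f + g) = poly_embed f + poly_embed g"
  by (rule poly_mapping_eqI) (simp add: lookup_poly_embed lookup_add)

lemma poly_embed_zero [simp]: "poly_embed 0 = 0" and poly_embed_one [simp]: "poly_embed 1 = 1"
  by (simp_all add: poly_mapping_eq_iff fun_eq_iff lookup_poly_embed lookup_one when_def)

lemma poly_embed_sum: "poly_embed (sum f A) = (\<Sum>i\<in>A. poly_embed (f i))"
  by (induction A rule: infinite_finite_induct) (auto simp: poly_embed_add)

lemma keys_poly_embed [simp]: "Poly_Mapping.keys (poly_embed f) = Poly_Mapping.keys f"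
  by (auto simp: in_keys_iff lookup_poly_embed)

lemma lookup_symm_proj:
  assumes "finite K" "Poly_Mapping.keys f \<subseteq> K"
  shows "Poly_Mapping.lookup (symm_proj f) m = (\<Sum>w\<in>K. if mset w = m then Poly_Mapping.lookup f w else 0)"
  unfolding symm_proj_def lookup_sum
  by (rule sum.mono_neutral_cong_left)
    (use assms in \<open>auto simp: in_keys_iff lookup_single when_def\<close>)

text \<open>A word with at most one letter is determined by its multiset, so tensor and symmetric
  algebra agree in degrees 0 and 1. This leaves a graded section no choice there.\<close>

lemma lookup_symm_proj_mset:
  assumes "length w \<le> 1"
  shows "Poly_Mapping.lookup (symm_proj f) (mset w) = Poly_Mapping.lookup f w"
proof -
  let ?K = "insert w (Poly_Mapping.keys f)"
  have eq: "mset w' = mset w \<longleftrightarrow> w' = w" for w'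
    using assms by (cases w) auto
  have "Poly_Mapping.lookup (symm_proj f) (mset w) = (\<Sum>w'\<in>?K. if w' = w then Poly_Mapping.lookup f w' else 0)"
    by (subst lookup_symm_proj[of ?K]) (auto simp: eq)
  then show ?thesis by simp
qed

locale hecke_section = hecke_data G \<alpha> a for G :: "(complex^'n^'n) set" and \<alpha> and a +
  fixes \<sigma> :: "('n, complex) symm \<Rightarrow> ('n, complex) tensor"
  assumes graded_\<sigma>: "graded_section \<sigma>"
begin

definition lift :: "'n multiset \<Rightarrow> ('n, complex) tensor" where
  "lift m = \<sigma> (Poly_Mapping.single m 1)"

lemma symm_proj_lift: "symm_proj (lift m) = Poly_Mapping.single m 1"
  using graded_\<sigma> unfolding graded_section_def lift_def by blast

lemma homog_lift: "homog (size m) (lift m)"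
proof -
  have "\<forall>m'\<in>Poly_Mapping.keys (Poly_Mapping.single m (1 :: complex)). size m' = size m" by simp
  then show ?thesis using graded_\<sigma> unfolding graded_section_def lift_def homog_def by blast
qed

lemma extend_section_eq: "extend_section \<sigma> = lin_ext (\<lambda>m. poly_embed (lift m))"
  by (simp add: extend_section_def lift_def)

lemma lift_mset:
  assumes "length w \<le> 1"
  shows "lift (mset w) = Poly_Mapping.single w 1"
proof (rule poly_mapping_eqI)
  fix w'
  show "Poly_Mapping.lookup (lift (mset w)) w' = Poly_Mapping.lookup (Poly_Mapping.single w 1) w'"
  proof (cases "length w' = length w")
    case True
    then have "Poly_Mapping.lookup (lift (mset w)) w' = Poly_Mapping.lookup (symm_proj (lift (mset w))) (mset w')"
      using assms by (simp add: lookup_symm_proj_mset)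
    moreover have "mset w = mset w' \<longleftrightarrow> w = w'" using assms by (cases w) auto
    ultimately show ?thesis by (simp add: symm_proj_lift lookup_single when_def)
  next
    case False
    then have "w' \<notin> Poly_Mapping.keys (lift (mset w))" using homog_lift[of "mset w"] by (auto simp: homog_def)
    then show ?thesis using False by (auto simp: lookup_single when_def in_keys_iff)
  qed
qed

lemma extend_section_const: "extend_section \<sigma> (const c) = const c"
  using lift_mset[of "[]"] by (simp add: extend_section_eq lin_ext_single)

lemma extend_section_vec: "extend_section \<sigma> (vec_symm v) = vec_tensor v"
proof -
  have "lift {#i#} = Poly_Mapping.single [i] 1" for i using lift_mset[of "[i]"] by simp
  then show ?thesis
    by (simp add: extend_section_eq vec_symm_def vec_tensor_def lin_ext_sum lin_ext_single mult_single flip: one_pCons)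
qed

abbreviation "S \<equiv> symm_cp G \<alpha>"

lemma S_carrier: "x \<in> carrier S \<longleftrightarrow> (\<forall>g. g \<notin> G \<longrightarrow> x g = 0)"
  and S_add: "x \<oplus>\<^bsub>S\<^esub> y = x + y"
  and S_smult: "p \<odot>\<^bsub>S\<^esub> x = (\<lambda>g. const p * x g)"
  by (simp_all add: crossed_product_def)

definition sect :: "(complex^'n^'n \<Rightarrow> ('n, complex poly) symm) \<Rightarrow> (complex^'n^'n \<Rightarrow> ('n, complex poly) tensor)" where
  "sect x = (\<lambda>g. extend_section \<sigma> (x g))"

lemma sect_add: "sect (x + y) = sect x + sect y"
  and sect_diff: "sect (x - y) = sect x - sect y"
  by (simp_all add: sect_def extend_section_eq lin_ext_add lin_ext_diff fun_eq_iff)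

lemma sect_smult: "sect (\<lambda>g. const p * x g) = p \<odot>\<^bsub>R\<^esub> sect x"
  by (simp add: sect_def extend_section_eq lin_ext_const_mult cp_smult)

lemma sect_carrier: "x \<in> carrier S \<Longrightarrow> sect x \<in> carrier R"
  by (simp add: S_carrier cp_carrier sect_def extend_section_eq)

lemma hecke_map_eq: "hecke_map G \<alpha> \<sigma> a x = I +>\<^bsub>R\<^esub> sect x"
  by (simp add: hecke_map_def sect_def)

lemma coset_eq_iff:
  assumes "x \<in> carrier R" "y \<in> carrier R"
  shows "I +>\<^bsub>R\<^esub> x = I +>\<^bsub>R\<^esub> y \<longleftrightarrow> x - y \<in> I"
  using cp.quotient_eq_iff_same_a_r_cos[OF ideal_I assms] cp_minus[OF assms] by simp

lemma hecke_algebra_simps: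
  "carrier (hecke_algebra G \<alpha> a) = a_rcosets\<^bsub>R\<^esub> I"
  "X \<oplus>\<^bsub>hecke_algebra G \<alpha> a\<^esub> Y = X <+>\<^bsub>R\<^esub> Y"
  "p \<odot>\<^bsub>hecke_algebra G \<alpha> a\<^esub> X = (\<Union>x\<in>X. I +>\<^bsub>R\<^esub> (p \<odot>\<^bsub>R\<^esub> x))"
  by (simp_all add: hecke_algebra_def quotient_algebra_def ring.extend_def FactRing_def)

lemma smult_carrier: "x \<in> carrier R \<Longrightarrow> p \<odot>\<^bsub>R\<^esub> x \<in> carrier R"
  by (simp add: cp_carrier cp_smult)

lemma smult_coset:
  assumes "x \<in> carrier R"
  shows "(\<Union>y\<in>I +>\<^bsub>R\<^esub> x. I +>\<^bsub>R\<^esub> (p \<odot>\<^bsub>R\<^esub> y)) = I +>\<^bsub>R\<^esub> (p \<odot>\<^bsub>R\<^esub> x)"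
proof -
  have "I +>\<^bsub>R\<^esub> (p \<odot>\<^bsub>R\<^esub> y) = I +>\<^bsub>R\<^esub> (p \<odot>\<^bsub>R\<^esub> x)" if y: "y \<in> I +>\<^bsub>R\<^esub> x" for y
  proof -
    obtain z where z: "z \<in> I" "y = z + x" using y unfolding a_r_coset_def' by auto
    have "p \<odot>\<^bsub>R\<^esub> y - p \<odot>\<^bsub>R\<^esub> x = p \<odot>\<^bsub>R\<^esub> z" by (simp add: z cp_smult fun_eq_iff distrib_left)
    then show ?thesis
      using z assms I_smult[OF z(1), of p] by (subst coset_eq_iff) (auto intro!: smult_carrier simp: I_carrier)
  qed
  moreover have "x \<in> I +>\<^bsub>R\<^esub> x"
    using I_zero assms by (auto simp: a_r_coset_def' intro!: bexI[of _ 0])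
  ultimately show ?thesis by blast
qed

text \<open>The map respects sums and scalars for every family, so being an isomorphism is a matter
  of bijectivity. Stating it with representatives avoids cosets from here on.\<close>

lemma twisted_graded_hecke_iff:
  "twisted_graded_hecke G \<alpha> \<sigma> a \<longleftrightarrow>
     (\<forall>x\<in>carrier S. sect x \<in> I \<longrightarrow> x = 0) \<and> (\<forall>y\<in>carrier R. \<exists>x\<in>carrier S. y - sect x \<in> I)"
proof -
  have "hecke_map G \<alpha> \<sigma> a (x \<oplus>\<^bsub>S\<^esub> y) = hecke_map G \<alpha> \<sigma> a x \<oplus>\<^bsub>hecke_algebra G \<alpha> a\<^esub> hecke_map G \<alpha> \<sigma> a y"
    if "x \<in> carrier S" "y \<in> carrier S" for x y
    unfolding hecke_map_eq hecke_algebra_simps S_add sect_add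
    using abelian_subgroup.a_rcos_sum[OF abelian_subgroupI3[OF ideal.axioms(1)[OF ideal_I] cp.abelian_group_axioms]
      sect_carrier[OF that(1)] sect_carrier[OF that(2)]] by simp
  moreover have "hecke_map G \<alpha> \<sigma> a (p \<odot>\<^bsub>S\<^esub> x) = p \<odot>\<^bsub>hecke_algebra G \<alpha> a\<^esub> hecke_map G \<alpha> \<sigma> a x"
    if "x \<in> carrier S" for p x
    unfolding hecke_map_eq hecke_algebra_simps S_smult sect_smult smult_coset[OF sect_carrier[OF that]] ..
  ultimately have "twisted_graded_hecke G \<alpha> \<sigma> a \<longleftrightarrow>
      bij_betw (hecke_map G \<alpha> \<sigma> a) (carrier S) (a_rcosets\<^bsub>R\<^esub> I)"
    unfolding twisted_graded_hecke_def module_iso_def hecke_algebra_simps(1) by blast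
  also have "\<dots> \<longleftrightarrow> inj_on (hecke_map G \<alpha> \<sigma> a) (carrier S) \<and> hecke_map G \<alpha> \<sigma> a ` carrier S = a_rcosets\<^bsub>R\<^esub> I"
    by (simp add: bij_betw_def)
  also have "inj_on (hecke_map G \<alpha> \<sigma> a) (carrier S) \<longleftrightarrow> (\<forall>x\<in>carrier S. sect x \<in> I \<longrightarrow> x = 0)"
  proof
    assume inj: "inj_on (hecke_map G \<alpha> \<sigma> a) (carrier S)"
    show "\<forall>x\<in>carrier S. sect x \<in> I \<longrightarrow> x = 0"
    proof (intro ballI impI)
      fix x assume x: "x \<in> carrier S" "sect x \<in> I"
      have "sect 0 = 0" using sect_diff[of 0 0] by simp
      then have "hecke_map G \<alpha> \<sigma> a x = hecke_map G \<alpha> \<sigma> a 0"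
        unfolding hecke_map_eq using x by (subst coset_eq_iff) (auto intro: sect_carrier)
      then show "x = 0" using inj x by (auto dest: inj_onD simp: S_carrier)
    qed
  next
    assume *: "\<forall>x\<in>carrier S. sect x \<in> I \<longrightarrow> x = 0"
    show "inj_on (hecke_map G \<alpha> \<sigma> a) (carrier S)"
    proof (rule inj_onI)
      fix x y assume xy: "x \<in> carrier S" "y \<in> carrier S" "hecke_map G \<alpha> \<sigma> a x = hecke_map G \<alpha> \<sigma> a y"
      then have "sect (x - y) \<in> I"
        unfolding hecke_map_eq sect_diff by (subst (asm) coset_eq_iff) (auto intro: sect_carrier)
      moreover have "x - y \<in> carrier S" using xy by (simp add: S_carrier)
      ultimately show "x = y" using * by auto
    qed
  qed
  also have "hecke_map G \<alpha> \<sigma> a ` carrier S = a_rcosets\<^bsub>R\<^esub> I \<longleftrightarrow> (\<forall>y\<in>carrier R. \<exists>x\<in>carrier S. y - sect x \<in> I)"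
  proof -
    have cosets: "a_rcosets\<^bsub>R\<^esub> I = (\<lambda>y. I +>\<^bsub>R\<^esub> y) ` carrier R" by (auto simp: A_RCOSETS_def')
    show ?thesis
    proof
      assume *: "hecke_map G \<alpha> \<sigma> a ` carrier S = a_rcosets\<^bsub>R\<^esub> I"
      show "\<forall>y\<in>carrier R. \<exists>x\<in>carrier S. y - sect x \<in> I"
      proof
        fix y assume y: "y \<in> carrier R"
        then obtain x where "x \<in> carrier S" "I +>\<^bsub>R\<^esub> y = I +>\<^bsub>R\<^esub> sect x"
          using * unfolding cosets hecke_map_eq by (metis (no_types, lifting) image_iff)
        then show "\<exists>x\<in>carrier S. y - sect x \<in> I" using y coset_eq_iff sect_carrier by blast
      qed
    next
      assume *: "\<forall>y\<in>carrier R. \<exists>x\<in>carrier S. y - sect x \<in> I"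
      show "hecke_map G \<alpha> \<sigma> a ` carrier S = a_rcosets\<^bsub>R\<^esub> I"
      proof
        show "hecke_map G \<alpha> \<sigma> a ` carrier S \<subseteq> a_rcosets\<^bsub>R\<^esub> I"
          unfolding cosets hecke_map_eq using sect_carrier by blast
        show "a_rcosets\<^bsub>R\<^esub> I \<subseteq> hecke_map G \<alpha> \<sigma> a ` carrier S"
        proof
          fix X assume "X \<in> a_rcosets\<^bsub>R\<^esub> I"
          then obtain y where y: "y \<in> carrier R" "X = I +>\<^bsub>R\<^esub> y" unfolding cosets by blast
          then obtain x where "x \<in> carrier S" "y - sect x \<in> I" using * by blast
          then have "X = hecke_map G \<alpha> \<sigma> a x" unfolding hecke_map_eq y(2) using y sect_carrier coset_eq_iff by blast
          then show "X \<in> hecke_map G \<alpha> \<sigma> a ` carrier S" using \<open>x \<in> carrier S\<close> by blast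
        qed
      qed
    qed
  qed
  finally show ?thesis .
qed

text \<open>A lift may combine many words, but all have the length of the monomial. At a monomial of
  at least that size, the normal form adds up the coefficients of the words above it, which is the
  projection of the lift.\<close>

lemma lookup_nf_section:
  assumes "\<And>m'. m' \<in> Poly_Mapping.keys s \<Longrightarrow> size m' \<le> size m"
  shows "Poly_Mapping.lookup (nf (extend_section \<sigma> s) k k') m = (if k' = k then Poly_Mapping.lookup s m else 0)"
proof -
  have lift: "Poly_Mapping.lookup (nf (poly_embed (lift m')) k k') m = (if k' = k \<and> m' = m then 1 else 0)"
    if "size m' \<le> size m" for m'
  proof -
    let ?K = "Poly_Mapping.keys (lift m')"
    have "Poly_Mapping.lookup (nf (poly_embed (lift m')) k k') m =
        (\<Sum>w\<in>?K. [:Poly_Mapping.lookup (lift m') w:] * Poly_Mapping.lookup (normal_form w k k') m)"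
      by (simp add: nf_def lin_ext_def lookup_sum lookup_const_mult lookup_poly_embed)
    also have "\<dots> = (\<Sum>w\<in>?K. [:if k' = k \<and> mset w = m then Poly_Mapping.lookup (lift m') w else 0:])"
    proof (rule sum.cong[OF refl])
      fix w assume "w \<in> ?K"
      then have "length w \<le> size m" using homog_lift[of m'] that by (auto simp: homog_def)
      then show "[:Poly_Mapping.lookup (lift m') w:] * Poly_Mapping.lookup (normal_form w k k') m =
          [:if k' = k \<and> mset w = m then Poly_Mapping.lookup (lift m') w else 0:]"
        by (simp add: lookup_normal_form)
    qed
    also have "\<dots> = [:\<Sum>w\<in>?K. if k' = k \<and> mset w = m then Poly_Mapping.lookup (lift m') w else 0:]"
      by (induction rule: infinite_finite_induct) auto
    also have "\<dots> = (if k' = k then [:Poly_Mapping.lookup (symm_proj (lift m')) m:] else 0)"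
      by (simp add: lookup_symm_proj[of ?K])
    finally show ?thesis by (simp add: symm_proj_lift lookup_single when_def)
  qed
  have "Poly_Mapping.lookup (nf (extend_section \<sigma> s) k k') m =
      (\<Sum>m'\<in>Poly_Mapping.keys s. Poly_Mapping.lookup s m' * Poly_Mapping.lookup (nf (poly_embed (lift m')) k k') m)"
    by (simp add: extend_section_eq lin_ext_def nf_sum nf_const_mult lookup_sum lookup_const_mult)
  also have "\<dots> = (\<Sum>m'\<in>Poly_Mapping.keys s. if m' = m then (if k' = k then Poly_Mapping.lookup s m else 0) else 0)"
    by (rule sum.cong) (auto simp: lift assms)
  also have "\<dots> = (if k' = k then Poly_Mapping.lookup s m else 0)"
    by (simp add: in_keys_iff)
  finally show ?thesis .
qed

text \<open>A monomial of maximal size among all group components of \<open>x\<close> is out of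
  reach of lower terms, so its coefficient in \<open>x\<close> reappears in the normal form of the
  section.\<close>

lemma total_nf_sect_eq_0:
  assumes "x \<in> carrier S" "\<And>k'. total_nf (sect x) k' = 0"
  shows "x = 0"
proof (rule ccontr)
  assume "x \<noteq> 0"
  define K where "K = (\<Union>g\<in>G. Poly_Mapping.keys (x g))"
  obtain g where "x g \<noteq> 0" using \<open>x \<noteq> 0\<close> by (auto simp: fun_eq_iff)
  then have "g \<in> G" "Poly_Mapping.keys (x g) \<noteq> {}" using assms(1) by (auto simp: S_carrier)
  then have "K \<noteq> {}" "finite K" using finite_G by (auto simp: K_def)
  then have "Max (size ` K) \<in> size ` K" by simp
  then obtain m where m: "m \<in> K" "\<And>m'. m' \<in> K \<Longrightarrow> size m' \<le> size m"
    using \<open>finite K\<close> by (metis (no_types, lifting) Max_ge finite_imageI image_iff)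
  then obtain h where h: "h \<in> G" "Poly_Mapping.lookup (x h) m \<noteq> 0" by (auto simp: K_def in_keys_iff)
  have "Poly_Mapping.lookup (total_nf (sect x) h) m = (\<Sum>k\<in>G. if h = k then Poly_Mapping.lookup (x k) m else 0)"
    unfolding total_nf_def sect_def lookup_sum
    by (intro sum.cong refl lookup_nf_section m(2)) (auto simp: K_def)
  also have "\<dots> = Poly_Mapping.lookup (x h) m" using h finite_G by simp
  finally show False using assms(2) h by simp
qed

end

text \<open>Applied with \<open>p1\<close>, \<open>p2\<close>, \<open>p3\<close> coming from the
  double commutators of three vectors, whose cyclic sum is zero.\<close>

lemma minus_sum_diffs:
  fixes p1 :: "'a::ab_group_add"
  assumes "p1 + p2 + p3 = 0"
  shows "- ((p1 - s1) + (p2 - s2) + (p3 - s3)) = s1 + s2 + s3"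
proof -
  have "- ((p1 - s1) + (p2 - s2) + (p3 - s3)) = s1 + s2 + s3 - (p1 + p2 + p3)"
    by (simp add: algebra_simps)
  then show ?thesis by (simp add: assms)
qed

section \<open>Surjectivity of the canonical map\<close>

context hecke_section begin

text \<open>The elements whose class is hit. They form a submodule that contains both the ideal and
  all sections; the aim is to show that it is everything.\<close>

definition reach :: "(complex^'n^'n \<Rightarrow> ('n, complex poly) tensor) set" where
  "reach = {y \<in> carrier R. \<exists>x\<in>carrier S. y - sect x \<in> I}"

lemma reach_I: "x \<in> I \<Longrightarrow> x \<in> reach"
proof -
  have "sect 0 = 0" using sect_diff[of 0 0] by simp
  moreover assume "x \<in> I"
  ultimately show ?thesis unfolding reach_def by (auto simp: I_carrier S_carrier intro!: bexI[of _ 0])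
qed

lemma reach_sect: "x \<in> carrier S \<Longrightarrow> sect x \<in> reach"
  unfolding reach_def using I_zero sect_carrier by (auto intro!: bexI[of _ x])

lemma reach_add:
  assumes "y \<in> reach" "y' \<in> reach"
  shows "y + y' \<in> reach"
proof -
  obtain x x' where x: "x \<in> carrier S" "y - sect x \<in> I" "x' \<in> carrier S" "y' - sect x' \<in> I"
    using assms by (auto simp: reach_def)
  have "y + y' - sect (x + x') = (y - sect x) + (y' - sect x')" by (simp only: sect_add algebra_simps)
  then have "y + y' - sect (x + x') \<in> I" using I_add[OF x(2,4)] by (simp only:)
  moreover have "x + x' \<in> carrier S" using x by (simp add: S_carrier)
  ultimately show ?thesis using assms unfolding reach_def by (intro CollectI conjI bexI[of _ "x + x'"]) auto
qed

lemma reach_smult: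
  assumes "y \<in> reach"
  shows "p \<odot>\<^bsub>R\<^esub> y \<in> reach"
proof -
  obtain x where x: "x \<in> carrier S" "y - sect x \<in> I"
    using assms by (auto simp: reach_def)
  have "p \<odot>\<^bsub>R\<^esub> y - sect (\<lambda>g. const p * x g) = p \<odot>\<^bsub>R\<^esub> (y - sect x)"
    unfolding sect_smult by (simp add: cp_smult fun_eq_iff right_diff_distrib)
  then have "p \<odot>\<^bsub>R\<^esub> y - sect (\<lambda>g. const p * x g) \<in> I" using I_smult[OF x(2), of p] by (simp only:)
  moreover have "(\<lambda>g. const p * x g) \<in> carrier S" using x by (simp add: S_carrier)
  ultimately show ?thesis using assms unfolding reach_def by (auto intro: smult_carrier)
qed

lemma reach_const_mult:
  assumes "cp_elem s g \<in> reach"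
  shows "cp_elem (const c * s) g \<in> reach"
proof -
  have "cp_elem (const c * s) g = c \<odot>\<^bsub>R\<^esub> cp_elem s g" by (auto simp: cp_smult cp_elem_def fun_eq_iff)
  then show ?thesis using reach_smult[OF assms] by simp
qed

lemma reach_diff:
  assumes "y \<in> reach" "y' \<in> reach"
  shows "y - y' \<in> reach"
proof -
  have "y - y' = y + (- 1) \<odot>\<^bsub>R\<^esub> y'" by (simp add: cp_smult fun_eq_iff single_uminus)
  then show ?thesis using reach_add[OF assms(1) reach_smult[OF assms(2)], of "- 1"] by (simp only:)
qed

lemma reach_sum: "(\<And>i. i \<in> A \<Longrightarrow> f i \<in> reach) \<Longrightarrow> sum f A \<in> reach"
  by (induction A rule: infinite_finite_induct) (simp_all add: reach_add reach_I I_zero)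

lemma reach_poly_mapping:
  assumes "\<And>w. w \<in> Poly_Mapping.keys s \<Longrightarrow> cp_elem (Poly_Mapping.single w 1) g \<in> reach"
  shows "cp_elem s g \<in> reach"
proof -
  have "cp_elem (Poly_Mapping.single w c) g \<in> reach" if "w \<in> Poly_Mapping.keys s" for w c
    using reach_const_mult[OF assms[OF that], of c] by (simp add: mult_single)
  then have "(\<Sum>w\<in>Poly_Mapping.keys s. cp_elem (Poly_Mapping.single w (Poly_Mapping.lookup s w)) g) \<in> reach"
    by (rule reach_sum)
  then show ?thesis by (simp flip: cp_elem_sum poly_mapping_sum_single)
qed

definition sort_word :: "'n list \<Rightarrow> 'n list" where
  "sort_word = sort_key to_nat"

lemma sort_word_cong: "mset w = mset w' \<Longrightarrow> sort_word w = sort_word w'"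
  unfolding sort_word_def
  by (rule sort_key_inj_key_eq) (auto intro: inj_on_subset[OF inj_to_nat])

text \<open>The relation of two basis vectors, multiplied by \<open>u\<close> on the left and by
  \<open>v\<close> and \<open>g\<close> on the right, equates the difference of the words with words
  two letters shorter, which are reachable by assumption.\<close>

lemma reach_swap:
  assumes "g \<in> G" "\<And>w k. length w = length u + length v \<Longrightarrow> k \<in> G \<Longrightarrow> cp_elem (Poly_Mapping.single w 1) k \<in> reach"
  shows "cp_elem (Poly_Mapping.single (u @ x # y # v) 1 - Poly_Mapping.single (u @ y # x # v) 1) g \<in> reach"
proof -
  let ?r = "hecke_relation G a (axis x 1) (axis y 1)"
  let ?c = "\<lambda>h. const (monom (a h (axis x 1) (axis y 1) * \<alpha> (mat 1) h * \<alpha> (mat 1 ** h) g) 1) *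
      (Poly_Mapping.single u 1 * act_tensor (mat 1 ** h) (Poly_Mapping.single v 1))"
  let ?d = "cp_elem (Poly_Mapping.single (u @ x # y # v) 1 - Poly_Mapping.single (u @ y # x # v) 1) g"
  have d: "const [:\<alpha> (mat 1) g:] * (Poly_Mapping.single u 1 * commutator (mat 1 *v axis x 1) (mat 1 *v axis y 1) *
      act_tensor (mat 1) (Poly_Mapping.single v 1)) = Poly_Mapping.single (u @ x # y # v) 1 - Poly_Mapping.single (u @ y # x # v) 1"
    using assms(1) by (simp add: vec_tensor_axis mult_single left_diff_distrib right_diff_distrib flip: one_pCons)
  have "cp_elem (Poly_Mapping.single u 1) (mat 1) \<otimes>\<^bsub>R\<^esub> ?r \<otimes>\<^bsub>R\<^esub> cp_elem (Poly_Mapping.single v 1) g \<in> I"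
    using assms(1) by (intro I_mult_right I_mult_left hecke_relation_in_I) auto
  then have "?d - (\<Sum>h\<in>G. cp_elem (?c h) (mat 1 ** h ** g)) \<in> reach"
    unfolding relation_mult_cp_elem[OF one_in_G assms(1)] d matrix_mul_lid by (rule reach_I)
  moreover have "(\<Sum>h\<in>G. cp_elem (?c h) (mat 1 ** h ** g)) \<in> reach"
  proof (rule reach_sum, rule reach_const_mult, rule reach_poly_mapping)
    fix h w assume "h \<in> G" "w \<in> Poly_Mapping.keys (Poly_Mapping.single u 1 * act_tensor (mat 1 ** h) (Poly_Mapping.single v (1::complex poly)))"
    then show "cp_elem (Poly_Mapping.single w 1) (mat 1 ** h ** g) \<in> reach"
      using homog_contraction[of u v 1 "mat 1 ** h" 1] assms by (auto simp: homog_def)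
  qed
  ultimately have "?d - (\<Sum>h\<in>G. cp_elem (?c h) (mat 1 ** h ** g)) + (\<Sum>h\<in>G. cp_elem (?c h) (mat 1 ** h ** g)) \<in> reach"
    by (rule reach_add)
  then show ?thesis unfolding diff_add_cancel .
qed

lemma reach_sort_word:
  assumes "g \<in> G" "\<And>w' k. length w' < length w \<Longrightarrow> k \<in> G \<Longrightarrow> cp_elem (Poly_Mapping.single w' 1) k \<in> reach"
  shows "cp_elem (Poly_Mapping.single w 1 - Poly_Mapping.single (sort_word w) 1) g \<in> reach"
  using assms(2)
proof (induction "word_weight w" arbitrary: w rule: less_induct)
  case less
  show ?case
  proof (cases "sorted (map to_nat w)")
    case True
    then have "sort_word w = w" by (simp add: sort_word_def sorted_sort_id sort_key_id_if_sorted)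
    then show ?thesis using reach_I[OF I_zero] by simp
  next
    case False
    then obtain u x y v where w: "w = u @ x # y # v" "to_nat y < to_nat x" by (rule descentE)
    let ?w = "u @ y # x # v"
    have "cp_elem (Poly_Mapping.single w 1 - Poly_Mapping.single ?w 1) g \<in> reach"
      unfolding w(1) by (rule reach_swap[OF assms(1)]) (use less.prems w in auto)
    moreover have "cp_elem (Poly_Mapping.single ?w 1 - Poly_Mapping.single (sort_word ?w) 1) g \<in> reach"
      by (rule less.hyps) (use less.prems w word_weight_swap in auto)
    moreover have "sort_word ?w = sort_word w" by (rule sort_word_cong) (simp add: w)
    ultimately have "cp_elem (Poly_Mapping.single w 1 - Poly_Mapping.single ?w 1) g
        + cp_elem (Poly_Mapping.single ?w 1 - Poly_Mapping.single (sort_word w) 1) g \<in> reach"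
      by (simp add: reach_add)
    then show ?thesis by (simp flip: cp_elem_add)
  qed
qed

text \<open>Words of \<open>lift m\<close> may well have multisets other than \<open>m\<close>.
  Replacing each word by the sorted one factors through \<open>symm_proj\<close>, where these
  contributions cancel and \<open>m\<close> survives with coefficient 1.\<close>

lemma sum_sorted_lift:
  "(\<Sum>w\<in>Poly_Mapping.keys (lift m). Poly_Mapping.single (sort_word w) [:Poly_Mapping.lookup (lift m) w:]) =
    Poly_Mapping.single (sort_word (SOME w. mset w = m)) 1"
proof -
  define r where "r m = sort_word (SOME w. mset w = m)" for m
  have r: "sort_word w = r (mset w)" for w
  proof -
    have "mset (SOME w'. mset w' = mset w) = mset w" by (rule someI[of "\<lambda>w'. mset w' = mset w"]) (rule refl)
    then show ?thesis unfolding r_def by (intro sort_word_cong) simp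
  qed
  have "(\<Sum>w\<in>Poly_Mapping.keys (lift m). Poly_Mapping.single (sort_word w) (Poly_Mapping.lookup (lift m) w)) =
      lin_ext (\<lambda>m. Poly_Mapping.single (r m) 1) (symm_proj (lift m))"
    by (simp add: symm_proj_def lin_ext_sum lin_ext_single mult_single r)
  also have "\<dots> = Poly_Mapping.single (r m) 1"
    by (simp add: symm_proj_lift lin_ext_single)
  finally have "poly_embed (\<Sum>w\<in>Poly_Mapping.keys (lift m). Poly_Mapping.single (sort_word w) (Poly_Mapping.lookup (lift m) w)) =
      Poly_Mapping.single (r m) [:1:]" by simp
  then show ?thesis by (simp add: poly_embed_sum r_def flip: one_pCons)
qed

text \<open>The lift of \<open>mset w\<close> is reachable, being a section. Sorting its words costs
  only reachable elements by the induction on length and leaves \<open>sort_word w\<close>; undoing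
  the sorting then reaches \<open>w\<close>.\<close>

lemma reach_word: "g \<in> G \<Longrightarrow> cp_elem (Poly_Mapping.single w 1) g \<in> reach"
proof (induction "length w" arbitrary: w g rule: less_induct)
  case less
  let ?m = "mset w" and ?s = "\<lambda>w. Poly_Mapping.single w (1 :: complex poly)"
  let ?l = "\<lambda>w. [:Poly_Mapping.lookup (lift ?m) w:]"
  let ?K = "Poly_Mapping.keys (lift ?m)"
  have sorted: "cp_elem (?s w' - ?s (sort_word w')) g \<in> reach" if "length w' = length w" for w'
    by (rule reach_sort_word[OF less.prems]) (use less.hyps that in auto)
  have "cp_elem (poly_embed (lift ?m)) g \<in> reach"
  proof -
    have "sect (cp_elem (Poly_Mapping.single ?m 1) g) = cp_elem (poly_embed (lift ?m)) g"
      by (auto simp: sect_def cp_elem_def extend_section_eq lin_ext_single fun_eq_iff)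
    moreover have "cp_elem (Poly_Mapping.single ?m 1) g \<in> carrier S"
      using less.prems by (auto simp: S_carrier cp_elem_def)
    ultimately show ?thesis using reach_sect by metis
  qed
  moreover have "(\<Sum>w'\<in>?K. cp_elem (const (?l w') * (?s w' - ?s (sort_word w'))) g) \<in> reach"
  proof (intro reach_sum reach_const_mult sorted)
    fix w' assume "w' \<in> ?K"
    then show "length w' = length w" using homog_lift[of ?m] by (simp add: homog_def)
  qed
  ultimately have "cp_elem (poly_embed (lift ?m)) g - (\<Sum>w'\<in>?K. cp_elem (const (?l w') * (?s w' - ?s (sort_word w'))) g) \<in> reach"
    by (rule reach_diff)
  moreover have "poly_embed (lift ?m) - (\<Sum>w'\<in>?K. const (?l w') * (?s w' - ?s (sort_word w'))) = ?s (sort_word w)"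
  proof -
    have "poly_embed (lift ?m) = (\<Sum>w'\<in>?K. Poly_Mapping.single w' (?l w'))"
      using poly_mapping_sum_single[of "poly_embed (lift ?m)"] by (simp add: lookup_poly_embed)
    then have "poly_embed (lift ?m) - (\<Sum>w'\<in>?K. const (?l w') * (?s w' - ?s (sort_word w'))) =
        (\<Sum>w'\<in>?K. Poly_Mapping.single (sort_word w') (?l w'))"
      by (simp add: right_diff_distrib mult_single sum_subtractf)
    also have "\<dots> = ?s (sort_word (SOME w'. mset w' = ?m))" by (rule sum_sorted_lift)
    also have "sort_word (SOME w'. mset w' = ?m) = sort_word w"
      by (rule sort_word_cong) (rule someI[of "\<lambda>w'. mset w' = mset w"], rule refl)
    finally show ?thesis .
  qed
  ultimately have "cp_elem (?s (sort_word w)) g \<in> reach"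
    by (simp flip: cp_elem_sum cp_elem_diff)
  from reach_add[OF sorted[OF refl] this] show ?case by (simp flip: cp_elem_add)
qed

lemma reach_all: "y \<in> carrier R \<Longrightarrow> y \<in> reach"
proof (induction y rule: cp_induct)
  case (elem s g)
  show ?case by (rule reach_poly_mapping, rule reach_word) (rule elem)
next
  case zero
  show ?case by (rule reach_I[OF I_zero])
qed (rule reach_add)

lemma twisted_graded_hecke_iff_inj:
  "twisted_graded_hecke G \<alpha> \<sigma> a \<longleftrightarrow> (\<forall>x\<in>carrier S. sect x \<in> I \<longrightarrow> x = 0)"
proof -
  have "\<exists>x\<in>carrier S. y - sect x \<in> I" if "y \<in> carrier R" for y
    using reach_all[OF that] by (simp add: reach_def)
  then have "\<forall>y\<in>carrier R. \<exists>x\<in>carrier S. y - sect x \<in> I" ..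
  then show ?thesis
    unfolding twisted_graded_hecke_iff by (intro iffI conjI) (erule conjunct1)
qed

lemma pbw_imp_twisted_graded_hecke:
  assumes "pbw_conditions G \<alpha> a"
  shows "twisted_graded_hecke G \<alpha> \<sigma> a"
  unfolding twisted_graded_hecke_iff_inj
proof (intro ballI impI)
  fix x assume "x \<in> carrier S" "sect x \<in> I"
  then show "x = 0"
    by (intro total_nf_sect_eq_0 pbw_conditions.total_nf_ideal[OF assms])
qed

section \<open>Necessity of equivariance and of the Jacobi identity\<close>

lemma cp_elem_reindex:
  assumes "bij_betw \<phi> G G" "h \<in> G"
  shows "(\<Sum>g\<in>G. cp_elem (f g) (\<phi> g)) (\<phi> h) = (f h :: 's::comm_monoid_add)"
proof -
  have "(\<Sum>g\<in>G. cp_elem (f g) (\<phi> g)) (\<phi> h) = (\<Sum>g\<in>G. if g = h then f g else 0)"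
    unfolding sum_apply
  proof (rule sum.cong[OF refl])
    fix g assume "g \<in> G"
    then have "\<phi> h = \<phi> g \<longleftrightarrow> g = h" using assms by (metis bij_betw_imp_inj_on inj_on_eq_iff)
    then show "cp_elem (f g) (\<phi> g) (\<phi> h) = (if g = h then f g else 0)" by (simp add: cp_elem_def)
  qed
  then show ?thesis using finite_G assms by simp
qed

lemma twisted_graded_hecke_imp_pbw:
  assumes "twisted_graded_hecke G \<alpha> \<sigma> a"
  shows "pbw_conditions G \<alpha> a"
proof
  have inj: "x = 0" if "x \<in> carrier S" "sect x \<in> I" for x
    using assms that unfolding twisted_graded_hecke_iff_inj by blast
  {
    fix g h v w assume G: "g \<in> G" "h \<in> G"
    let ?E = "cp_elem 1 h \<otimes>\<^bsub>R\<^esub> hecke_relation G a v w - hecke_relation G a (h *v v) (h *v w) \<otimes>\<^bsub>R\<^esub> cp_elem 1 h"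
    have "?E \<in> I" using G by (intro I_diff I_mult_left I_mult_right hecke_relation_in_I) auto
    have right: "hecke_relation G a (h *v v) (h *v w) \<otimes>\<^bsub>R\<^esub> cp_elem 1 h =
        cp_elem (commutator (h *v v) (h *v w)) h - (\<Sum>g\<in>G. cp_elem (const (monom (a g (h *v v) (h *v w) * \<alpha> g h) 1)) (g ** h))"
      unfolding hecke_relation_def cp_mult_diff_left cp_mult_sum_left
      using G by (simp add: cp_elem_mult mult_single smult_monom mult.commute[of "\<alpha> _ _"] flip: one_pCons)
    \<comment> \<open>The commutators in \<open>?E\<close> cancel, so every component is a scalar
      polynomial. On scalars the section is the identity, which exhibits \<open>?E\<close> as the
      section of \<open>c\<close>.\<close>
    define c where "c k = (\<Sum>g\<in>G. cp_elem (monom (a g (h *v v) (h *v w) * \<alpha> g h) 1) (g ** h) k)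
        - (\<Sum>g\<in>G. cp_elem (monom (a g v w * \<alpha> h g) 1) (h ** g) k)" for k
    have ce: "cp_elem (const p) k k' = const (cp_elem p k k')" for p :: "complex poly" and k k'
      by (simp add: cp_elem_def)
    have const_sum: "const (sum f A) = (\<Sum>i\<in>A. const (f i) :: ('n, complex poly) tensor)" for f :: "complex^'n^'n \<Rightarrow> complex poly" and A
      by (induction A rule: infinite_finite_induct) (auto simp: single_add)
    have "sect (\<lambda>k. const (c k)) = (\<lambda>k. const (c k))" by (simp add: sect_def extend_section_const)
    also have "\<dots> = ?E"
      unfolding right cp_elem_mult_relation[OF G(2)]
      by (simp add: c_def fun_eq_iff sum_apply ce single_diff const_sum)
    finally have "sect (\<lambda>k. const (c k)) = ?E" .
    moreover have "(\<lambda>k. const (c k)) \<in> carrier S"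
    proof -
      have "cp_elem p (g ** h) k = 0" "cp_elem p (h ** g) k = 0" if "g \<in> G" "k \<notin> G" for p :: "complex poly" and g k
        using that G(2) by (auto simp: cp_elem_def)
      then have "c k = 0" if "k \<notin> G" for k using that by (simp add: c_def)
      then show ?thesis by (simp add: S_carrier)
    qed
    ultimately have "(\<lambda>k. const (c k) :: ('n, complex poly) symm) = 0" using inj \<open>?E \<in> I\<close> by simp
    \<comment> \<open>At this component exactly one index of each sum contributes: \<open>g\<close>
      in the one, and its conjugate by \<open>h\<close> in the other.\<close>
    from fun_cong[OF this, of "h ** g"] have "const (c (h ** g)) = (0 :: ('n, complex poly) symm)" by simp
    from arg_cong[OF this, of "\<lambda>p. Poly_Mapping.lookup p 0"] have c0: "c (h ** g) = 0" by simp
    have b1: "bij_betw (\<lambda>g. g ** h) G G"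
      by (rule bij_betw_byWitness[where f' = "\<lambda>g. g ** matrix_inv h"]) (use G in \<open>auto simp flip: matrix_mul_assoc\<close>)
    have hg: "(h ** g ** matrix_inv h) ** h = h ** g" "h ** g ** matrix_inv h \<in> G" using G by (simp_all flip: matrix_mul_assoc)
    have "monom (a (h ** g ** matrix_inv h) (h *v v) (h *v w) * \<alpha> (h ** g ** matrix_inv h) h) 1 = monom (a g v w * \<alpha> h g) 1"
      using c0 cp_elem_reindex[OF b1 hg(2), of "\<lambda>g. monom (a g (h *v v) (h *v w) * \<alpha> g h) 1"]
        cp_elem_reindex[OF bij_betw_left_mult[OF G(2)] G(1), of "\<lambda>g. monom (a g v w * \<alpha> h g) 1"] hg G
      by (simp add: c_def sum_apply)
    then show "a (h ** g ** matrix_inv h) (h *v v) (h *v w) * \<alpha> (h ** g ** matrix_inv h) h = \<alpha> h g * a g v w"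
      by (simp add: mult.commute)
  }
  {
    fix g u v w assume g: "g \<in> G"
    define D where "D u v w = cp_elem (vec_tensor u) (mat 1) \<otimes>\<^bsub>R\<^esub> hecke_relation G a v w
      - hecke_relation G a v w \<otimes>\<^bsub>R\<^esub> cp_elem (vec_tensor u) (mat 1)" for u v w
    have D_I: "D u v w \<in> I" for u v w
      unfolding D_def by (intro I_diff I_mult_left I_mult_right hecke_relation_in_I) auto
    have right: "hecke_relation G a v w \<otimes>\<^bsub>R\<^esub> cp_elem (vec_tensor u) (mat 1) =
        cp_elem (commutator v w * vec_tensor u) (mat 1) - (\<Sum>g\<in>G. cp_elem (const (monom (a g v w) 1) * vec_tensor (g *v u)) g)" for u v w
      unfolding hecke_relation_def cp_mult_diff_left cp_mult_sum_left
      by (simp add: cp_elem_mult act_tensor_vec flip: one_pCons)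
    have left: "cp_elem (vec_tensor u) (mat 1) \<otimes>\<^bsub>R\<^esub> hecke_relation G a v w =
        cp_elem (vec_tensor u * commutator v w) (mat 1) - (\<Sum>g\<in>G. cp_elem (const (monom (a g v w) 1) * vec_tensor u) g)" for u v w
      unfolding cp_elem_mult_relation[OF one_in_G] by simp
    let ?t = "monom (1 :: complex) 1"
    have D: "D u v w = cp_elem (vec_tensor u * commutator v w - commutator v w * vec_tensor u) (mat 1)
        - (\<Sum>g\<in>G. cp_elem (const ?t * vec_tensor (a g v w *s (u - g *v u))) g)" for u v w
    proof -
      have "const ?t * vec_tensor (a g v w *s (u - g *v u)) = const (monom (a g v w) 1) * vec_tensor u - const (monom (a g v w) 1) * vec_tensor (g *v u)" for g
        unfolding vec_tensor_scale vec_tensor_diff const_mult_const_mult by (simp add: smult_monom right_diff_distrib)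
      then show ?thesis
        unfolding D_def left right by (simp add: cp_elem_diff sum_subtractf)
    qed
    \<comment> \<open>The vector that remains at \<open>g\<close> once the tensor commutators cancel
      in the cyclic sum. It occurs with a factor \<open>t\<close>, which can be cancelled in
      \<open>complex poly\<close>.\<close>
    define J where "J g = a g v w *s (u - g *v u) + a g w u *s (v - g *v v) + a g u v *s (w - g *v w)" for g
    have "vec_tensor u * commutator v w - commutator v w * vec_tensor u
        + (vec_tensor v * commutator w u - commutator w u * vec_tensor v)
        + (vec_tensor w * commutator u v - commutator u v * vec_tensor w) = 0"
      by (simp add: algebra_simps)
    then have "- (D u v w + D v w u + D w u v) = (\<Sum>g\<in>G. cp_elem (const ?t * vec_tensor (J g)) g)"
      unfolding D J_def vec_tensor_add distrib_left cp_elem_add sum.distrib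
      by (intro minus_sum_diffs) (simp only: cp_elem_add[symmetric] cp_elem_zero)
    moreover have "\<dots> = sect (\<lambda>g. if g \<in> G then const ?t * vec_symm (J g) else 0)"
    proof
      fix h
      have "(\<Sum>g\<in>G. cp_elem (const ?t * vec_tensor (J g)) g) h = (\<Sum>g\<in>G. if g = h then const ?t * vec_tensor (J h) else 0)"
        unfolding sum_apply by (rule sum.cong) (auto simp: cp_elem_def)
      then show "(\<Sum>g\<in>G. cp_elem (const ?t * vec_tensor (J g)) g) h = sect (\<lambda>g. if g \<in> G then const ?t * vec_symm (J g) else 0) h"
        using finite_G by (simp add: sect_def extend_section_eq lin_ext_const_mult extend_section_vec[unfolded extend_section_eq])
    qed
    moreover have "- (D u v w + D v w u + D w u v) \<in> I" by (intro I_uminus I_add D_I)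
    ultimately have "(\<lambda>g. if g \<in> G then const ?t * vec_symm (J g) else 0) = 0"
      by (intro inj) (auto simp: S_carrier)
    from fun_cong[OF this, of g] have "const ?t * vec_symm (J g) = 0" using g by simp
    from arg_cong[OF this, of "\<lambda>p. Poly_Mapping.lookup p _"]
    have "?t * Poly_Mapping.lookup (vec_symm (J g)) {#i#} = 0" for i
      unfolding lookup_const_mult by simp
    moreover have "Poly_Mapping.lookup (vec_symm (J g)) {#i#} = [:J g $ i:]" for i
      by (simp add: vec_symm_def lookup_sum lookup_single when_def)
    ultimately have "J g $ i = 0" for i by (simp add: monom_eq_0_iff)
    then show "a g v w *s (u - g *v u) + a g w u *s (v - g *v v) + a g u v *s (w - g *v w) = 0"
      unfolding J_def by (simp add: vec_eq_iff)
  }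
qed

end

section \<open>The decomposition of \<open>V\<close> along a group element\<close>

locale hermitian_group = twisted_group G \<alpha> for G :: "(complex^'n^'n) set" and \<alpha> +
  fixes B :: "complex^'n \<Rightarrow> complex^'n \<Rightarrow> complex"
  assumes hermitian: "invariant_hermitian_form G B"
begin

lemma B_linear: "Vector_Spaces.linear (*s) (*) (\<lambda>v. B v w)"
  and B_cnj: "B w v = cnj (B v w)"
  and B_nondegenerate: "(\<And>w. B v w = 0) \<Longrightarrow> v = 0"
  and B_invariant: "g \<in> G \<Longrightarrow> B (g *v v) (g *v w) = B v w"
  using hermitian unfolding invariant_hermitian_form_def by blast+

lemma B_add_left: "B (v + v') w = B v w + B v' w"
  and B_scale_left: "B (c *s v) w = c * B v w"
  using B_linear[of w] unfolding Vector_Spaces.linear_iff by blast+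

lemma B_zero_left [simp]: "B 0 w = 0"
  using B_scale_left[of 0 0 w] by simp

lemma B_diff_left: "B (v - v') w = B v w - B v' w"
  using B_add_left[of "v - v'" v' w] by simp

lemma B_sum_left: "B (sum f A) w = (\<Sum>i\<in>A. B (f i) w)"
  by (induction A rule: infinite_finite_induct) (auto simp: B_add_left)

lemma B_add_right: "B v (w + w') = B v w + B v w'"
  by (subst (1 2 3) B_cnj) (simp add: B_add_left)

lemma B_scale_right: "B v (c *s w) = cnj c * B v w"
  by (subst (1 2) B_cnj) (simp add: B_scale_left)

lemma B_sum_right: "B v (sum f A) = (\<Sum>i\<in>A. B v (f i))"
  by (subst B_cnj) (simp add: B_sum_left flip: B_cnj)

lemma B_eq_0_commute: "B v w = 0 \<longleftrightarrow> B w v = 0"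
  by (subst B_cnj) simp

lemma subspace_fixed_space: "vec.subspace (fixed_space g)"
  by (auto simp: vec.subspace_def fixed_space_def vec.add matrix_vector_right_distrib vector_scalar_commute)

lemma subspace_fixed_perp: "vec.subspace (fixed_perp B g)"
  by (auto simp: vec.subspace_def fixed_perp_def B_add_left B_scale_left)

lemma finite_order:
  assumes g: "g \<in> G"
  obtains m where "m > 0" "\<And>v. ((*v) g ^^ m) v = v"
proof -
  define pw where "pw i = ((**) g ^^ i) (mat 1)" for i
  have pw: "pw i \<in> G" "pw i *v v = ((*v) g ^^ i) v" for i v
    unfolding pw_def by (induction i) (auto simp: g simp flip: matrix_vector_mul_assoc)
  have "\<not> inj pw"
  proof
    assume "inj pw"
    then have "infinite (range pw)" by (rule range_inj_infinite)
    moreover have "range pw \<subseteq> G" using pw by auto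
    ultimately show False using finite_G finite_subset by blast
  qed
  then obtain i j where ij: "i < j" "pw i = pw j"
    unfolding inj_def by (metis linorder_neqE_nat)
  have "inj ((*v) g)" by (rule injI) (metis g left_inverse_vec)
  then have inj: "inj ((*v) g ^^ i)" by (rule inj_fn)
  show thesis
  proof
    show "j - i > 0" using ij by simp
    fix v
    have "((*v) g ^^ i) (((*v) g ^^ (j - i)) v) = ((*v) g ^^ i) v"
      using ij pw(2)[of i v] pw(2)[of j v] by (simp flip: funpow_add[THEN fun_cong, unfolded o_apply])
    then show "((*v) g ^^ (j - i)) v = v" using inj by (auto dest: injD)
  qed
qed

text \<open>The mean of \<open>v\<close> over the cyclic group generated by \<open>g\<close>: it is
  fixed because applying \<open>g\<close> shifts the sum by one step, and an invariant functional
  cannot tell it from \<open>v\<close>. It serves both for the Hermitian form and for the forms of a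
  family.\<close>

lemma fixed_average:
  assumes g: "g \<in> G"
  obtains u where "u \<in> fixed_space g"
    "\<And>f. Vector_Spaces.linear (*s) (*) f \<Longrightarrow> (\<And>x. f (g *v x) = f x) \<Longrightarrow> f u = (f v :: complex)"
proof -
  obtain m where m: "m > 0" "\<And>v. ((*v) g ^^ m) v = v" by (rule finite_order[OF g]) blast
  define F where "F i = ((*v) g ^^ i) v" for i
  define u where "u = (1 / of_nat m) *s (\<Sum>i<m. F i)"
  have "(\<Sum>i<m. F (Suc i)) - (\<Sum>i<m. F i) = F m - F 0"
    unfolding sum_subtractf[symmetric] by (rule sum_lessThan_telescope)
  then have "(\<Sum>i<m. F (Suc i)) = (\<Sum>i<m. F i)" using m(2) by (simp add: F_def)
  moreover have "g *v (\<Sum>i<m. F i) = (\<Sum>i<m. F (Suc i))"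
    by (simp add: vec.linear_sum[OF matrix_vector_mul_linear_gen] F_def)
  ultimately have "u \<in> fixed_space g" by (simp add: fixed_space_def u_def vector_scalar_commute)
  moreover have "f u = f v" if f: "Vector_Spaces.linear (*s) (*) f" "\<And>x. f (g *v x) = f x" for f :: "complex^'n \<Rightarrow> complex"
  proof -
    have f_add: "f (x + y) = f x + f y" and f_scale: "f (c *s x) = c * f x" for x y c
      using f(1) unfolding Vector_Spaces.linear_iff by blast+
    have "f 0 = 0" using f_scale[of 0 0] by simp
    then have f_sum: "f (\<Sum>i<k. F i) = (\<Sum>i<k. f (F i))" for k :: nat
      by (induction k) (simp_all add: f_add)
    have "f (F i) = f v" for i
      by (induction i) (simp_all add: F_def f(2))
    then show ?thesis using m by (simp add: u_def f_scale f_sum)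
  qed
  ultimately show thesis by (rule that)
qed

text \<open>For fixed \<open>w\<close> the functional \<open>B x w\<close> of \<open>x\<close> is
  invariant under \<open>g\<close>, so \<open>v\<close> and its average have the same product with
  every fixed vector.\<close>

lemma fixed_component:
  assumes g: "g \<in> G"
  obtains u where "u \<in> fixed_space g" "v - u \<in> fixed_perp B g"
proof -
  obtain u where u: "u \<in> fixed_space g"
    "\<And>f. Vector_Spaces.linear (*s) (*) f \<Longrightarrow> (\<And>x. f (g *v x) = f x) \<Longrightarrow> f u = (f v :: complex)"
    by (rule fixed_average[OF g, of v]) blast
  have "B (v - u) w = 0" if w: "w \<in> fixed_space g" for w
  proof -
    have "B (g *v x) w = B x w" for x
      using B_invariant[OF g, of x w] w by (simp add: fixed_space_def)
    then show ?thesis using u(2)[OF B_linear] by (simp add: B_diff_left)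
  qed
  then show thesis using that u(1) by (auto simp: fixed_perp_def)
qed

lemma fixed_space_Int_perp:
  assumes "g \<in> G" "v \<in> fixed_space g" "v \<in> fixed_perp B g"
  shows "v = 0"
proof (rule B_nondegenerate)
  fix w
  obtain u where u: "u \<in> fixed_space g" "w - u \<in> fixed_perp B g" using fixed_component[OF assms(1)] .
  have "B v w = B v u + B v (w - u)" using B_add_right[of v u "w - u"] by simp
  moreover have "B v u = 0" using assms(3) u by (simp add: fixed_perp_def)
  moreover have "B v (w - u) = 0"
    by (subst B_eq_0_commute) (use assms(2) u in \<open>simp add: fixed_perp_def\<close>)
  ultimately show "B v w = 0" by simp
qed

lemma dim_fixed_perp:
  assumes "g \<in> G"
  shows "vec.dim (fixed_space g) + vec.dim (fixed_perp B g) = CARD('n)"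
proof -
  have "{x + y |x y. x \<in> fixed_space g \<and> y \<in> fixed_perp B g} = UNIV"
  proof (intro equalityI subset_UNIV subsetI)
    fix v
    obtain u where "u \<in> fixed_space g" "v - u \<in> fixed_perp B g" using fixed_component[OF assms] .
    then show "v \<in> {x + y |x y. x \<in> fixed_space g \<and> y \<in> fixed_perp B g}" by force
  qed
  moreover have "fixed_space g \<inter> fixed_perp B g = {0}"
    using fixed_space_Int_perp[OF assms] vec.subspace_0[OF subspace_fixed_space] vec.subspace_0[OF subspace_fixed_perp] by blast
  moreover have "vec.dim {0 :: complex^'n} = 0"
    using vec.dim_eq_card[of "{}" "{0 :: complex^'n}"] by (simp add: vec.span_insert_0)
  ultimately show ?thesis
    using vec.dim_sums_Int[OF subspace_fixed_space[of g] subspace_fixed_perp[of g]]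
    by (simp add: card_cart_basis)
qed

definition proj :: "complex^'n^'n \<Rightarrow> complex^'n \<Rightarrow> complex^'n" where
  "proj g v = (THE w. w \<in> fixed_perp B g \<and> v - w \<in> fixed_space g)"

lemma h_perp_eq: "h_perp B g h v = proj g (h *v v)"
  by (simp add: h_perp_def proj_def)

lemma proj_eqI:
  assumes "g \<in> G" "w \<in> fixed_perp B g" "v - w \<in> fixed_space g"
  shows "proj g v = w"
  unfolding proj_def
proof (rule the_equality)
  fix w' assume w': "w' \<in> fixed_perp B g \<and> v - w' \<in> fixed_space g"
  have "w - w' \<in> fixed_perp B g" using assms w' vec.subspace_diff[OF subspace_fixed_perp] by blast
  moreover have "(v - w') - (v - w) \<in> fixed_space g" using assms w' vec.subspace_diff[OF subspace_fixed_space] by blast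
  ultimately have "w - w' = 0" by (intro fixed_space_Int_perp[OF assms(1)]) simp_all
  then show "w' = w" by simp
qed (use assms in auto)

lemma proj_in:
  assumes "g \<in> G"
  shows "proj g v \<in> fixed_perp B g" "v - proj g v \<in> fixed_space g"
proof -
  obtain u where u: "u \<in> fixed_space g" "v - u \<in> fixed_perp B g" using fixed_component[OF assms] .
  then have "proj g v = v - u" by (intro proj_eqI assms) auto
  then show "proj g v \<in> fixed_perp B g" "v - proj g v \<in> fixed_space g" using u by auto
qed

lemma proj_add: "g \<in> G \<Longrightarrow> proj g (v + w) = proj g v + proj g w"
  by (rule proj_eqI)
    (use proj_in vec.subspace_add[OF subspace_fixed_perp]
      vec.subspace_add[OF subspace_fixed_space, of "v - proj g v" g "w - proj g w"] in \<open>auto simp: algebra_simps\<close>)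

lemma proj_scale: "g \<in> G \<Longrightarrow> proj g (c *s v) = c *s proj g v"
  by (rule proj_eqI)
    (use proj_in vec.subspace_scale[OF subspace_fixed_perp]
      vec.subspace_scale[OF subspace_fixed_space, of "v - proj g v" g c] in \<open>auto simp: vec.scale_right_diff_distrib\<close>)

lemma proj_perp: "g \<in> G \<Longrightarrow> w \<in> fixed_perp B g \<Longrightarrow> proj g w = w"
  by (rule proj_eqI) (auto simp: vec.subspace_0[OF subspace_fixed_space])

lemma proj_fixed: "g \<in> G \<Longrightarrow> w \<in> fixed_space g \<Longrightarrow> proj g w = 0"
  by (rule proj_eqI) (auto simp: vec.subspace_0[OF subspace_fixed_perp])

lemma diff_proj: "g \<in> G \<Longrightarrow> v - g *v v = proj g v - g *v proj g v"
  using proj_in(2)[of g v] by (simp add: fixed_space_def matrix_vector_mult_diff_distrib algebra_simps)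

text \<open>These are the skew forms that descend to the quotient by the fixed space.\<close>

definition kernel_fixed :: "complex^'n^'n \<Rightarrow> (complex^'n \<Rightarrow> complex^'n \<Rightarrow> complex) \<Rightarrow> bool" where
  "kernel_fixed g b \<longleftrightarrow> skew_bilinear b \<and> (\<forall>u\<in>fixed_space g. \<forall>v. b u v = 0)"

end

lemma skew_bilinearD:
  assumes "skew_bilinear b"
  shows "b (v + v') w = b v w + b v' w" "b v (w + w') = b v w + b v w'"
    "b (c *s v) w = c * b v w" "b v (c *s w) = c * b v w" "b v w = - b w v"
proof -
  have *: "Vector_Spaces.linear (*s) (*) (\<lambda>v. b v w)" "Vector_Spaces.linear (*s) (*) (b v)" for v w
    using assms unfolding skew_bilinear_def by blast+
  show "b (v + v') w = b v w + b v' w" "b (c *s v) w = c * b v w"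
    using *(1)[of w] unfolding Vector_Spaces.linear_iff by blast+
  show "b v (w + w') = b v w + b v w'" "b v (c *s w) = c * b v w"
    using *(2)[of v] unfolding Vector_Spaces.linear_iff by blast+
  show "b v w = - b w v"
    using assms unfolding skew_bilinear_def by blast
qed

lemma skew_bilinear_alternating: "skew_bilinear b \<Longrightarrow> b v v = 0"
  using skew_bilinearD(5)[of b v v] unfolding eq_neg_iff_add_eq_0 by simp

lemma linear_scalar_iff:
  "Vector_Spaces.linear (*s) (*) f \<longleftrightarrow> (\<forall>v w. f (v + w) = f v + f w) \<and> (\<forall>c v. f (c *s v) = c * f v)"
  for f :: "complex^'n \<Rightarrow> complex"
  unfolding Vector_Spaces.linear_iff by (auto intro: vec.vector_space_axioms vector_space_over_itself.vector_space_axioms)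

lemma skew_bilinearI:
  assumes "\<And>v v' w. b (v + v') w = b v w + b v' w" "\<And>c v w. b (c *s v) w = c * b v w"
    and skew: "\<And>v w. b v w = - b w v"
  shows "skew_bilinear b"
proof -
  have "b v (w + w') = b v w + b v w'" "b v (c *s w) = c * b v w" for v w w' c
    by (subst (1 2 3) skew, simp add: assms(1)) (subst (1 2) skew, simp add: assms(2))
  then show ?thesis
    unfolding skew_bilinear_def linear_scalar_iff using assms by blast
qed

context hermitian_group begin

lemma kernel_fixed_proj:
  assumes g: "g \<in> G" and b: "kernel_fixed g b"
  shows "b v w = b (proj g v) (proj g w)"
proof -
  have skew_b: "skew_bilinear b" using b by (simp add: kernel_fixed_def)
  have left: "b v w = b (proj g v) w" for v w
  proof -
    have "b v w = b (proj g v) w + b (v - proj g v) w"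
      using skew_bilinearD(1)[OF skew_b, of "proj g v" "v - proj g v" w] by simp
    then show ?thesis using b proj_in(2)[OF g] by (simp add: kernel_fixed_def)
  qed
  show ?thesis
    using left[of v w] left[of w "proj g v"] skew_bilinearD(5)[OF skew_b, of "proj g v" w]
      skew_bilinearD(5)[OF skew_b, of "proj g v" "proj g w"] by simp
qed

text \<open>For \<open>codim V\<^sup>g = 2\<close>, the coordinates of the component in \<open>fixed_perp B g\<close> give a volume form,
  normalized on the basis which \<open>subspace_det\<close> chooses.\<close>

lemma volume_form:
  assumes g: "g \<in> G" and dim: "vec.dim (fixed_perp B g) = 2"
  obtains \<omega> e1 e2 where "kernel_fixed g \<omega>" "\<omega> e1 e2 = 1"
    "\<And>b v w. kernel_fixed g b \<Longrightarrow> b v w = b e1 e2 * \<omega> v w"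
    "\<And>h. subspace_det (fixed_perp B g) (h_perp B g h) = \<omega> (h *v e1) (h *v e2)"
    "\<And>u v w. \<omega> v w *s proj g u + \<omega> w u *s proj g v + \<omega> u v *s proj g w = 0"
proof -
  let ?W = "fixed_perp B g"
  \<comment> \<open>Literally the choice made in \<open>subspace_det\<close>, so that the
    determinant unfolds in this basis.\<close>
  define E where "E = (SOME E. vec.independent E \<and> vec.span E = ?W)"
  obtain E' where "E' \<subseteq> ?W" "vec.independent E'" "?W \<subseteq> vec.span E'" by (rule vec.basis_exists[of ?W])
  then have "vec.span E' = ?W" using vec.span_minimal[OF _ subspace_fixed_perp] by blast
  then have E: "vec.independent E" "vec.span E = ?W"
    using someI[of "\<lambda>E. vec.independent E \<and> vec.span E = ?W" E'] \<open>vec.independent E'\<close> unfolding E_def by auto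
  have "card E = 2" using vec.dim_eq_card[OF _ E(1), of ?W] E dim by (metis vec.span_span)
  then obtain e1 e2 where e: "E = {e1, e2}" "e1 \<noteq> e2" by (meson card_2_iff)
  define r where "r i v = vec.representation E (proj g v) i" for i v
  have W: "proj g v \<in> vec.span E" for v using E proj_in[OF g] by simp
  have r_add: "r i (v + w) = r i v + r i w" and r_scale: "r i (c *s v) = c * r i v" for i v w c
    by (simp_all add: r_def proj_add[OF g] proj_scale[OF g] vec.representation_add[OF E(1) W W] vec.representation_scale[OF E(1) W])
  have r_fixed: "r i u = 0" if "u \<in> fixed_space g" for i u
    using that by (simp add: r_def proj_fixed[OF g] vec.representation_zero)
  have "e1 \<in> E" "e2 \<in> E" using e by auto
  have eW: "e1 \<in> ?W" "e2 \<in> ?W" using E e vec.span_base by blast+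
  have r_e: "r e1 e1 = 1" "r e2 e1 = 0" "r e1 e2 = 0" "r e2 e2 = 1"
    using e(2) \<open>e1 \<in> E\<close> \<open>e2 \<in> E\<close> by (simp_all add: r_def proj_perp[OF g] eW vec.representation_basis[OF E(1)])
  have proj_eq: "proj g v = r e1 v *s e1 + r e2 v *s e2" for v
    using vec.sum_representation_eq[OF E(1) W[of v], of E] e by (simp add: r_def)
  define \<omega> where "\<omega> v w = r e1 v * r e2 w - r e2 v * r e1 w" for v w
  have skew: "skew_bilinear \<omega>"
    by (rule skew_bilinearI) (simp_all add: \<omega>_def r_add r_scale algebra_simps)
  show thesis
  proof
    show "kernel_fixed g \<omega>" using skew by (simp add: kernel_fixed_def \<omega>_def r_fixed)
    show "\<omega> e1 e2 = 1" by (simp add: \<omega>_def r_e)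
  next
    fix b v w assume b: "kernel_fixed g b"
    then have skew_b: "skew_bilinear b" by (simp add: kernel_fixed_def)
    note b_simps = skew_bilinearD(1-4)[OF skew_b] skew_bilinear_alternating[OF skew_b]
    have "b v w = b (proj g v) (proj g w)" by (rule kernel_fixed_proj[OF g b])
    also have "\<dots> = b e1 e2 * \<omega> v w"
      unfolding proj_eq b_simps skew_bilinearD(5)[OF skew_b, of e2 e1] \<omega>_def by (simp add: algebra_simps)
    finally show "b v w = b e1 e2 * \<omega> v w" .
  next
    fix h
    \<comment> \<open>With two basis vectors the Leibniz sum has two terms, and it is the value of
      \<open>\<omega>\<close> on the images of the basis.\<close>
    have P: "{p. p permutes E} = {id, Transposition.transpose e1 e2}" unfolding e permutes_doubleton_iff by auto
    have prod_E: "prod F E = F e1 * F e2" for F :: "_ \<Rightarrow> complex" using e by simp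
    have "id \<noteq> Transposition.transpose e1 e2"
      using e(2) by (metis id_apply transpose_apply_first)
    then show "subspace_det ?W (h_perp B g h) = \<omega> (h *v e1) (h *v e2)"
      using e(2) by (simp add: subspace_det_def Let_def E_def[symmetric] P prod_E sign_swap_id h_perp_eq \<omega>_def r_def)
  next
    fix u v w
    \<comment> \<open>Cramer's rule in coordinates: the linear relation between three vectors of a
      plane.\<close>
    show "\<omega> v w *s proj g u + \<omega> w u *s proj g v + \<omega> u v *s proj g w = 0"
      unfolding proj_eq \<omega>_def by (simp add: vec_eq_iff algebra_simps)
  qed
qed

text \<open>By \<open>diff_proj\<close> only the components in the plane
  \<open>fixed_perp B g\<close> matter, so the expression is \<open>1 - g\<close> applied to a
  cyclic sum of vectors in that plane, which vanishes by Cramer's rule.\<close>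

lemma kernel_fixed_jacobi:
  assumes "g \<in> G" "vec.dim (fixed_perp B g) = 2" "kernel_fixed g b"
  shows "b v w *s (u - g *v u) + b w u *s (v - g *v v) + b u v *s (w - g *v w) = 0"
proof -
  obtain \<omega> e1 e2 where \<omega>: "\<And>b v w. kernel_fixed g b \<Longrightarrow> b v w = b e1 e2 * \<omega> v w"
    "\<And>u v w. \<omega> v w *s proj g u + \<omega> w u *s proj g v + \<omega> u v *s proj g w = 0"
    using volume_form[OF assms(1,2)] by metis
  let ?s = "b v w *s proj g u + b w u *s proj g v + b u v *s proj g w"
  have "?s = b e1 e2 *s (\<omega> v w *s proj g u + \<omega> w u *s proj g v + \<omega> u v *s proj g w)"
    unfolding \<omega>(1)[OF assms(3), of v w] \<omega>(1)[OF assms(3), of w u] \<omega>(1)[OF assms(3), of u v]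
    by (simp add: vec_eq_iff algebra_simps)
  then have "?s = 0" unfolding \<omega>(2) by simp
  have "b v w *s (u - g *v u) + b w u *s (v - g *v v) + b u v *s (w - g *v w) = ?s - g *v ?s"
    unfolding diff_proj[OF assms(1), of u] diff_proj[OF assms(1), of v] diff_proj[OF assms(1), of w]
    by (simp add: matrix_vector_right_distrib vector_scalar_commute vec.scale_right_diff_distrib algebra_simps)
  then show ?thesis unfolding \<open>?s = 0\<close> by simp
qed

text \<open>As \<open>h\<close> preserves the fixed space of \<open>g\<close>, pulling back by
  \<open>h\<close> acts on a one-dimensional space of forms, hence by a scalar. Evaluating on
  \<open>e1\<close>, \<open>e2\<close> shows it, and for the forms from \<open>volume_form\<close>
  it is the determinant of \<open>h_perp\<close>.\<close>

lemma volume_form_centralizer: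
  assumes "kernel_fixed g \<omega>" "\<omega> e1 e2 = 1" "\<And>b v w. kernel_fixed g b \<Longrightarrow> b v w = b e1 e2 * \<omega> v w"
    and "kernel_fixed g b" "h ** g = g ** h"
  shows "b (h *v v) (h *v w) = \<omega> (h *v e1) (h *v e2) * b v w"
proof -
  have "kernel_fixed g (\<lambda>v w. b (h *v v) (h *v w))" if "kernel_fixed g b" for b
  proof -
    have b: "skew_bilinear b" "\<And>u v. u \<in> fixed_space g \<Longrightarrow> b u v = 0" using that by (auto simp: kernel_fixed_def)
    have "h *v u \<in> fixed_space g" if "u \<in> fixed_space g" for u
      using that assms(5) unfolding fixed_space_def mem_Collect_eq by (metis matrix_vector_mul_assoc)
    moreover have "skew_bilinear (\<lambda>v w. b (h *v v) (h *v w))"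
      by (rule skew_bilinearI; (subst skew_bilinearD(5)[OF b(1)], rule refl)?)
        (simp_all add: matrix_vector_right_distrib vector_scalar_commute skew_bilinearD(1-4)[OF b(1)])
    ultimately show ?thesis using b by (simp add: kernel_fixed_def)
  qed
  from assms(3)[OF this[OF assms(4)], of v w] assms(3)[OF assms(4), of "h *v e1" "h *v e2"] assms(3)[OF assms(4), of v w]
  show ?thesis by simp
qed

end

section \<open>Components of a family away from the identity\<close>

lemma skew_bilinear_sum:
  assumes "\<And>i. i \<in> A \<Longrightarrow> skew_bilinear (b i)"
  shows "skew_bilinear (\<lambda>v w. \<Sum>i\<in>A. c i * b i v w)"
proof (rule skew_bilinearI)
  fix v v' w and d :: complex
  show "(\<Sum>i\<in>A. c i * b i (v + v') w) = (\<Sum>i\<in>A. c i * b i v w) + (\<Sum>i\<in>A. c i * b i v' w)"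
    unfolding sum.distrib[symmetric]
    by (rule sum.cong) (simp_all add: skew_bilinearD(1)[OF assms] distrib_left)
  show "(\<Sum>i\<in>A. c i * b i (d *s v) w) = d * (\<Sum>i\<in>A. c i * b i v w)"
    unfolding sum_distrib_left
    by (rule sum.cong) (simp_all add: skew_bilinearD(3)[OF assms])
  show "(\<Sum>i\<in>A. c i * b i v w) = - (\<Sum>i\<in>A. c i * b i w v)"
    unfolding sum_negf[symmetric]
  proof (rule sum.cong[OF refl])
    fix i assume "i \<in> A"
    from skew_bilinearD(5)[OF assms[OF this], of v w] show "c i * b i v w = - (c i * b i w v)" by simp
  qed
qed

lemma skew_bilinear_comp:
  assumes "skew_bilinear b"
  shows "skew_bilinear (\<lambda>v w. b (m *v v) (m *v w))"
  by (rule skew_bilinearI; (rule skew_bilinearD(5)[OF assms])?)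
    (simp_all add: matrix_vector_right_distrib vector_scalar_commute skew_bilinearD(1-4)[OF assms])

definition jacobi_sum :: "complex^'n^'n \<Rightarrow> (complex^'n \<Rightarrow> complex^'n \<Rightarrow> complex) \<Rightarrow>
    complex^'n \<Rightarrow> complex^'n \<Rightarrow> complex^'n \<Rightarrow> complex^'n" where
  "jacobi_sum g b u v w = b v w *s (u - g *v u) + b w u *s (v - g *v v) + b u v *s (w - g *v w)"

lemma jacobi_sum_sum:
  "jacobi_sum g (\<lambda>v w. \<Sum>i\<in>A. c i * b i v w) u v w = (\<Sum>i\<in>A. c i *s jacobi_sum g (b i) u v w)"
  by (simp add: jacobi_sum_def vec_eq_iff sum_distrib_right sum.distrib sum_subtractf distrib_left right_diff_distrib mult.assoc)

context twisted_group begin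

lemma pbw_conditions_iff:
  "pbw_conditions G \<alpha> a \<longleftrightarrow>
     (\<forall>g\<in>G. skew_bilinear (a g)) \<and>
     (\<forall>g\<in>G. \<forall>h\<in>G. \<forall>v w. a (h ** g ** matrix_inv h) (h *v v) (h *v w) * \<alpha> (h ** g ** matrix_inv h) h = \<alpha> h g * a g v w) \<and>
     (\<forall>g\<in>G. \<forall>u v w. jacobi_sum g (a g) u v w = 0)"
  unfolding pbw_conditions_def hecke_data_def hecke_data_axioms_def pbw_conditions_axioms_def jacobi_sum_def
  using twisted_group_axioms by blast

definition families :: "'n form_family set" where
  "families = {a. (\<forall>g. g \<notin> G \<longrightarrow> a g = 0) \<and> pbw_conditions G \<alpha> a}"

text \<open>From here on neither the algebra nor the section occurs; what is left is linear algebra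
  of the two conditions.\<close>

lemma hecke_families_eq:
  assumes "graded_section \<sigma>"
  shows "hecke_families G \<alpha> \<sigma> = families"
proof -
  have "(\<forall>g\<in>G. skew_bilinear (a g)) \<and> twisted_graded_hecke G \<alpha> \<sigma> a \<longleftrightarrow> pbw_conditions G \<alpha> a" for a
  proof (cases "\<forall>g\<in>G. skew_bilinear (a g)")
    case True
    interpret hecke_section G \<alpha> a \<sigma>
      by unfold_locales (use True assms in auto)
    show ?thesis using pbw_imp_twisted_graded_hecke twisted_graded_hecke_imp_pbw True by blast
  next
    case False
    then show ?thesis unfolding pbw_conditions_iff by blast
  qed
  then show ?thesis unfolding hecke_families_def families_def by auto
qed

lemma familiesD:
  assumes "a \<in> families"
  shows "g \<notin> G \<Longrightarrow> a g = 0"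
    and "g \<in> G \<Longrightarrow> skew_bilinear (a g)"
    and "g \<in> G \<Longrightarrow> h \<in> G \<Longrightarrow>
      a (h ** g ** matrix_inv h) (h *v v) (h *v w) * \<alpha> (h ** g ** matrix_inv h) h = \<alpha> h g * a g v w"
    and "g \<in> G \<Longrightarrow> jacobi_sum g (a g) u v w = 0"
  using assms unfolding families_def pbw_conditions_iff by blast+

lemma subspace_families: "fam.subspace families"
  unfolding fam.subspace_def
proof (intro conjI ballI allI)
  show "0 \<in> families"
    unfolding families_def pbw_conditions_iff
    by (auto simp: jacobi_sum_def intro!: skew_bilinearI)
next
  fix a b assume ab: "a \<in> families" "b \<in> families"
  have "skew_bilinear ((a + b) g)" if "g \<in> G" for g
  proof (rule skew_bilinearI)
    fix v w
    from skew_bilinearD(5)[OF familiesD(2)[OF ab(1) that], of v w] skew_bilinearD(5)[OF familiesD(2)[OF ab(2) that], of v w]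
    show "(a + b) g v w = - (a + b) g w v" by simp
  qed (simp_all add: skew_bilinearD(1-4)[OF familiesD(2)[OF ab(1) that]] skew_bilinearD(1-4)[OF familiesD(2)[OF ab(2) that]] algebra_simps)
  moreover have "jacobi_sum g ((a + b) g) u v w = jacobi_sum g (a g) u v w + jacobi_sum g (b g) u v w" for g u v w
    by (simp add: jacobi_sum_def vec_eq_iff algebra_simps)
  ultimately show "a + b \<in> families"
    using familiesD(1)[OF ab(1)] familiesD(1)[OF ab(2)] familiesD(3)[OF ab(1)] familiesD(3)[OF ab(2)] familiesD(4)[OF ab(1)] familiesD(4)[OF ab(2)]
    unfolding families_def pbw_conditions_iff by (simp add: distrib_left distrib_right)
next
  fix c a assume a: "a \<in> families"
  have "skew_bilinear (\<lambda>v w. c * a g v w)" if "g \<in> G" for g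
  proof (rule skew_bilinearI)
    fix v w
    from skew_bilinearD(5)[OF familiesD(2)[OF a that], of v w]
    show "c * a g v w = - (c * a g w v)" by simp
  qed (simp_all add: skew_bilinearD(1-4)[OF familiesD(2)[OF a that]] algebra_simps)
  moreover have "jacobi_sum g (\<lambda>v w. c * a g v w) u v w = c *s jacobi_sum g (a g) u v w" for g u v w
    by (simp add: jacobi_sum_def vec_eq_iff algebra_simps)
  moreover have "c * a (h ** g ** matrix_inv h) (h *v v) (h *v w) * \<alpha> (h ** g ** matrix_inv h) h = \<alpha> h g * (c * a g v w)"
    if "g \<in> G" "h \<in> G" for g h v w
    using familiesD(3)[OF a that, of v w] by (simp add: mult.assoc mult.left_commute)
  ultimately show "(\<lambda>g v w. c * a g v w) \<in> families"
    using familiesD(1)[OF a] familiesD(4)[OF a]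
    unfolding families_def pbw_conditions_iff by (simp add: fun_eq_iff)
qed

end

context hermitian_group begin

lemma kernel_fixed_families:
  assumes a: "a \<in> families" and g: "g \<in> G" "g \<noteq> mat 1"
  shows "kernel_fixed g (a g)"
proof -
  note skew = familiesD(2)[OF a g(1)]
  \<comment> \<open>Equivariance under \<open>g\<close> itself, where both sides carry the nonzero
    factor \<open>\<alpha> g g\<close>.\<close>
  have inv: "a g (g *v v) (g *v w) = a g v w" for v w
    using familiesD(3)[OF a g(1) g(1), of v w] g by (simp flip: matrix_mul_assoc)
  \<comment> \<open>In the Jacobi sum of two fixed vectors and one moved vector \<open>w\<close>
    only the multiple of \<open>w - g *v w\<close> survives.\<close>
  have fixed: "a g u u' = 0" if "u \<in> fixed_space g" "u' \<in> fixed_space g" for u u'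
  proof -
    obtain w where "g *v w \<noteq> w" using g(2) by (metis matrix_eq matrix_vector_mul_lid)
    then show ?thesis
      using familiesD(4)[OF a g(1), of w u u'] that by (simp add: jacobi_sum_def fixed_space_def)
  qed
  have "a g u v = 0" if u: "u \<in> fixed_space g" for u v
  proof -
    obtain u' where u': "u' \<in> fixed_space g"
      "\<And>f. Vector_Spaces.linear (*s) (*) f \<Longrightarrow> (\<And>x. f (g *v x) = f x) \<Longrightarrow> f u' = (f v :: complex)"
      by (rule fixed_average[OF g(1), of v]) blast
    have "Vector_Spaces.linear (*s) (*) (a g u)"
      unfolding linear_scalar_iff using skew_bilinearD(2,4)[OF skew] by blast
    moreover have "a g u (g *v x) = a g u x" for x
      using inv[of u x] u by (simp add: fixed_space_def)
    ultimately have "a g u u' = a g u v" by (rule u'(2))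
    then show ?thesis using fixed[OF u u'(1)] by simp
  qed
  then show ?thesis using skew by (simp add: kernel_fixed_def)
qed

text \<open>Take \<open>v\<close>, \<open>w\<close> in the complement with nonzero pairing. For
  \<open>u\<close> in the complement the Jacobi sum is \<open>1 - g\<close> applied to the cyclic
  combination \<open>?x\<close>, which is therefore both fixed and in the complement, hence zero.
  Solving \<open>?x = 0\<close> for \<open>u\<close> shows that \<open>v\<close>, \<open>w\<close>
  span.\<close>

lemma dim_fixed_perp_families:
  assumes a: "a \<in> families" and g: "g \<in> G" "g \<noteq> mat 1" and nz: "a g \<noteq> 0"
  shows "vec.dim (fixed_perp B g) = 2"
proof -
  have kf: "kernel_fixed g (a g)" by (rule kernel_fixed_families[OF a g])
  note skew = familiesD(2)[OF a g(1)]
  obtain v0 w0 where "a g v0 w0 \<noteq> 0" using nz by (auto simp: fun_eq_iff)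
  define v w where "v = proj g v0" and "w = proj g w0"
  have vw: "v \<in> fixed_perp B g" "w \<in> fixed_perp B g" unfolding v_def w_def by (rule proj_in[OF g(1)])+
  have nz: "a g v w \<noteq> 0" using \<open>a g v0 w0 \<noteq> 0\<close> kernel_fixed_proj[OF g(1) kf, of v0 w0] by (simp add: v_def w_def)
  have "fixed_perp B g \<subseteq> vec.span {v, w}"
  proof
    fix u assume u: "u \<in> fixed_perp B g"
    let ?x = "a g v w *s u + a g w u *s v + a g u v *s w"
    have "?x - g *v ?x = jacobi_sum g (a g) u v w"
      by (simp add: jacobi_sum_def matrix_vector_right_distrib vector_scalar_commute vec.scale_right_diff_distrib algebra_simps)
    then have "?x \<in> fixed_space g" using familiesD(4)[OF a g(1), of u v w] by (simp add: fixed_space_def)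
    moreover have "?x \<in> fixed_perp B g"
      using u vw by (intro vec.subspace_add[OF subspace_fixed_perp] vec.subspace_scale[OF subspace_fixed_perp])
    ultimately have "?x = 0" by (rule fixed_space_Int_perp[OF g(1)])
    have "a g v w *s u = ?x - a g w u *s v - a g u v *s w" by simp
    then have "a g v w *s u = - (a g w u *s v) - a g u v *s w" unfolding \<open>?x = 0\<close> by simp
    moreover have "u = (1 / a g v w) *s (a g v w *s u)" using nz by simp
    ultimately have "u = (1 / a g v w) *s (- (a g w u *s v) - a g u v *s w)" by (simp only:)
    moreover have "(1 / a g v w) *s (- (a g w u *s v) - a g u v *s w) \<in> vec.span {v, w}"
      by (intro vec.span_scale vec.span_diff vec.span_neg vec.span_base) auto
    ultimately show "u \<in> vec.span {v, w}" by (simp only:)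
  qed
  moreover have "vec.span {v, w} \<subseteq> fixed_perp B g"
    using vw by (intro vec.span_minimal subspace_fixed_perp) auto
  ultimately have span: "vec.span {v, w} = fixed_perp B g" by blast
  have "v \<noteq> c *s w" for c
    using nz skew_bilinearD(3)[OF skew, of c w w] skew_bilinear_alternating[OF skew, of w] by auto
  then have "v \<notin> vec.span {w}" by (auto simp: vec.span_singleton)
  moreover have "w \<noteq> 0"
    using nz skew_bilinearD(4)[OF skew, of v 0 0] by auto
  ultimately have "vec.independent {v, w}" "v \<noteq> w"
    using vec.span_base[of w "{w}"] by (auto simp: vec.independent_insert)
  moreover have "vec.span {v, w} = vec.span (fixed_perp B g)" unfolding span[symmetric] by (rule vec.span_span[symmetric])
  ultimately show ?thesis
    using vec.dim_eq_card[of "{v, w}" "fixed_perp B g"] by simp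
qed

section \<open>Contributing elements and families induced from their volume forms\<close>

definition contributing :: "complex^'n^'n \<Rightarrow> bool" where
  "contributing g \<longleftrightarrow> g \<in> G \<and> CARD('n) - vec.dim (fixed_space g) = 2 \<and>
     (\<forall>h\<in>centralizer G g. subspace_det (fixed_perp B g) (h_perp B g h) = \<alpha> h g * inverse (\<alpha> g h))"

lemma contributing_classes_eq: "contributing_classes G \<alpha> B = conj_class G ` {g. contributing g}"
  by (auto simp: contributing_classes_def contributing_def)

lemma codim_eq_2_iff:
  assumes "g \<in> G"
  shows "CARD('n) - vec.dim (fixed_space g) = 2 \<longleftrightarrow> vec.dim (fixed_perp B g) = 2"
  using dim_fixed_perp[OF assms] by linarith

text \<open>Conjugation by an element of the centralizer returns to \<open>g\<close>, so there
  equivariance compares a form with a multiple of itself. If the form is nonzero, the factors agree,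
  which is the determinant condition.\<close>

lemma not_contributing:
  assumes a: "a \<in> families" and g: "g \<in> G" "g \<noteq> mat 1" "\<not> contributing g"
  shows "a g = 0"
proof (rule ccontr)
  assume nz: "a g \<noteq> 0"
  then have dim: "vec.dim (fixed_perp B g) = 2" by (rule dim_fixed_perp_families[OF a g(1,2)])
  obtain \<omega> e1 e2 where \<omega>: "kernel_fixed g \<omega>" "\<omega> e1 e2 = 1"
    "\<And>b v w. kernel_fixed g b \<Longrightarrow> b v w = b e1 e2 * \<omega> v w"
    "\<And>h. subspace_det (fixed_perp B g) (h_perp B g h) = \<omega> (h *v e1) (h *v e2)"
    by (rule volume_form[OF g(1) dim]) blast
  obtain h where h: "h \<in> G" "h ** g = g ** h" "\<omega> (h *v e1) (h *v e2) \<noteq> \<alpha> h g * inverse (\<alpha> g h)"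
    using g dim \<omega>(4) codim_eq_2_iff[OF g(1)] by (auto simp: contributing_def centralizer_def)
  have conj: "h ** g ** matrix_inv h = g" using h g by (simp flip: matrix_mul_assoc)
  obtain v w where "a g v w \<noteq> 0" using nz by (auto simp: fun_eq_iff)
  moreover have "\<omega> (h *v e1) (h *v e2) * a g v w * \<alpha> g h = \<alpha> h g * a g v w"
    using familiesD(3)[OF a g(1) h(1), of v w] volume_form_centralizer[OF \<omega>(1-3) kernel_fixed_families[OF a g(1,2)] h(2), of v w]
    unfolding conj by simp
  ultimately have "\<omega> (h *v e1) (h *v e2) * \<alpha> g h = \<alpha> h g" by simp
  then have "\<omega> (h *v e1) (h *v e2) = \<alpha> h g * inverse (\<alpha> g h)" using h g by (simp add: field_simps)
  then show False using h(3) by contradiction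
qed

text \<open>The family supported on the conjugacy class of \<open>g\<close> which is induced by a form at \<open>g\<close>,
  by averaging over the centralizer of \<open>g\<close>.\<close>

definition induced :: "complex^'n^'n \<Rightarrow> (complex^'n \<Rightarrow> complex^'n \<Rightarrow> complex) \<Rightarrow> 'n form_family" where
  "induced g b g' v w = (\<Sum>h | h \<in> G \<and> h ** g ** matrix_inv h = g'.
     \<alpha> h g / (\<alpha> g' h * of_nat (card (centralizer G g))) * b (matrix_inv h *v v) (matrix_inv h *v w))"

lemma induced_eq_0:
  assumes "g' \<notin> conj_class G g"
  shows "induced g b g' = 0"
proof -
  have "{h. h \<in> G \<and> h ** g ** matrix_inv h = g'} = {}" using assms by (auto simp: conj_class_def)
  then show ?thesis by (intro ext) (simp only: induced_def sum.empty zero_fun_apply)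
qed

text \<open>Equivariance forces the factor \<open>\<alpha> h g / \<alpha> g' h\<close> when a form
  is carried from \<open>g\<close> to its conjugate \<open>g'\<close> by \<open>h\<close>. The
  identity says that carrying by \<open>h\<close> and then by \<open>k\<close> is the same as
  carrying by \<open>k ** h\<close>; it combines three instances of the cocycle identity.\<close>

lemma cocycle_conj:
  assumes G: "g \<in> G" "h \<in> G" "k \<in> G"
  defines "g' \<equiv> h ** g ** matrix_inv h" and "g'' \<equiv> k ** (h ** g ** matrix_inv h) ** matrix_inv k"
  shows "\<alpha> (k ** h) g / \<alpha> g'' (k ** h) * \<alpha> g'' k = \<alpha> k g' * (\<alpha> h g / \<alpha> g' h)"
proof -
  have G': "g' \<in> G" "g'' \<in> G" using G by (simp_all add: g'_def g''_def)
  have e: "g' ** h = h ** g" "g'' ** k = k ** g'"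
    using G by (simp_all add: g'_def g''_def flip: matrix_mul_assoc)
  have c1: "\<alpha> k h * \<alpha> (k ** h) g = \<alpha> h g * \<alpha> k (h ** g)" using G by (intro cocycle)
  have c2: "\<alpha> k g' * \<alpha> (k ** g') h = \<alpha> g' h * \<alpha> k (h ** g)"
    using cocycle[OF G(3) G'(1) G(2)] e by simp
  have c3: "\<alpha> g'' k * \<alpha> (k ** g') h = \<alpha> k h * \<alpha> g'' (k ** h)"
    using cocycle[OF G'(2) G(3,2)] e by simp
  have "\<alpha> k h * (\<alpha> k (h ** g) * (\<alpha> (k ** h) g * \<alpha> g'' k * \<alpha> g' h)) =
      (\<alpha> k h * \<alpha> (k ** h) g) * \<alpha> g'' k * (\<alpha> g' h * \<alpha> k (h ** g))" by (simp add: mult_ac)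
  also have "\<dots> = \<alpha> h g * \<alpha> k (h ** g) * \<alpha> k g' * (\<alpha> g'' k * \<alpha> (k ** g') h)"
    unfolding c1 c2[symmetric] by (simp add: mult_ac)
  also have "\<dots> = \<alpha> k h * (\<alpha> k (h ** g) * (\<alpha> k g' * \<alpha> h g * \<alpha> g'' (k ** h)))"
    unfolding c3 by (simp add: mult_ac)
  finally have "\<alpha> (k ** h) g * \<alpha> g'' k * \<alpha> g' h = \<alpha> k g' * \<alpha> h g * \<alpha> g'' (k ** h)"
    using G by simp
  then show ?thesis using G G' by (simp add: field_simps)
qed

text \<open>Each summand is a transported copy of \<open>b\<close>, so it inherits the Jacobi
  identity at the conjugate element. Equivariance under \<open>k\<close> is the substitution of
  \<open>k ** h\<close> for \<open>h\<close> in the sum, with \<open>cocycle_conj\<close> matching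
  the coefficients.\<close>

lemma induced_families:
  assumes g: "g \<in> G" and dim: "vec.dim (fixed_perp B g) = 2" and b: "kernel_fixed g b"
  shows "induced g b \<in> families"
proof -
  have skew_b: "skew_bilinear b" using b by (simp add: kernel_fixed_def)
  have "induced g b g' = 0" if "g' \<notin> G" for g'
    using that g by (intro induced_eq_0) (auto simp: conj_class_def)
  moreover have "skew_bilinear (induced g b g')" for g'
    unfolding induced_def[abs_def] by (intro skew_bilinear_sum skew_bilinear_comp skew_b)
  moreover have "jacobi_sum g' (induced g b g') u v w = 0" for g' u v w
    unfolding induced_def[abs_def] jacobi_sum_sum
  proof (intro sum.neutral ballI)
    fix h assume "h \<in> {h. h \<in> G \<and> h ** g ** matrix_inv h = g'}"
    then have h: "h \<in> G" "g' = h ** g ** matrix_inv h" by auto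
    let ?u = "matrix_inv h *v u" and ?v = "matrix_inv h *v v" and ?w = "matrix_inv h *v w"
    have x: "x - g' *v x = h *v (matrix_inv h *v x - g *v (matrix_inv h *v x))" for x
      using h by (simp add: matrix_vector_mult_diff_distrib flip: matrix_vector_mul_assoc)
    have "jacobi_sum g' (\<lambda>v w. b (matrix_inv h *v v) (matrix_inv h *v w)) u v w = h *v jacobi_sum g b ?u ?v ?w"
      unfolding jacobi_sum_def x matrix_vector_right_distrib vector_scalar_commute ..
    also have "jacobi_sum g b ?u ?v ?w = 0"
      unfolding jacobi_sum_def by (rule kernel_fixed_jacobi[OF g dim b])
    finally show "(\<alpha> h g / (\<alpha> g' h * of_nat (card (centralizer G g)))) *s
        jacobi_sum g' (\<lambda>v w. b (matrix_inv h *v v) (matrix_inv h *v w)) u v w = 0" by simp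
  qed
  moreover have "induced g b (k ** g' ** matrix_inv k) (k *v v) (k *v w) * \<alpha> (k ** g' ** matrix_inv k) k =
      \<alpha> k g' * induced g b g' v w" if G: "g' \<in> G" "k \<in> G" for g' k v w
  proof -
    let ?g = "k ** g' ** matrix_inv k" and ?N = "of_nat (card (centralizer G g)) :: complex"
    have inv: "matrix_inv (k ** h) *v (k *v x) = matrix_inv h *v x" if "h \<in> G" for h x
      using left_inverse_vec[of "k ** h" "matrix_inv h *v x"] that G by (simp flip: matrix_vector_mul_assoc)
    have conj: "k ** h ** g ** matrix_inv (k ** h) = ?g \<longleftrightarrow> h ** g ** matrix_inv h = g'" if "h \<in> G" for h
    proof -
      have "k ** h ** g ** matrix_inv (k ** h) = ?g \<longleftrightarrow> k ** h ** g ** matrix_inv (k ** h) ** (k ** h) = ?g ** (k ** h)"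
        using G that by (simp add: cancel_right)
      also have "\<dots> \<longleftrightarrow> k ** (h ** g) = k ** (g' ** h)" using G that by (simp flip: matrix_mul_assoc)
      also have "\<dots> \<longleftrightarrow> h ** g ** matrix_inv h ** h = g' ** h" using G that by (simp add: cancel_left flip: matrix_mul_assoc)
      also have "\<dots> \<longleftrightarrow> h ** g ** matrix_inv h = g'" using that by (simp add: cancel_right)
      finally show ?thesis .
    qed
    have bij: "bij_betw (\<lambda>h. k ** h) {h. h \<in> G \<and> h ** g ** matrix_inv h = g'} {h. h \<in> G \<and> h ** g ** matrix_inv h = ?g}"
    proof (rule bij_betw_byWitness[where f' = "\<lambda>h. matrix_inv k ** h"])
      show "(\<lambda>h. k ** h) ` {h. h \<in> G \<and> h ** g ** matrix_inv h = g'} \<subseteq> {h. h \<in> G \<and> h ** g ** matrix_inv h = ?g}"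
        using conj G by auto
      show "(\<lambda>h. matrix_inv k ** h) ` {h. h \<in> G \<and> h ** g ** matrix_inv h = ?g} \<subseteq> {h. h \<in> G \<and> h ** g ** matrix_inv h = g'}"
      proof (intro image_subsetI)
        fix x assume x: "x \<in> {h. h \<in> G \<and> h ** g ** matrix_inv h = ?g}"
        then have "matrix_inv k ** x \<in> G" "k ** (matrix_inv k ** x) = x" using G by auto
        then show "matrix_inv k ** x \<in> {h. h \<in> G \<and> h ** g ** matrix_inv h = g'}"
          using conj[of "matrix_inv k ** x"] x by (simp del: right_inverse_assoc)
      qed
    qed (use G in auto)
    have "induced g b ?g (k *v v) (k *v w) * \<alpha> ?g k =
        (\<Sum>h | h \<in> G \<and> h ** g ** matrix_inv h = g'. \<alpha> (k ** h) g / (\<alpha> ?g (k ** h) * ?N) *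
          b (matrix_inv (k ** h) *v (k *v v)) (matrix_inv (k ** h) *v (k *v w)) * \<alpha> ?g k)"
      unfolding induced_def sum_distrib_right
      by (rule sum.reindex_bij_betw[OF bij, symmetric])
    also have "\<dots> = (\<Sum>h | h \<in> G \<and> h ** g ** matrix_inv h = g'. \<alpha> k g' * (\<alpha> h g / (\<alpha> g' h * ?N) *
          b (matrix_inv h *v v) (matrix_inv h *v w)))"
    proof (rule sum.cong[OF refl])
      fix h assume "h \<in> {h. h \<in> G \<and> h ** g ** matrix_inv h = g'}"
      then have h: "h \<in> G" "g' = h ** g ** matrix_inv h" by auto
      have c: "\<alpha> (k ** h) g / \<alpha> ?g (k ** h) * \<alpha> ?g k = \<alpha> k g' * (\<alpha> h g / \<alpha> g' h)"
        unfolding h(2) by (rule cocycle_conj[OF g h(1) G(2)])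
      have "\<alpha> (k ** h) g / (\<alpha> ?g (k ** h) * ?N) * x * \<alpha> ?g k = (\<alpha> (k ** h) g / \<alpha> ?g (k ** h) * \<alpha> ?g k) * x / ?N" for x
        by simp
      then show "\<alpha> (k ** h) g / (\<alpha> ?g (k ** h) * ?N) * b (matrix_inv (k ** h) *v (k *v v)) (matrix_inv (k ** h) *v (k *v w)) * \<alpha> ?g k =
          \<alpha> k g' * (\<alpha> h g / (\<alpha> g' h * ?N) * b (matrix_inv h *v v) (matrix_inv h *v w))"
        unfolding inv[OF h(1)] c by simp
    qed
    finally show ?thesis unfolding induced_def sum_distrib_left .
  qed
  ultimately show ?thesis unfolding families_def pbw_conditions_iff by blast
qed

text \<open>At \<open>g\<close> the sum runs over the centralizer. The determinant condition makes
  all summands equal, so nothing cancels, and the division by the order of the centralizer restores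
  \<open>\<omega>\<close>.\<close>

lemma induced_volume_form:
  assumes g: "contributing g" and \<omega>: "kernel_fixed g \<omega>" "\<omega> e1 e2 = 1"
    "\<And>b v w. kernel_fixed g b \<Longrightarrow> b v w = b e1 e2 * \<omega> v w"
    "\<And>h. subspace_det (fixed_perp B g) (h_perp B g h) = \<omega> (h *v e1) (h *v e2)"
  shows "induced g \<omega> g v w = \<omega> v w"
proof -
  have gG: "g \<in> G" using g by (simp add: contributing_def)
  have C: "{h. h \<in> G \<and> h ** g ** matrix_inv h = g} = centralizer G g"
  proof -
    have "h ** g ** matrix_inv h = g \<longleftrightarrow> h ** g = g ** h" if "h \<in> G" for h
      using cancel_right[OF that, of "h ** g ** matrix_inv h" g] that by (simp flip: matrix_mul_assoc)
    then show ?thesis by (auto simp: centralizer_def)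
  qed
  let ?N = "of_nat (card (centralizer G g)) :: complex"
  have "mat 1 \<in> centralizer G g" "finite (centralizer G g)" using finite_G by (auto simp: centralizer_def)
  then have N: "?N \<noteq> 0" by auto
  have "\<alpha> h g / (\<alpha> g h * ?N) * \<omega> (matrix_inv h *v v) (matrix_inv h *v w) = \<omega> v w / ?N" if "h \<in> centralizer G g" for h
  proof -
    have h: "h \<in> G" "h ** g = g ** h" using that by (auto simp: centralizer_def)
    have "\<alpha> h g / \<alpha> g h = \<omega> (h *v e1) (h *v e2)"
      using g that \<omega>(4)[of h] by (simp add: contributing_def field_simps)
    then have "\<alpha> h g / \<alpha> g h * \<omega> (matrix_inv h *v v) (matrix_inv h *v w) = \<omega> v w"
      using volume_form_centralizer[OF \<omega>(1-3) \<omega>(1) h(2), of "matrix_inv h *v v" "matrix_inv h *v w"] h(1) by simp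
    moreover have "\<alpha> h g / (\<alpha> g h * ?N) * x = \<alpha> h g / \<alpha> g h * x / ?N" for x by simp
    ultimately show ?thesis by (simp only:)
  qed
  then have "induced g \<omega> g v w = (\<Sum>h\<in>centralizer G g. \<omega> v w / ?N)"
    unfolding induced_def C by (rule sum.cong[OF refl])
  then show ?thesis using N by simp
qed

lemma conj_class_self: "g \<in> G \<Longrightarrow> g \<in> conj_class G g"
proof -
  have "matrix_inv (mat 1) = (mat 1 :: complex^'n^'n)" using right_inverse[OF one_in_G] by simp
  then have "g = mat 1 ** g ** matrix_inv (mat 1)" by simp
  then show ?thesis unfolding conj_class_def using one_in_G by blast
qed

lemma conj_class_eq:
  assumes "g \<in> G" "g' \<in> conj_class G g"
  shows "conj_class G g' = conj_class G g"
proof -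
  obtain h where h: "h \<in> G" "g' = h ** g ** matrix_inv h" using assms by (auto simp: conj_class_def)
  have eq: "k ** g' ** matrix_inv k = (k ** h) ** g ** matrix_inv (k ** h)" if "k \<in> G" for k
  proof -
    have "k ** g' ** matrix_inv k ** (k ** h) = (k ** h) ** g ** matrix_inv (k ** h) ** (k ** h)"
      using h that by (simp flip: matrix_mul_assoc)
    then show ?thesis by (rule iffD1[OF cancel_right[OF mult_in_G[OF that h(1)]]])
  qed
  show ?thesis
  proof (intro equalityI subsetI)
    fix x assume "x \<in> conj_class G g'"
    then obtain k where "k \<in> G" "x = k ** g' ** matrix_inv k" by (auto simp: conj_class_def)
    then have "x = (k ** h) ** g ** matrix_inv (k ** h)" "k ** h \<in> G" using eq[of k] h by simp_all
    then show "x \<in> conj_class G g" unfolding conj_class_def by blast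
  next
    fix x assume "x \<in> conj_class G g"
    then obtain k where k: "k \<in> G" "x = k ** g ** matrix_inv k" by (auto simp: conj_class_def)
    have "(k ** matrix_inv h) ** h = k" using h by (simp flip: matrix_mul_assoc)
    then have "x = (k ** matrix_inv h) ** g' ** matrix_inv (k ** matrix_inv h)"
      using eq[of "k ** matrix_inv h"] k h by simp
    moreover have "k ** matrix_inv h \<in> G" using k h by simp
    ultimately show "x \<in> conj_class G g'" unfolding conj_class_def by blast
  qed
qed

end

section \<open>The component at the identity\<close>

lemma wedge_axis:
  "wedge (axis k 1) (axis l 1) $ (i, j) =
    (if k = i \<and> l = j then 1 else 0) - (if l = i \<and> k = j then 1 else 0)"
  unfolding wedge_def axis_def by (cases "k = i"; cases "k = j"; cases "l = i"; cases "l = j"; simp)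

lemma ext_square_skew: "x \<in> ext_square \<Longrightarrow> x $ (i, j) = - x $ (j, i)"
  for x :: "complex^('n::finite \<times> 'n)"
proof -
  assume x: "x \<in> ext_square"
  let ?S = "{x :: complex^('n \<times> 'n). \<forall>i j. x $ (i, j) = - x $ (j, i)}"
  have "vec.subspace ?S"
    unfolding vec.subspace_def
  proof (intro conjI ballI allI CollectI)
    fix x y :: "complex^('n \<times> 'n)" and i j assume "x \<in> ?S" "y \<in> ?S"
    then have "x $ (i, j) = - x $ (j, i)" "y $ (i, j) = - y $ (j, i)" by blast+
    then show "(x + y) $ (i, j) = - (x + y) $ (j, i)" by simp
  next
    fix c and x :: "complex^('n \<times> 'n)" and i j assume "x \<in> ?S"
    then have "x $ (i, j) = - x $ (j, i)" by blast
    then show "(c *s x) $ (i, j) = - (c *s x) $ (j, i)" by simp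
  qed simp
  moreover have "{wedge v w | v w. True} \<subseteq> ?S"
    by (auto simp: wedge_def)
  ultimately have "ext_square \<subseteq> ?S"
    unfolding ext_square_def by (intro vec.span_minimal)
  then show ?thesis using x by blast
qed

lemma skew_ext_square:
  fixes x :: "complex^('n::finite \<times> 'n)"
  assumes skew: "\<And>i j. x $ (i, j) = - x $ (j, i)"
  shows "x \<in> ext_square"
proof -
  \<comment> \<open>The factor one half is due to summing over ordered pairs, which meets every
    wedge twice.\<close>
  have "x = (\<Sum>p\<in>UNIV. (x $ p / 2) *s wedge (axis (fst p) 1) (axis (snd p) 1))"
  proof (rule vec_eq_iff[THEN iffD2], rule allI)
    fix q :: "'n \<times> 'n"
    obtain i j where q: "q = (i, j)" by (cases q)
    have "(\<Sum>p\<in>UNIV. (x $ p / 2) *s wedge (axis (fst p) 1) (axis (snd p) 1)) $ q =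
        (\<Sum>p\<in>UNIV. (if p = (i, j) then x $ (i, j) / 2 else 0) - (if p = (j, i) then x $ (j, i) / 2 else 0))"
      unfolding sum_component q
    proof (rule sum.cong[OF refl])
      fix p :: "'n \<times> 'n"
      obtain k l where p: "p = (k, l)" by (cases p)
      show "((x $ p / 2) *s wedge (axis (fst p) 1) (axis (snd p) 1)) $ (i, j) =
          (if p = (i, j) then x $ (i, j) / 2 else 0) - (if p = (j, i) then x $ (j, i) / 2 else 0)"
        unfolding p by (cases "k = i"; cases "k = j"; cases "l = i"; cases "l = j"; simp add: wedge_axis)
    qed
    also have "\<dots> = x $ (i, j) / 2 - x $ (j, i) / 2"
      unfolding sum_subtractf by (simp only: sum.delta finite_code finite UNIV_I if_True)
    also have "\<dots> = x $ q" unfolding q skew[of j i] by simp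
    finally show "x $ q = (\<Sum>p\<in>UNIV. (x $ p / 2) *s wedge (axis (fst p) 1) (axis (snd p) 1)) $ q"
      by (rule sym)
  qed
  also have "\<dots> \<in> ext_square"
    unfolding ext_square_def by (intro vec.span_sum vec.span_scale) (rule vec.span_base, blast)
  finally show ?thesis .
qed

context hermitian_group begin

text \<open>The form \<open>\<Lambda>\<^sup>2 B\<close> identifies the conjugate of \<open>\<Lambda>\<^sup>2 V\<close> with the space of skew forms.\<close>

definition dual_form :: "complex^('n \<times> 'n) \<Rightarrow> complex^'n \<Rightarrow> complex^'n \<Rightarrow> complex" where
  "dual_form x v w = (\<Sum>i\<in>UNIV. \<Sum>j\<in>UNIV. cnj (x $ (i, j)) * B v (axis i 1) * B w (axis j 1))"

lemma dual_form_add: "dual_form (x + y) v w = dual_form x v w + dual_form y v w"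
  and dual_form_scale: "dual_form (c *s x) v w = cnj c * dual_form x v w"
  and dual_form_zero: "dual_form 0 v w = 0"
  by (simp_all add: dual_form_def distrib_right sum.distrib sum_distrib_left mult.assoc)

lemma dual_form_sum: "dual_form (sum f A) v w = (\<Sum>i\<in>A. dual_form (f i) v w)"
  by (induction A rule: infinite_finite_induct) (auto simp: dual_form_add dual_form_zero)

lemma skew_bilinear_dual_form:
  assumes "x \<in> ext_square"
  shows "skew_bilinear (dual_form x)"
proof (rule skew_bilinearI)
  fix v v' w and c :: complex
  show "dual_form x (v + v') w = dual_form x v w + dual_form x v' w"
    by (simp add: dual_form_def B_add_left distrib_left distrib_right sum.distrib)
  show "dual_form x (c *s v) w = c * dual_form x v w"
    by (simp add: dual_form_def B_scale_left sum_distrib_left mult_ac)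
  have "dual_form x v w = (\<Sum>j\<in>UNIV. \<Sum>i\<in>UNIV. cnj (x $ (i, j)) * B v (axis i 1) * B w (axis j 1))"
    unfolding dual_form_def by (rule sum.swap)
  also have "\<dots> = (\<Sum>j\<in>UNIV. \<Sum>i\<in>UNIV. - (cnj (x $ (j, i)) * B w (axis j 1) * B v (axis i 1)))"
  proof (intro sum.cong refl)
    fix i j
    have "x $ (i, j) = - x $ (j, i)" by (rule ext_square_skew[OF assms])
    then show "cnj (x $ (i, j)) * B v (axis i 1) * B w (axis j 1) = - (cnj (x $ (j, i)) * B w (axis j 1) * B v (axis i 1))"
      by simp
  qed
  finally show "dual_form x v w = - dual_form x w v"
    by (simp add: dual_form_def sum_negf)
qed

lemma B_expand_right: "B v w = (\<Sum>i\<in>UNIV. cnj (w $ i) * B v (axis i 1))"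
  by (subst vec_eq_sum_axis[of w]) (simp add: B_sum_right B_scale_right)

text \<open>Nondegeneracy makes the map \<open>L\<close> of products with the standard basis
  injective, hence bijective; the vectors \<open>d i\<close> are its preimages of the standard
  basis.\<close>

lemma dual_basis:
  obtains d where "\<And>i j. B (d i) (axis j 1) = (if i = j then 1 else 0)"
    "\<And>v. v = (\<Sum>i\<in>UNIV. B v (axis i 1) *s d i)"
proof -
  define L where "L v = (\<chi> i. B v (axis i 1))" for v
  define d where "d i = inv_into UNIV L (axis i 1)" for i
  have L: "Vector_Spaces.linear (*s) (*s) L"
    unfolding Vector_Spaces.linear_iff
    by (intro conjI vec.vector_space_axioms) (simp_all add: L_def vec_eq_iff B_add_left B_scale_left)
  have L0: "v = 0" if "L v = 0" for v
    using that by (intro B_nondegenerate) (subst B_expand_right, simp add: L_def vec_eq_iff)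
  have "inj L"
    unfolding vec.linear_inj_iff_eq_0[OF L] using L0 by blast
  then have "surj L" using vec.linear_inj_imp_surj[OF L] by blast
  then have d: "L (d i) = axis i 1" for i unfolding d_def by (rule surj_f_inv_f)
  have dB: "B (d i) (axis j 1) = (if i = j then 1 else 0)" for i j
    using arg_cong[OF d[of i], of "\<lambda>x. x $ j"] by (simp add: L_def axis_def)
  moreover have "v = (\<Sum>i\<in>UNIV. B v (axis i 1) *s d i)" for v
  proof -
    have "B (\<Sum>i\<in>UNIV. B v (axis i 1) *s d i) (axis j 1) = B v (axis j 1)" for j
      by (simp add: B_sum_left B_scale_left dB if_distrib[of "(*) _"] cong: if_cong)
    then have "L (v - (\<Sum>i\<in>UNIV. B v (axis i 1) *s d i)) = 0"
      by (simp add: L_def vec_eq_iff B_diff_left)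
    from L0[OF this] show ?thesis by simp
  qed
  ultimately show thesis by (rule that)
qed

lemma dual_form_eq_0:
  assumes "\<And>v w. dual_form x v w = 0"
  shows "x = 0"
proof -
  obtain d where d: "\<And>i j. B (d i) (axis j 1) = (if i = j then 1 else 0)" by (rule dual_basis) blast
  have "dual_form x (d i) (d j) = cnj (x $ (i, j))" for i j
  proof -
    have "dual_form x (d i) (d j) = (\<Sum>i'\<in>UNIV. \<Sum>j'\<in>UNIV. if j' = j then if i' = i then cnj (x $ (i, j)) else 0 else 0)"
      unfolding dual_form_def by (intro sum.cong refl) (simp add: d)
    then show ?thesis by simp
  qed
  then show ?thesis using assms by (simp add: vec_eq_iff)
qed

lemma dual_form_surj:
  assumes b: "skew_bilinear b"
  obtains x where "x \<in> ext_square" "dual_form x = b"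
proof -
  obtain d where d: "\<And>i j. B (d i) (axis j 1) = (if i = j then 1 else 0)"
    "\<And>v. v = (\<Sum>i\<in>UNIV. B v (axis i 1) *s d i)" by (rule dual_basis) blast
  \<comment> \<open>Conjugated, since \<open>dual_form\<close> is conjugate-linear in the
    tensor.\<close>
  define x where "x = (\<chi> p. cnj (b (d (fst p)) (d (snd p))))"
  have b0: "b 0 w = 0" "b w 0 = 0" for w
    using skew_bilinearD(3,4)[OF b, of 0 0 w] skew_bilinearD(4)[OF b, of w 0 0] by simp_all
  have b_sum: "b (sum f A) w = (\<Sum>i\<in>A. b (f i) w)" "b w (sum f A) = (\<Sum>i\<in>A. b w (f i))"
    for f :: "'n \<Rightarrow> complex^'n" and A w
    by (induction A rule: infinite_finite_induct) (simp_all add: b0 skew_bilinearD(1,2)[OF b])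
  have "x \<in> ext_square"
  proof (rule skew_ext_square)
    fix i j
    show "x $ (i, j) = - x $ (j, i)"
      using skew_bilinearD(5)[OF b, of "d i" "d j"] by (simp add: x_def)
  qed
  moreover have "dual_form x v w = b v w" for v w
  proof -
    have "b v w = b (\<Sum>i\<in>UNIV. B v (axis i 1) *s d i) (\<Sum>j\<in>UNIV. B w (axis j 1) *s d j)"
      using d(2)[of v] d(2)[of w] by simp
    also have "\<dots> = (\<Sum>i\<in>UNIV. B v (axis i 1) * b (d i) (\<Sum>j\<in>UNIV. B w (axis j 1) *s d j))"
      by (simp only: b_sum(1) skew_bilinearD(3)[OF b])
    also have "\<dots> = dual_form x v w"
      by (simp add: b_sum(2) skew_bilinearD(4)[OF b] dual_form_def x_def sum_distrib_left mult_ac)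
    finally show ?thesis ..
  qed
  ultimately show thesis using that by blast
qed

text \<open>Invariance of \<open>B\<close> moves \<open>h\<close> from the first argument to its
  inverse \<open>k\<close> in the second. Expanding \<open>k *v axis i 1\<close> there yields
  conjugated matrix entries, and these are what the conjugate of
  \<open>tensor_square_act k x\<close> contains.\<close>

lemma dual_form_act:
  assumes G: "h \<in> G" "k \<in> G" and hk: "\<And>v. h *v (k *v v) = v"
  shows "dual_form x (h *v v) (h *v w) = dual_form (tensor_square_act k x) v w"
proof -
  have B: "B (h *v v) (axis i 1) = (\<Sum>r\<in>UNIV. cnj (k $ r $ i) * B v (axis r 1))" for v i
  proof -
    have "B (h *v v) (axis i 1) = B v (k *v axis i 1)"
      using B_invariant[OF G(1), of v "k *v axis i 1"] by (simp add: hk)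
    also have "\<dots> = (\<Sum>r\<in>UNIV. cnj (k $ r $ i) * B v (axis r 1))"
      by (subst B_expand_right) (simp add: matrix_vector_mult_def axis_def if_distrib[of "(*) _"] cong: if_cong)
    finally show ?thesis .
  qed
  have pairs: "(\<Sum>i\<in>UNIV. \<Sum>j\<in>UNIV. f i j) = (\<Sum>p\<in>UNIV. f (fst p) (snd p))" for f :: "'n \<Rightarrow> 'n \<Rightarrow> complex"
    by (simp add: sum.cartesian_product case_prod_unfold)
  let ?t = "\<lambda>i j r s. cnj (k $ r $ i * k $ s $ j * x $ (i, j)) * B v (axis r 1) * B w (axis s 1)"
  have "dual_form x (h *v v) (h *v w) = (\<Sum>i\<in>UNIV. \<Sum>j\<in>UNIV. \<Sum>r\<in>UNIV. \<Sum>s\<in>UNIV. ?t i j r s)"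
    unfolding dual_form_def B by (simp add: sum_product sum_distrib_left mult_ac)
  also have "\<dots> = (\<Sum>p\<in>UNIV. \<Sum>q\<in>UNIV. ?t (fst p) (snd p) (fst q) (snd q))"
    unfolding pairs ..
  also have "\<dots> = (\<Sum>q\<in>UNIV. \<Sum>p\<in>UNIV. ?t (fst p) (snd p) (fst q) (snd q))"
    by (rule sum.swap)
  also have "\<dots> = dual_form (tensor_square_act k x) v w"
    unfolding dual_form_def pairs tensor_square_act_def by (simp add: sum_distrib_right)
  finally show ?thesis .
qed

lemma dual_form_invariant_iff:
  "(\<forall>g\<in>G. tensor_square_act g x = x) \<longleftrightarrow> (\<forall>g\<in>G. \<forall>v w. dual_form x (g *v v) (g *v w) = dual_form x v w)"
proof
  assume inv: "\<forall>g\<in>G. tensor_square_act g x = x"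
  show "\<forall>g\<in>G. \<forall>v w. dual_form x (g *v v) (g *v w) = dual_form x v w"
  proof (intro ballI allI)
    fix g v w assume "g \<in> G"
    then show "dual_form x (g *v v) (g *v w) = dual_form x v w"
      using inv by (subst dual_form_act[of _ "matrix_inv g"]) auto
  qed
next
  assume inv: "\<forall>g\<in>G. \<forall>v w. dual_form x (g *v v) (g *v w) = dual_form x v w"
  show "\<forall>g\<in>G. tensor_square_act g x = x"
  proof
    fix g assume g: "g \<in> G"
    have "dual_form (tensor_square_act g x + (- 1) *s x) v w = 0" for v w
      using dual_form_act[of "matrix_inv g" g x v w] inv g
      unfolding dual_form_add dual_form_scale by simp
    from dual_form_eq_0[OF this] show "tensor_square_act g x = x" by (simp add: vec_eq_iff)
  qed
qed

definition identity_family :: "complex^('n \<times> 'n) \<Rightarrow> 'n form_family" where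
  "identity_family x g = (if g = mat 1 then dual_form x else 0)"

lemma conj_eq_one_iff:
  assumes "g \<in> G" "h \<in> G"
  shows "h ** g ** matrix_inv h = mat 1 \<longleftrightarrow> g = mat 1"
proof
  assume "h ** g ** matrix_inv h = mat 1"
  then have "matrix_inv h ** (h ** g ** matrix_inv h) ** h = matrix_inv h ** mat 1 ** h" by simp
  then show "g = mat 1" using assms by (simp flip: matrix_mul_assoc)
qed (use assms in simp)

lemma identity_family_families:
  assumes "x \<in> ext_square_invariants G"
  shows "identity_family x \<in> families"
proof -
  have "x \<in> ext_square \<and> (\<forall>g\<in>G. tensor_square_act g x = x)"
    using assms unfolding ext_square_invariants_def by (rule CollectD)
  then have x: "x \<in> ext_square" "\<forall>g\<in>G. \<forall>v w. dual_form x (g *v v) (g *v w) = dual_form x v w"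
    by (blast, intro dual_form_invariant_iff[THEN iffD1]) blast
  have "skew_bilinear (identity_family x g)" for g
  proof (cases "g = mat 1")
    case False
    then have "identity_family x g = (\<lambda>v w. 0)" by (simp add: identity_family_def fun_eq_iff)
    then show ?thesis using skew_bilinearI[of "\<lambda>v w. 0"] by simp
  qed (simp add: identity_family_def skew_bilinear_dual_form[OF x(1)])
  moreover have "jacobi_sum g (identity_family x g) u v w = 0" for g u v w
    by (simp add: identity_family_def jacobi_sum_def)
  moreover have "identity_family x (h ** g ** matrix_inv h) (h *v v) (h *v w) * \<alpha> (h ** g ** matrix_inv h) h =
      \<alpha> h g * identity_family x g v w" if "g \<in> G" "h \<in> G" for g h v w
    using that x(2) by (simp add: identity_family_def conj_eq_one_iff)
  moreover have "identity_family x g = 0" if "g \<notin> G" for g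
    using that one_in_G by (auto simp: identity_family_def)
  ultimately show ?thesis unfolding families_def pbw_conditions_iff by blast
qed

lemma families_at_identity:
  assumes "a \<in> families"
  obtains x where "x \<in> ext_square_invariants G" "a (mat 1) = dual_form x"
proof -
  obtain x where x: "x \<in> ext_square" "dual_form x = a (mat 1)"
    by (rule dual_form_surj[OF familiesD(2)[OF assms one_in_G]]) blast
  \<comment> \<open>The identity is its own conjugate and \<alpha> is normalized, so equivariance at
    \<open>mat 1\<close> is plain invariance.\<close>
  have "\<forall>g\<in>G. \<forall>v w. dual_form x (g *v v) (g *v w) = dual_form x v w"
    using familiesD(3)[OF assms one_in_G] unfolding x(2) by simp
  then have "\<forall>g\<in>G. tensor_square_act g x = x" by (rule dual_form_invariant_iff[THEN iffD2])
  with x(1) have "x \<in> ext_square_invariants G" unfolding ext_square_invariants_def by blast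
  then show thesis using x(2)[symmetric] by (rule that)
qed

section \<open>A basis of the space of families\<close>

text \<open>Supplies, for every class, a basis family together with the evaluation
  \<open>b g e1 e2\<close> that reads off the corresponding coordinate of any family
  \<open>b\<close>.\<close>

lemma contributing_class_family:
  assumes "C \<in> contributing_classes G \<alpha> B"
  shows "\<exists>g e1 e2 A. g \<in> G \<and> g \<noteq> mat 1 \<and> C = conj_class G g \<and> A \<in> families \<and> A g e1 e2 = 1 \<and>
    (\<forall>g'. g' \<notin> C \<longrightarrow> A g' = 0) \<and> (\<forall>b v w. b \<in> families \<longrightarrow> b g v w = b g e1 e2 * A g v w)"
proof -
  obtain g where g: "contributing g" "C = conj_class G g"
    using assms unfolding contributing_classes_eq by blast
  then have gG: "g \<in> G" and dim: "vec.dim (fixed_perp B g) = 2"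
    using codim_eq_2_iff unfolding contributing_def by blast+
  obtain \<omega> e1 e2 where \<omega>: "kernel_fixed g \<omega>" "\<omega> e1 e2 = 1"
    "\<And>b v w. kernel_fixed g b \<Longrightarrow> b v w = b e1 e2 * \<omega> v w"
    "\<And>h. subspace_det (fixed_perp B g) (h_perp B g h) = \<omega> (h *v e1) (h *v e2)"
    by (rule volume_form[OF gG dim]) blast
  have "fixed_space (mat 1) = (UNIV :: (complex^'n) set)" by (auto simp: fixed_space_def)
  then have "g \<noteq> mat 1" using \<omega>(1,2) by (auto simp: kernel_fixed_def)
  have A: "induced g \<omega> g v w = \<omega> v w" for v w
    by (rule induced_volume_form[OF g(1) \<omega>])
  show ?thesis
  proof (intro exI conjI allI impI)
    show "induced g \<omega> \<in> families" by (rule induced_families[OF gG dim \<omega>(1)])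
    show "induced g \<omega> g e1 e2 = 1" unfolding A by (rule \<omega>(2))
    show "induced g \<omega> g' = 0" if "g' \<notin> C" for g' using that g(2) by (intro induced_eq_0) simp
    show "b g v w = b g e1 e2 * induced g \<omega> g v w" if "b \<in> families" for b v w
      unfolding A by (rule \<omega>(3)[OF kernel_fixed_families[OF that gG \<open>g \<noteq> mat 1\<close>]])
  qed (rule gG g \<open>g \<noteq> mat 1\<close>)+
qed

text \<open>Equivariance spreads a zero from one representative over its class, and away from the
  identity only contributing elements can carry a nonzero form. So the coordinates of a family
  determine it.\<close>

lemma families_eq_0:
  assumes a: "a \<in> families" and one: "a (mat 1) = 0"
    and classes: "\<And>C. C \<in> contributing_classes G \<alpha> B \<Longrightarrow> \<exists>g\<in>G. C = conj_class G g \<and> a g = 0"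
  shows "a = 0"
proof
  fix g
  show "a g = 0 g"
  proof (cases "g \<in> G \<and> g \<noteq> mat 1 \<and> contributing g")
    case True
    then have gG: "g \<in> G" by simp
    obtain g' where g': "g' \<in> G" "conj_class G g = conj_class G g'" "a g' = 0"
      using classes[of "conj_class G g"] True unfolding contributing_classes_eq by blast
    have "g' \<in> conj_class G g" using conj_class_self[OF g'(1)] g'(2) by simp
    then obtain h where h: "h \<in> G" "g' = h ** g ** matrix_inv h" by (auto simp: conj_class_def)
    have "a g v w = 0" for v w
      using familiesD(3)[OF a gG h(1), of v w] g'(3) h gG by simp
    then show ?thesis by (simp add: fun_eq_iff)
  next
    case False
    then show ?thesis
      using one familiesD(1)[OF a] not_contributing[OF a] by (cases "g \<in> G"; cases "g = mat 1") auto
  qed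
qed

lemma finite_contributing_classes: "finite (contributing_classes G \<alpha> B)"
  unfolding contributing_classes_eq by (rule finite_imageI, rule finite_subset[OF _ finite_G]) (auto simp: contributing_def)

text \<open>The basis consists of one family for each contributing class and the identity families
  of a basis of the invariants. The two kinds separate: class families vanish at
  \<open>mat 1\<close>, identity families vanish elsewhere, and a class family vanishes on the
  representatives of the other classes.\<close>

lemma dim_families:
  "fam.dim families = card (contributing_classes G \<alpha> B) + vec.dim (ext_square_invariants G)"
proof -
  let ?CC = "contributing_classes G \<alpha> B"
  let ?P = "\<lambda>C (g, e1, e2, A). g \<in> G \<and> g \<noteq> mat 1 \<and> C = conj_class G g \<and> A \<in> families \<and> A g e1 e2 = 1 \<and>
    (\<forall>g'. g' \<notin> C \<longrightarrow> A g' = 0) \<and> (\<forall>b v w. b \<in> families \<longrightarrow> b g v w = b g e1 e2 * A g v w)"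
  have "\<forall>C\<in>?CC. \<exists>p. ?P C p"
    unfolding split_paired_Ex prod.case by (intro ballI contributing_class_family)
  then obtain F where F: "\<forall>C\<in>?CC. ?P C (F C)" by (rule bchoice[THEN exE])
  define rep where "rep C = fst (F C)" for C
  define e1 where "e1 C = fst (snd (F C))" for C
  define e2 where "e2 C = fst (snd (snd (F C)))" for C
  define A where "A C = snd (snd (snd (F C)))" for C
  have "rep C \<in> G \<and> rep C \<noteq> mat 1 \<and> C = conj_class G (rep C) \<and> A C \<in> families \<and> A C (rep C) (e1 C) (e2 C) = 1 \<and>
      (\<forall>g'. g' \<notin> C \<longrightarrow> A C g' = 0) \<and> (\<forall>b v w. b \<in> families \<longrightarrow> b (rep C) v w = b (rep C) (e1 C) (e2 C) * A C (rep C) v w)"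
    if "C \<in> ?CC" for C
    using F[THEN bspec, OF that] unfolding rep_def e1_def e2_def A_def case_prod_unfold .
  then have rep: "\<And>C. C \<in> ?CC \<Longrightarrow> rep C \<in> G" "\<And>C. C \<in> ?CC \<Longrightarrow> rep C \<noteq> mat 1" "\<And>C. C \<in> ?CC \<Longrightarrow> C = conj_class G (rep C)"
    and A: "\<And>C. C \<in> ?CC \<Longrightarrow> A C \<in> families" "\<And>C. C \<in> ?CC \<Longrightarrow> A C (rep C) (e1 C) (e2 C) = 1"
      "\<And>C g'. C \<in> ?CC \<Longrightarrow> g' \<notin> C \<Longrightarrow> A C g' = 0"
      "\<And>C b v w. C \<in> ?CC \<Longrightarrow> b \<in> families \<Longrightarrow> b (rep C) v w = b (rep C) (e1 C) (e2 C) * A C (rep C) v w"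
    by blast+
  have A_rep: "A C (rep C') = 0" if "C \<in> ?CC" "C' \<in> ?CC" "C \<noteq> C'" for C C'
  proof (rule A(3)[OF that(1)])
    show "rep C' \<notin> C"
      using conj_class_eq[OF rep(1)[OF that(1)], of "rep C'"] rep(3)[OF that(1)] rep(3)[OF that(2)] that(3) by auto
  qed
  have A_one: "A C (mat 1) = 0" if "C \<in> ?CC" for C
  proof (rule A(3)[OF that])
    show "mat 1 \<notin> C"
    proof
      assume "mat 1 \<in> C"
      then have "mat 1 \<in> conj_class G (rep C)" by (subst (asm) rep(3)[OF that])
      then obtain h where "h \<in> G" "mat 1 = h ** rep C ** matrix_inv h" by (auto simp: conj_class_def)
      then show False using conj_eq_one_iff[OF rep(1)[OF that]] rep(2)[OF that] by metis
    qed
  qed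
  obtain E where E: "E \<subseteq> ext_square_invariants G" "vec.independent E" "ext_square_invariants G \<subseteq> vec.span E"
    "card E = vec.dim (ext_square_invariants G)" by (rule vec.basis_exists)
  have finE: "finite E" using vec.finiteI_independent[OF E(2)] .
  let ?\<Phi> = "identity_family" and ?s = "\<lambda>(c::complex) (a :: 'n form_family) g v w. c * a g v w"
  have \<Phi>_one: "?\<Phi> x (mat 1) = dual_form x" and \<Phi>_other: "g \<noteq> mat 1 \<Longrightarrow> ?\<Phi> x g = 0" for x g
    by (simp_all add: identity_family_def)
  have inj_A: "inj_on A ?CC"
  proof (rule inj_onI, rule ccontr)
    fix C C' assume *: "C \<in> ?CC" "C' \<in> ?CC" "A C = A C'" "C \<noteq> C'"
    then show False using A(2)[OF *(2)] A_rep[OF *(1,2,4)] by simp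
  qed
  have inj_\<Phi>: "inj ?\<Phi>"
  proof (rule injI)
    fix x y assume "?\<Phi> x = ?\<Phi> y"
    then have "dual_form x = dual_form y" using \<Phi>_one by metis
    then have "dual_form (x + (- 1) *s y) v w = 0" for v w
      unfolding dual_form_add dual_form_scale by simp
    from dual_form_eq_0[OF this] show "x = y" by (simp add: vec_eq_iff)
  qed
  have disjoint: "A ` ?CC \<inter> ?\<Phi> ` E = {}"
  proof -
    have "A C \<noteq> ?\<Phi> x" if C: "C \<in> ?CC" for C x
      using A(2)[OF C] \<Phi>_other[OF rep(2)[OF C], of x] by auto
    then show ?thesis by blast
  qed
  let ?Bs = "A ` ?CC \<union> ?\<Phi> ` E"
  have fin: "finite ?Bs" using finite_contributing_classes finE by simp
  have card: "card ?Bs = card ?CC + card E"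
    using card_Un_disjoint[OF _ _ disjoint] finite_contributing_classes finE
      card_image[OF inj_A] card_image[OF inj_on_subset[OF inj_\<Phi>]] by simp
  have sub: "?Bs \<subseteq> families" using A(1) identity_family_families E(1) by blast
  have indep: "fam.independent ?Bs"
  proof (rule fam.independent_if_scalars_zero[OF fin])
    fix f x assume sum0: "(\<Sum>x\<in>?Bs. ?s (f x) x) = 0" and x: "x \<in> ?Bs"
    have "(\<Sum>x\<in>?Bs. ?s (f x) x) = (\<Sum>x\<in>A ` ?CC. ?s (f x) x) + (\<Sum>x\<in>?\<Phi> ` E. ?s (f x) x)"
      by (rule sum.union_disjoint) (use finite_contributing_classes finE disjoint in auto)
    also have "\<dots> = (\<Sum>C\<in>?CC. ?s (f (A C)) (A C)) + (\<Sum>e\<in>E. ?s (f (?\<Phi> e)) (?\<Phi> e))"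
      unfolding sum.reindex[OF inj_A] sum.reindex[OF inj_on_subset[OF inj_\<Phi> subset_UNIV]] o_def ..
    finally have "(\<Sum>x\<in>?Bs. ?s (f x) x) = (\<Sum>C\<in>?CC. ?s (f (A C)) (A C)) + (\<Sum>e\<in>E. ?s (f (?\<Phi> e)) (?\<Phi> e))" .
    with sum0 have sum1: "(\<Sum>C\<in>?CC. ?s (f (A C)) (A C)) + (\<Sum>e\<in>E. ?s (f (?\<Phi> e)) (?\<Phi> e)) = 0" by (simp only:)
    have eq: "(\<Sum>C\<in>?CC. f (A C) * A C g v w) + (\<Sum>e\<in>E. f (?\<Phi> e) * ?\<Phi> e g v w) = 0" for g v w
      using fun_cong[OF fun_cong[OF fun_cong[OF sum1, of g], of v], of w] by (simp add: sum_apply)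
    have fA: "f (A C) = 0" if C: "C \<in> ?CC" for C
    proof -
      have "(\<Sum>C'\<in>?CC. f (A C') * A C' (rep C) (e1 C) (e2 C)) = (\<Sum>C'\<in>?CC. if C' = C then f (A C) else 0)"
        by (rule sum.cong) (auto simp: A(2)[OF C] A_rep C)
      also have "\<dots> = f (A C)" using C finite_contributing_classes by simp
      finally show ?thesis using eq[of "rep C" "e1 C" "e2 C"] \<Phi>_other[OF rep(2)[OF C]] by simp
    qed
    \<comment> \<open>A relation among identity families becomes a relation among the tensors with
      conjugated coefficients.\<close>
    have "dual_form (\<Sum>e\<in>E. cnj (f (?\<Phi> e)) *s e) v w = 0" for v w
      using eq[of "mat 1" v w] by (simp add: A_one \<Phi>_one dual_form_sum dual_form_scale)
    then have "(\<Sum>e\<in>E. cnj (f (?\<Phi> e)) *s e) = 0" by (rule dual_form_eq_0)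
    then have "\<forall>e\<in>E. cnj (f (?\<Phi> e)) = 0"
      by (rule E(2)[unfolded vec.independent_explicit, THEN conjunct2, THEN spec, THEN mp])
    then show "f x = 0" using x fA by auto
  qed
  have "families \<subseteq> fam.span ?Bs"
  proof
    fix b assume b: "b \<in> families"
    obtain x where x: "x \<in> ext_square_invariants G" "b (mat 1) = dual_form x"
      by (rule families_at_identity[OF b])
    \<comment> \<open>The combination of basis families and an identity family that has the
      coordinates of \<open>b\<close>; the difference vanishes at \<open>mat 1\<close> and at all
      representatives.\<close>
    define y where "y = (\<Sum>C\<in>?CC. ?s (b (rep C) (e1 C) (e2 C)) (A C)) + ?\<Phi> x"
    have y_apply: "y g v w = (\<Sum>C\<in>?CC. b (rep C) (e1 C) (e2 C) * A C g v w) + ?\<Phi> x g v w" for g v w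
      by (simp add: y_def sum_apply)
    have "y \<in> families"
      unfolding y_def
      by (intro fam.subspace_add[OF subspace_families] fam.subspace_sum[OF subspace_families]
        fam.subspace_scale[OF subspace_families] A(1) identity_family_families x(1))
    then have by_fam: "b - y \<in> families" using b by (intro fam.subspace_diff[OF subspace_families])
    have by_one: "(b - y) (mat 1) = 0"
      by (simp add: fun_eq_iff y_apply A_one \<Phi>_one x(2))
    have by_rep: "(b - y) (rep C) = 0" if C: "C \<in> ?CC" for C
    proof (intro ext)
      fix v w
      have "y (rep C) v w = (\<Sum>C'\<in>?CC. if C' = C then b (rep C) (e1 C) (e2 C) * A C (rep C) v w else 0)"
        unfolding y_apply \<Phi>_other[OF rep(2)[OF C]] zero_fun_apply add_0_right
        by (rule sum.cong) (auto simp: A_rep C)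
      also have "\<dots> = b (rep C) v w"
        using C finite_contributing_classes A(4)[OF C b, of v w] by simp
      finally show "(b - y) (rep C) v w = 0 v w" by simp
    qed
    have "b - y = 0"
      using by_fam by_one
    proof (rule families_eq_0)
      fix C assume C: "C \<in> ?CC"
      show "\<exists>g\<in>G. C = conj_class G g \<and> (b - y) g = 0"
        by (rule bexI[where x = "rep C"], rule conjI, rule rep(3)[OF C], rule by_rep[OF C], rule rep(1)[OF C])
    qed
    then have "b = y" by simp
    have \<Phi>_span: "identity_family x \<in> fam.span ?Bs"
    proof -
      have "x \<in> vec.span E" using E(3) x(1) by blast
      then obtain c where c: "x = (\<Sum>e\<in>E. c e *s e)"
        unfolding vec.span_finite[OF finE] by blast
      have "?\<Phi> x = (\<Sum>e\<in>E. ?s (cnj (c e)) (?\<Phi> e))"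
      proof (intro ext)
        fix g v w
        show "?\<Phi> x g v w = (\<Sum>e\<in>E. ?s (cnj (c e)) (?\<Phi> e)) g v w"
          by (cases "g = mat 1") (simp_all add: sum_apply identity_family_def c dual_form_sum dual_form_scale)
      qed
      moreover have "\<dots> \<in> fam.span ?Bs"
        by (intro fam.span_sum fam.span_scale) (rule fam.span_base, blast)
      ultimately show ?thesis by (simp only:)
    qed
    have "(\<Sum>C\<in>?CC. ?s (b (rep C) (e1 C) (e2 C)) (A C)) \<in> fam.span ?Bs"
      by (intro fam.span_sum fam.span_scale) (rule fam.span_base, blast)
    then have "y \<in> fam.span ?Bs"
      unfolding y_def using \<Phi>_span by (rule fam.span_add)
    then show "b \<in> fam.span ?Bs" by (simp only: \<open>b = y\<close>[symmetric])
  qed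
  then show ?thesis
    using fam.dim_unique[OF sub _ indep card] E(4) by simp
qed

end

theorem corollary2p13:
  fixes G :: "(complex^'n^'n) set"
    and \<alpha> :: "complex^'n^'n \<Rightarrow> complex^'n^'n \<Rightarrow> complex"
    and B :: "complex^'n \<Rightarrow> complex^'n \<Rightarrow> complex"
    and \<sigma> :: "('n, complex) symm \<Rightarrow> ('n, complex) tensor"
  assumes "finite G" and "subgroup G GL"
    and "normalized_two_cocycle G \<alpha>"
    and "invariant_hermitian_form G B"
    and "graded_section \<sigma>"
  shows "fam.subspace (hecke_families G \<alpha> \<sigma>) \<and>
         fam.dim (hecke_families G \<alpha> \<sigma>) =
           card (contributing_classes G \<alpha> B) + vec.dim (ext_square_invariants G)"
proof -
  interpret hermitian_group G \<alpha> B
    by (intro hermitian_group.intro twisted_group.intro hermitian_group_axioms.intro assms)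
  show ?thesis
    unfolding hecke_families_eq[OF assms(5)] using subspace_families dim_families by blast
qed

end
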